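(* Let $k,p,N$ be positive integers and let $X_1,\dots,X_N\in\mathbb{R}^{k\times p}$ be independent random matrices, each with i.i.d. $N(0,1)$ entries. Define the random operator $\mathfrak{X}:\mathbb{R}^{k\times p}\to\mathbb{R}^N$ by $[\mathfrak{X}(\Theta)]_i=\operatorname{trace}(X_i^T\Theta)$. Then, with probability at least $1-2\exp(-N/32)$, $$\frac{\|\mathfrak{X}(\Theta)\|_2}{\sqrt{N}}\ \ge\ \frac14\|\Theta\|_F-\left(\sqrt{\frac{k}{N}}+\sqrt{\frac{p}{N}}\right)\|\Theta\|_1\qquad\text{for all }\Theta\in\mathbb{R}^{k\times p}.$$
   Context: $\|\Theta\|_1$ denotes the nuclear norm (sum of singular values) and $\|\Theta\|_F$ the Frobenius norm; $\|\cdot\|_2$ is the Euclidean norm on $\mathbb{R}^N$. *)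

theory Defs
  imports "HOL-Probability.Probability"
begin

text \<open>A \<open>k \<times> p\<close> real matrix has type \<open>real^'p^'k\<close>: the row index is outermost.\<close>

definition singular_space :: "real^'p^'k \<Rightarrow> real \<Rightarrow> (real^'p) set" where
  "singular_space A s = {v. (transpose A ** A) *v v = s\<^sup>2 *\<^sub>R v}"

definition singular_values :: "real^'p^'k \<Rightarrow> real set" where
  "singular_values A = {s. s \<ge> 0 \<and> (\<exists>v. v \<noteq> 0 \<and> v \<in> singular_space A s)}"

text \<open>The sum of the singular values, each counted with its multiplicity. Since
  \<open>transpose A ** A\<close> is symmetric, the multiplicity of an eigenvalue is the dimension of
  its eigenspace.\<close>

definition nuclear_norm :: "real^'p^'k \<Rightarrow> real" where
  "nuclear_norm A = (\<Sum>s\<in>singular_values A. real (dim (singular_space A s)) * s)"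

definition frobenius_norm :: "real^'p^'k \<Rightarrow> real" where
  "frobenius_norm A = sqrt (\<Sum>i\<in>UNIV. \<Sum>j\<in>UNIV. (A $ i $ j)\<^sup>2)"

definition trace_operator :: "('n \<Rightarrow> real^'p^'k) \<Rightarrow> real^'p^'k \<Rightarrow> real^'n" where
  "trace_operator X \<Theta> = (\<chi> i. trace (transpose (X i) ** \<Theta>))"

definition iid_std_normal_entries :: "'a measure \<Rightarrow> ('a \<Rightarrow> real^'p^'k) \<Rightarrow> bool" where
  "iid_std_normal_entries M Y \<longleftrightarrow>
     prob_space.indep_vars M (\<lambda>_. borel) (\<lambda>(a, b) \<omega>. Y \<omega> $ a $ b) (UNIV :: ('k \<times> 'p) set) \<and>
     (\<forall>a b. distributed M lborel (\<lambda>\<omega>. Y \<omega> $ a $ b) std_normal_density)"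

lemma frobenius_norm_eq_norm: "frobenius_norm A = norm A"
  by (simp add: frobenius_norm_def norm_vec_def L2_set_def sum_nonneg)

text \<open>Finiteness matters because a sum over an infinite set is 0 by convention.\<close>

lemma finite_singular_values: "finite (singular_values (A :: real^'p^'k))"
proof -
  let ?B = "transpose A ** A"
  define f where "f s = (SOME v. v \<noteq> 0 \<and> v \<in> singular_space A s)" for s
  have f: "s \<ge> 0 \<and> f s \<noteq> 0 \<and> ?B *v f s = s\<^sup>2 *\<^sub>R f s" if "s \<in> singular_values A" for s
  proof -
    have "\<exists>v. v \<noteq> 0 \<and> v \<in> singular_space A s" "s \<ge> 0"
      using that by (auto simp: singular_values_def)
    from someI_ex[OF this(1)] this(2) show ?thesis
      unfolding f_def by (auto simp: singular_space_def)
  qed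
  have gram: "(?B *v x) \<bullet> y = (A *v x) \<bullet> (A *v y)" for x y
  proof -
    have "?B *v x = (A *v x) v* A"
      by (metis matrix_vector_mul_assoc transpose_matrix_vector)
    then show ?thesis
      by (metis dot_lmul_matrix)
  qed
  have sym: "(?B *v x) \<bullet> y = x \<bullet> (?B *v y)" for x y
    by (metis gram inner_commute)
  have orth: "f s \<bullet> f t = 0"
    if "s \<in> singular_values A" "t \<in> singular_values A" "s \<noteq> t" for s t
  proof -
    have "s\<^sup>2 * (f s \<bullet> f t) = t\<^sup>2 * (f s \<bullet> f t)"
      using sym[of "f s" "f t"] f[OF that(1)] f[OF that(2)]
      by (metis inner_scaleR_left inner_scaleR_right)
    moreover have "s\<^sup>2 \<noteq> t\<^sup>2"
      using f[OF that(1)] f[OF that(2)] that(3) by simp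
    ultimately show ?thesis by simp
  qed
  have inj: "inj_on f (singular_values A)"
    using orth f by (intro inj_onI) (metis inner_eq_zero_iff)
  have "pairwise orthogonal (f ` singular_values A)"
    using orth by (auto simp: pairwise_def orthogonal_def)
  moreover have "0 \<notin> f ` singular_values A"
    using f by force
  ultimately have "independent (f ` singular_values A)"
    by (rule pairwise_orthogonal_independent)
  then have "finite (f ` singular_values A)"
    by (rule independent_imp_finite)
  then show ?thesis
    using inj by (simp add: finite_image_iff)
qed

end

theory Submission imports Defs
begin

text \<open>Put \<open>c = sqrt k + sqrt p\<close> and let \<open>\<Theta>\<close> have Frobenius norm 1 and nuclear norm \<open>t\<close>. By
  Cauchy-Schwarz \<open>sqrt N\<close> times the norm of the image of \<open>\<Theta>\<close> is at least the sum of the clipped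
  values \<open>min \<bar>X\<^sub>i \<bullet> \<Theta>\<bar> (3/2)\<close>, each of mean at least 11/16. Replacing the \<open>X\<^sub>i\<close> one at a time,
  symmetrisation and contraction bound the supremum over \<open>\<Theta>\<close> of the centred sum, minus
  \<open>c t sqrt N\<close>, by the expected supremum of \<open>2 (X\<^sub>1 + \<dots> + X\<^sub>N) \<bullet> \<Theta> - c t sqrt N\<close>, while Hoeffding's
  lemma controls the exponential moment. Only \<open>c t \<le> sqrt N / 4\<close> matters, as otherwise the claim
  is void; there the expected supremum is at most \<open>N/4\<close>, because
  the Sudakov-Fernique comparison of \<open>G \<bullet> u v\<^sup>T\<close> with \<open>g \<bullet> u + h \<bullet> v\<close> gives
  \<open>E max (c/2) \<parallel>G\<parallel> \<le> c\<close> for a standard Gaussian matrix \<open>G\<close> and its operator norm. This avoids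
  Gordon's inequality, Gaussian concentration and peeling.\<close>

section \<open>The spectral theorem and the nuclear norm\<close>

text \<open>The constants are tuned to each other. A failure at \<Theta> pushes the penalised
  centred sum above (11/16 - 1/4) N = 7N/16, against N/4 for the expected supremum: a gap of 3N/16.
  Clipping at 3/2 costs 9 l^2 N / 32 in the exponent by Hoeffding's lemma, and the largest value of
  3 l / 16 - 9 l^2 / 32 is exactly 1/32, at l = 1/3. The obstacle is that t varies. For t up to R/c
  the supremum of t (2 ||G|| - c) is R/c times a positive part, which a bound on the expectation of
  ||G|| does not control. The floor c/2 under the operator norm removes the positive part, and the
  comparison inequality accepts it because it allows a deterministic offset for each index. The same
  kind of offset, \<open>h\<close>, carries the penalty c t sqrt N through symmetrisation, so all
  values of t are treated at once. All suprema run over finite sets, with bounds independent of the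
  set. Measurability is then elementary, and the comparison concerns finitely many rank-one matrices
  instead of the operator norm itself.\<close>

lemma selfadjoint_eigenvectors_span:
  fixes f :: "'a::euclidean_space \<Rightarrow> 'a"
  assumes lin: "linear f" and sym: "\<And>x y. f x \<bullet> y = x \<bullet> f y"
  shows "span {v. \<exists>c. f v = c *\<^sub>R v} = UNIV"
proof (rule ccontr)
  define W where "W = span {v. \<exists>c. f v = c *\<^sub>R v}"
  assume "span {v. \<exists>c. f v = c *\<^sub>R v} \<noteq> UNIV"
  then obtain y where y: "y \<notin> W" by (auto simp: W_def)
  define Wp where "Wp = {x. \<forall>w\<in>W. x \<bullet> w = 0}"
  have subW: "subspace W" by (simp add: W_def)
  have subWp: "subspace Wp"
    by (auto simp: Wp_def subspace_def inner_add_left)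
  have fW: "f w \<in> W" if "w \<in> W" for w
    using that unfolding W_def
  proof (induction rule: span_induct_alt)
    case base then show ?case using linear_0[OF lin] by (simp add: span_zero)
  next
    case (step c x y)
    then obtain d where "f x = d *\<^sub>R x" by auto
    then have "f (c *\<^sub>R x + y) = (c * d) *\<^sub>R x + f y"
      using lin by (simp add: linear_add linear_scale)
    then show ?case using step by (auto intro!: span_add span_scale span_base[of x])
  qed
  have fWp: "f x \<in> Wp" if "x \<in> Wp" for x
    using that fW by (auto simp: Wp_def sym)
  obtain w z where wz: "w \<in> span W" "\<And>u. u \<in> span W \<Longrightarrow> orthogonal z u" "y = w + z"
    using orthogonal_subspace_decomp_exists[of W y] by metis
  have spW: "span W = W" using subW by (simp add: span_eq_iff)
  have z: "z \<in> Wp" "z \<noteq> 0"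
    using wz y by (auto simp: Wp_def orthogonal_def spW)
  \<comment> \<open>A maximiser of the Rayleigh quotient over the unit sphere of the invariant
    complement \<open>Wp\<close> will be an eigenvector. It then lies in \<open>W\<close> as well,
    which is impossible for a unit vector.\<close>
  define S where "S = sphere 0 1 \<inter> Wp"
  have "compact S"
    unfolding S_def by (intro compact_Int_closed closed_subspace subWp) auto
  moreover have "(1 / norm z) *\<^sub>R z \<in> S"
    using z subWp by (auto simp: S_def subspace_scale)
  moreover have "continuous_on S (\<lambda>u. u \<bullet> f u)"
    using lin by (intro continuous_intros linear_continuous_on) (simp add: linear_conv_bounded_linear)
  ultimately obtain x where x: "x \<in> S" "\<And>u. u \<in> S \<Longrightarrow> u \<bullet> f u \<le> x \<bullet> f x"
    using continuous_attains_sup[of S "\<lambda>u. u \<bullet> f u"] by blast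
  define m where "m = x \<bullet> f x"
  have xx: "x \<bullet> x = 1" using x(1) by (simp add: S_def norm_eq_1)
  have xWp: "x \<in> Wp" using x(1) by (simp add: S_def)
  have max: "u \<bullet> f u \<le> m * (u \<bullet> u)" if "u \<in> Wp" for u
  proof (cases "u = 0")
    case True then show ?thesis using linear_0[OF lin] by simp
  next
    case False
    have "(1 / norm u) *\<^sub>R u \<in> S"
      using False that subWp by (auto simp: S_def subspace_scale)
    from x(2)[OF this] have "(u \<bullet> f u) / (norm u)\<^sup>2 \<le> m"
      using lin by (simp add: m_def linear_scale power2_eq_square)
    then show ?thesis using False by (simp add: divide_le_eq power2_norm_eq_inner)
  qed
  \<comment> \<open>The residual of the eigenvalue equation. Moving from \<open>x\<close> along
    \<open>d\<close> gains \<open>2 * t * (d \<bullet> d)\<close> and loses only terms of order t^2,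
    so maximality forces \<open>d = 0\<close> as t tends to 0 from the right.\<close>
  define d where "d = f x - m *\<^sub>R x"
  have dWp: "d \<in> Wp"
    unfolding d_def using fWp xWp subWp by (simp add: subspace_diff subspace_scale)
  have dx: "d \<bullet> x = 0"
    using xx by (simp add: d_def inner_diff_left m_def inner_commute[of "f x"])
  have dfx: "d \<bullet> f x = d \<bullet> d"
    using dx inner_diff_right[of d "f x" "m *\<^sub>R x"] by (simp add: d_def[symmetric])
  have *: "2 * (d \<bullet> d) \<le> t * (m * (d \<bullet> d) - d \<bullet> f d)" if "t > 0" for t
  proof -
    have "x + t *\<^sub>R d \<in> Wp" using dWp xWp subWp by (simp add: subspace_add subspace_scale)
    from max[OF this] have "m + 2 * t * (d \<bullet> d) + t * t * (d \<bullet> f d) \<le> m * (1 + t * t * (d \<bullet> d))"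
      using lin dx dfx sym[of x d]
      by (simp add: linear_add linear_scale inner_add_left inner_add_right xx m_def[symmetric]
          inner_commute algebra_simps)
    then have "t * (2 * (d \<bullet> d)) \<le> t * (t * (m * (d \<bullet> d) - d \<bullet> f d))"
      by (simp add: algebra_simps)
    then show ?thesis using that by simp
  qed
  have "((\<lambda>t. t * (m * (d \<bullet> d) - d \<bullet> f d)) \<longlongrightarrow> 0 * (m * (d \<bullet> d) - d \<bullet> f d)) (at_right 0)"
    by (intro tendsto_intros)
  then have "2 * (d \<bullet> d) \<le> 0"
    by (intro tendsto_lowerbound[where F = "at_right (0::real)"])
       (auto intro!: eventually_at_rightI[of 0 1] *)
  then have "d = 0" using inner_ge_zero[of d] by (metis inner_eq_zero_iff order_antisym mult_le_0_iff not_numeral_le_zero)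
  then have "x \<in> W" by (auto simp: d_def W_def intro!: span_base)
  with xWp have "x \<bullet> x = 0" unfolding Wp_def by blast
  with xx show False by simp
qed

lemma gram_matrix_inner: "((transpose A ** A) *v x) \<bullet> y = (A *v x) \<bullet> (A *v y)"
  for A :: "real^'p^'k"
proof -
  have "(transpose A ** A) *v x = (A *v x) v* A"
    by (metis matrix_vector_mul_assoc transpose_matrix_vector)
  then show ?thesis by (metis dot_lmul_matrix)
qed

text \<open>The vectors are right singular vectors: orthonormal bases of the singular spaces,
  collected over all singular values, zero included. Distinct singular values give orthogonal
  vectors because the Gram matrix is self-adjoint, and the spectral theorem gives spanning. Counting
  basis vectors absorbs the multiplicities in \<open>nuclear_norm\<close>.\<close>

lemma singular_value_basis:
  fixes A :: "real^'p^'k"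
  obtains V where "finite V" "\<And>v. v \<in> V \<Longrightarrow> norm v = 1" "pairwise orthogonal V"
    "span V = UNIV" "pairwise (\<lambda>v w. orthogonal (A *v v) (A *v w)) V"
    "nuclear_norm A = (\<Sum>v\<in>V. norm (A *v v))"
proof -
  define f where "f = (\<lambda>v. (transpose A ** A) *v v)"
  have gram: "f x \<bullet> y = (A *v x) \<bullet> (A *v y)" for x y
    unfolding f_def by (rule gram_matrix_inner)
  have "\<exists>B. B \<subseteq> singular_space A s \<and> pairwise orthogonal B \<and> (\<forall>x\<in>B. norm x = 1) \<and>
      independent B \<and> card B = dim (singular_space A s) \<and> span B = singular_space A s" for s
  proof -
    have "subspace (singular_space A s)"
      by (auto simp: subspace_def singular_space_def matrix_vector_right_distrib scaleR_add_right
          matrix_vector_mult_scaleR)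
    from orthonormal_basis_subspace[OF this] show ?thesis by metis
  qed
  then obtain B where B: "\<And>s. B s \<subseteq> singular_space A s" "\<And>s. pairwise orthogonal (B s)"
    "\<And>s x. x \<in> B s \<Longrightarrow> norm x = 1" "\<And>s. independent (B s)"
    "\<And>s. card (B s) = dim (singular_space A s)" "\<And>s. span (B s) = singular_space A s"
    by metis
  have fin: "finite (B s)" for s using B(4) by (simp add: independent_imp_finite)
  define SV where "SV = singular_values A"
  have SVf: "finite SV" by (simp add: SV_def finite_singular_values)
  define V where "V = (\<Union>s\<in>SV. B s)"
  have fB: "f v = s\<^sup>2 *\<^sub>R v" if "v \<in> B s" for v s
    using B(1)[of s] that by (auto simp: singular_space_def f_def)
  have nB: "norm (A *v v) = s" if "v \<in> B s" "s \<in> SV" for v s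
  proof -
    have "(norm (A *v v))\<^sup>2 = s\<^sup>2 * (norm v)\<^sup>2"
      using gram[of v v] fB[OF that(1)] by (simp add: power2_norm_eq_inner)
    then show ?thesis using that B(3)[OF that(1)] by (simp add: SV_def singular_values_def)
  qed
  have orth: "orthogonal v w" if "v \<in> B s" "w \<in> B t" "s \<in> SV" "t \<in> SV" "s \<noteq> t" for v w s t
  proof -
    have "s\<^sup>2 * (v \<bullet> w) = t\<^sup>2 * (v \<bullet> w)"
      using gram[of v w] gram[of w v] fB[OF that(1)] fB[OF that(2)] by (simp add: inner_commute)
    moreover have "s\<^sup>2 \<noteq> t\<^sup>2" using that(3-5) by (auto simp: SV_def singular_values_def)
    ultimately show ?thesis by (simp add: orthogonal_def)
  qed
  have disj: "B s \<inter> B t = {}" if "s \<in> SV" "t \<in> SV" "s \<noteq> t" for s t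
  proof -
    have False if "v \<in> B s" "v \<in> B t" for v
      using orth[OF that \<open>s \<in> SV\<close> \<open>t \<in> SV\<close> \<open>s \<noteq> t\<close>] B(3)[OF that(1)]
      by (simp add: orthogonal_self)
    then show ?thesis by blast
  qed
  have 1: "finite V" using SVf fin by (simp add: V_def)
  have 2: "norm v = 1" if "v \<in> V" for v using that B(3) by (auto simp: V_def)
  have 3: "pairwise orthogonal V"
    unfolding V_def pairwise_def by (metis UN_E B(2) orth pairwise_def)
  have "v \<in> span V" if "f v = c *\<^sub>R v" for v c
  proof (cases "v = 0")
    case True then show ?thesis by (simp add: span_zero)
  next
    case False
    have "c * (norm v)\<^sup>2 = (norm (A *v v))\<^sup>2"
      using gram[of v v] that by (simp add: power2_norm_eq_inner)
    \<comment> \<open>Eigenvalues of a Gram matrix are nonnegative, so every eigenvector lies in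
      \<open>singular_space A (sqrt c)\<close>, whose basis has been collected in
      \<open>V\<close>.\<close>
    then have c: "c \<ge> 0" using False
      by (metis zero_le_mult_iff zero_le_power2 not_less zero_less_power2 norm_eq_zero mult_less_0_iff)
    then have v: "v \<in> singular_space A (sqrt c)"
      using that by (simp add: singular_space_def f_def)
    then have "sqrt c \<in> SV" using False c by (auto simp: SV_def singular_values_def)
    then have "span (B (sqrt c)) \<subseteq> span V" by (intro span_mono) (auto simp: V_def)
    then show ?thesis using v B(6) by auto
  qed
  then have "span {v. \<exists>c. f v = c *\<^sub>R v} \<subseteq> span V"
    by (intro span_minimal) auto
  moreover have "linear f" by (simp add: f_def)
  then have "span {v. \<exists>c. f v = c *\<^sub>R v} = UNIV"
    using gram by (intro selfadjoint_eigenvectors_span) (metis inner_commute)+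
  ultimately have 4: "span V = UNIV" by auto
  have 5: "pairwise (\<lambda>v w. orthogonal (A *v v) (A *v w)) V"
    unfolding pairwise_def
  proof (intro ballI impI)
    fix v w assume vw: "v \<in> V" "w \<in> V" "v \<noteq> w"
    then obtain s where "v \<in> B s" by (auto simp: V_def)
    moreover have "orthogonal v w" using 3 vw by (auto simp: pairwise_def)
    ultimately show "orthogonal (A *v v) (A *v w)"
      using gram[of v w] fB[of v s] by (simp add: orthogonal_def)
  qed
  have "(\<Sum>v\<in>V. norm (A *v v)) = (\<Sum>s\<in>SV. \<Sum>v\<in>B s. norm (A *v v))"
    unfolding V_def using SVf fin disj by (intro sum.UNION_disjoint) auto
  also have "\<dots> = (\<Sum>s\<in>SV. real (dim (singular_space A s)) * s)"
    using nB B(5) by (intro sum.cong) auto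
  finally have 6: "nuclear_norm A = (\<Sum>v\<in>V. norm (A *v v))"
    by (simp add: nuclear_norm_def SV_def)
  show thesis by (rule that[of V]) (use 1 2 3 4 5 6 in auto)
qed

lemma orthonormal_expansion:
  fixes x :: "'a::euclidean_space"
  assumes "finite V" "\<And>v. v \<in> V \<Longrightarrow> norm v = 1" "pairwise orthogonal V" "span V = UNIV"
  shows "x = (\<Sum>v\<in>V. (x \<bullet> v) *\<^sub>R v)"
proof -
  have "(x - (\<Sum>v\<in>V. (x \<bullet> v) *\<^sub>R v)) \<bullet> w = 0" if "w \<in> V" for w
  proof -
    have "(\<Sum>v\<in>V. (x \<bullet> v) *\<^sub>R v) \<bullet> w = (\<Sum>v\<in>V. if v = w then x \<bullet> w else 0)"
      unfolding inner_sum_left using assms that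
      by (intro sum.cong) (auto simp: pairwise_def orthogonal_def norm_eq_1)
    then show ?thesis using assms(1) that by (simp add: inner_diff_left)
  qed
  then have "orthogonal (x - (\<Sum>v\<in>V. (x \<bullet> v) *\<^sub>R v)) w" if "w \<in> V" for w
    using that by (simp add: orthogonal_def)
  then have "orthogonal (x - (\<Sum>v\<in>V. (x \<bullet> v) *\<^sub>R v)) y" for y
    by (rule orthogonal_to_span[where S = V, rotated]) (simp_all add: assms(4))
  then have "x - (\<Sum>v\<in>V. (x \<bullet> v) *\<^sub>R v) = 0" using orthogonal_self by blast
  then show ?thesis by (rule eq_iff_diff_eq_0[THEN iffD2])
qed

section \<open>Rank-one matrices and the duality between nuclear and operator norm\<close>

definition outer_prod :: "real^'k \<Rightarrow> real^'p \<Rightarrow> real^'p^'k" where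
  "outer_prod u v = (\<chi> a b. u $ a * v $ b)"

lemma outer_prod_mult: "outer_prod u v *v x = (v \<bullet> x) *\<^sub>R u"
  by (simp add: outer_prod_def matrix_vector_mult_def vec_eq_iff inner_vec_def sum_distrib_left
      mult.assoc mult.commute[of _ "u $ _"])

lemma inner_outer_prod: "G \<bullet> outer_prod u v = u \<bullet> (G *v v)"
  apply (simp add: outer_prod_def matrix_vector_mult_def inner_vec_def sum_distrib_left)
  apply (intro sum.cong refl)
  apply simp
  done

lemma outer_prod_inner_outer_prod: "outer_prod u v \<bullet> outer_prod u' v' = (u \<bullet> u') * (v \<bullet> v')"
  by (simp add: inner_outer_prod outer_prod_mult inner_commute)

text \<open>Both sides are the trace of \<open>transpose G ** A\<close>, the right one computed in
  the basis \<open>V\<close>. The proof expands \<open>A\<close> into the rank-one matrices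
  \<open>outer_prod (A *v v) v\<close>.\<close>

lemma inner_matrix_orthonormal:
  fixes G A :: "real^'p^'k"
  assumes "finite V" "\<And>v. v \<in> V \<Longrightarrow> norm v = 1" "pairwise orthogonal V" "span V = UNIV"
  shows "G \<bullet> A = (\<Sum>v\<in>V. (G *v v) \<bullet> (A *v v))"
proof -
  have "A *v x = (\<Sum>v\<in>V. outer_prod (A *v v) v) *v x" for x
  proof -
    have "A *v x = A *v (\<Sum>v\<in>V. (x \<bullet> v) *\<^sub>R v)"
      using orthonormal_expansion[OF assms, of x] by simp
    also have "\<dots> = (\<Sum>v\<in>V. (x \<bullet> v) *\<^sub>R (A *v v))"
      by (simp add: linear_sum[OF matrix_vector_mul_linear] matrix_vector_mult_scaleR)
    also have "\<dots> = (\<Sum>v\<in>V. outer_prod (A *v v) v *v x)"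
      by (simp add: outer_prod_mult inner_commute)
    also have "\<dots> = (\<Sum>v\<in>V. outer_prod (A *v v) v) *v x"
      by (induction V rule: infinite_finite_induct) (auto simp: matrix_vector_mult_add_rdistrib)
    finally show ?thesis .
  qed
  then have "A = (\<Sum>v\<in>V. outer_prod (A *v v) v)"
    by (subst matrix_eq) blast
  then have "G \<bullet> A = G \<bullet> (\<Sum>v\<in>V. outer_prod (A *v v) v)" by (rule arg_cong)
  also have "\<dots> = (\<Sum>v\<in>V. (G *v v) \<bullet> (A *v v))"
    unfolding inner_sum_right inner_outer_prod by (intro sum.cong refl inner_commute)
  finally show ?thesis .
qed

text \<open>The easy half of the duality: in a basis of right singular vectors each term
  \<open>(B *v v) \<bullet> (A *v v)\<close> is at most \<open>norm (A *v v)\<close> by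
  Cauchy-Schwarz.\<close>

lemma inner_le_nuclear_norm:
  fixes B A :: "real^'p^'k"
  assumes "\<And>x. norm x = 1 \<Longrightarrow> norm (B *v x) \<le> 1"
  shows "B \<bullet> A \<le> nuclear_norm A"
proof -
  obtain V where V: "finite V" "\<And>v. v \<in> V \<Longrightarrow> norm v = 1" "pairwise orthogonal V"
    "span V = UNIV" "pairwise (\<lambda>v w. orthogonal (A *v v) (A *v w)) V"
    "nuclear_norm A = (\<Sum>v\<in>V. norm (A *v v))"
    using singular_value_basis[of A] by blast
  have "(B *v v) \<bullet> (A *v v) \<le> norm (A *v v)" if "v \<in> V" for v
  proof -
    have "(B *v v) \<bullet> (A *v v) \<le> norm (B *v v) * norm (A *v v)" by (rule norm_cauchy_schwarz)
    also have "\<dots> \<le> 1 * norm (A *v v)" by (intro mult_right_mono assms V that) auto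
    finally show ?thesis by simp
  qed
  then have "(\<Sum>v\<in>V. (B *v v) \<bullet> (A *v v)) \<le> (\<Sum>v\<in>V. norm (A *v v))" by (rule sum_mono)
  moreover have "B \<bullet> A = (\<Sum>v\<in>V. (B *v v) \<bullet> (A *v v))"
    using V by (intro inner_matrix_orthonormal) auto
  ultimately show ?thesis by (simp only: V(6))
qed

text \<open>The maximiser is the partial isometry of the polar decomposition. With the preceding
  inequality this makes the nuclear norm a maximum of linear functionals, whence subadditivity and
  homogeneity.\<close>

lemma nuclear_norm_attained:
  fixes A :: "real^'p^'k"
  obtains B where "\<And>x. norm x = 1 \<Longrightarrow> norm (B *v x) \<le> 1" "nuclear_norm A = B \<bullet> A"
proof -
  obtain V where V: "finite V" "\<And>v. v \<in> V \<Longrightarrow> norm v = 1" "pairwise orthogonal V"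
    "span V = UNIV" "pairwise (\<lambda>v w. orthogonal (A *v v) (A *v w)) V"
    "nuclear_norm A = (\<Sum>v\<in>V. norm (A *v v))"
    using singular_value_basis[of A] by blast
  \<comment> \<open>Since \<open>sgn 0 = 0\<close>, kernel vectors drop out of \<open>B\<close>; the
    remaining \<open>u v\<close> are orthonormal, so Pythagoras bounds the operator norm of
    \<open>B\<close> by 1.\<close>
  define u where "u v = sgn (A *v v)" for v
  define B where "B = (\<Sum>v\<in>V. outer_prod (u v) v)"
  have Bx: "B *v x = (\<Sum>v\<in>V. (v \<bullet> x) *\<^sub>R u v)" for x
  proof -
    have "(\<Sum>v\<in>V. outer_prod (u v) v) *v x = (\<Sum>v\<in>V. outer_prod (u v) v *v x)"
      by (induction V rule: infinite_finite_induct) (auto simp: matrix_vector_mult_add_rdistrib)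
    then show ?thesis by (simp add: B_def outer_prod_mult)
  qed
  have pyth: "(norm (\<Sum>v\<in>V. (v \<bullet> x) *\<^sub>R w v))\<^sup>2 = (\<Sum>v\<in>V. (v \<bullet> x)\<^sup>2 * (norm (w v))\<^sup>2)"
    if "pairwise (\<lambda>v v'. orthogonal (w v) (w v')) V" for x and w :: "real^'p \<Rightarrow> 'b::euclidean_space"
    by (subst norm_sum_Pythagorean)
       (use V(1) that in \<open>auto simp: pairwise_def orthogonal_def power_mult_distrib\<close>)
  have "norm (B *v x) \<le> 1" if "norm x = 1" for x
  proof -
    have "pairwise (\<lambda>v v'. orthogonal (u v) (u v')) V"
      using V(5) by (auto simp: pairwise_def orthogonal_def u_def sgn_div_norm)
    then have "(norm (B *v x))\<^sup>2 = (\<Sum>v\<in>V. (v \<bullet> x)\<^sup>2 * (norm (u v))\<^sup>2)"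
      unfolding Bx by (rule pyth)
    also have "\<dots> \<le> (\<Sum>v\<in>V. (v \<bullet> x)\<^sup>2 * (norm v)\<^sup>2)"
      using V(2) by (intro sum_mono mult_left_mono) (auto simp: u_def norm_sgn)
    also have "\<dots> = (norm (\<Sum>v\<in>V. (v \<bullet> x) *\<^sub>R v))\<^sup>2"
      using V(3) by (intro pyth[symmetric]) (auto simp: pairwise_def)
    also have "(\<Sum>v\<in>V. (v \<bullet> x) *\<^sub>R v) = x"
      using orthonormal_expansion[OF V(1-4), of x] by (simp add: inner_commute)
    finally show ?thesis using that by (simp add: power2_le_imp_le abs_square_le_1)
  qed
  moreover have "B \<bullet> A = nuclear_norm A"
  proof -
    have "B \<bullet> A = (\<Sum>v\<in>V. A \<bullet> outer_prod (u v) v)"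
      by (simp add: B_def inner_sum_right inner_commute[of _ A])
    also have "\<dots> = (\<Sum>v\<in>V. norm (A *v v))"
    proof (intro sum.cong refl)
      fix v show "A \<bullet> outer_prod (u v) v = norm (A *v v)"
        by (cases "A *v v = 0") (simp_all add: inner_outer_prod u_def sgn_div_norm dot_square_norm power2_eq_square)
    qed
    finally show ?thesis by (simp add: V)
  qed
  ultimately show thesis by (intro that[of B]) auto
qed

lemma nuclear_norm_triangle: "nuclear_norm (A + B) \<le> nuclear_norm A + nuclear_norm B"
  for A :: "real^'p^'k"
proof -
  obtain C where C: "\<And>x. norm x = 1 \<Longrightarrow> norm (C *v x) \<le> 1" "nuclear_norm (A + B) = C \<bullet> (A + B)"
    using nuclear_norm_attained[of "A + B"] by blast
  then show ?thesis using inner_le_nuclear_norm[OF C(1)]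
    by (simp add: inner_add_right add_mono)
qed

lemma nuclear_norm_nonneg: "0 \<le> nuclear_norm A" for A :: "real^'p^'k"
  using inner_le_nuclear_norm[of 0 A] by simp

lemma nuclear_norm_scaleR: 
  fixes A :: "real^'p^'k"
  assumes "c \<ge> 0"
  shows "nuclear_norm (c *\<^sub>R A) = c * nuclear_norm A"
proof (rule antisym)
  obtain C where C: "\<And>x. norm x = 1 \<Longrightarrow> norm (C *v x) \<le> 1" "nuclear_norm (c *\<^sub>R A) = C \<bullet> (c *\<^sub>R A)"
    using nuclear_norm_attained[of "c *\<^sub>R A"] by blast
  then show "nuclear_norm (c *\<^sub>R A) \<le> c * nuclear_norm A" using inner_le_nuclear_norm[OF C(1), of A]
    assms by (simp add: mult_left_mono)
  obtain C where C: "\<And>x. norm x = 1 \<Longrightarrow> norm (C *v x) \<le> 1" "nuclear_norm A = C \<bullet> A"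
    using nuclear_norm_attained[of A] by blast
  then show "c * nuclear_norm A \<le> nuclear_norm (c *\<^sub>R A)"
    using inner_le_nuclear_norm[OF C(1), of "c *\<^sub>R A"] by simp
qed

text \<open>Each singular value is at most the Frobenius norm. The factor is cruder than the square
  root of the rank, but it serves only to make the nuclear norm Lipschitz.\<close>

lemma nuclear_norm_le_norm: "nuclear_norm A \<le> real CARD('p) * norm A" for A :: "real^'p^'k"
proof -
  obtain V where V: "finite V" "\<And>v. v \<in> V \<Longrightarrow> norm v = 1" "pairwise orthogonal V"
    "span V = UNIV" "pairwise (\<lambda>v w. orthogonal (A *v v) (A *v w)) V"
    "nuclear_norm A = (\<Sum>v\<in>V. norm (A *v v))"
    using singular_value_basis[of A] by blast
  have "0 \<notin> V" using V(2)[of 0] by auto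
  then have "card V \<le> CARD('p)"
    using pairwise_orthogonal_independent[OF V(3)] independent_bound[of V] by simp
  moreover have "norm (A *v v) \<le> norm A" if "v \<in> V" for v
  proof -
    have "(norm (A *v v))\<^sup>2 = A \<bullet> outer_prod (A *v v) v"
      by (simp add: inner_outer_prod power2_norm_eq_inner)
    also have "\<dots> \<le> norm A * norm (outer_prod (A *v v) v)" by (rule norm_cauchy_schwarz)
    also have "norm (outer_prod (A *v v) v) = norm (A *v v)"
      using V(2)[OF that]
      by (simp add: norm_eq_sqrt_inner outer_prod_inner_outer_prod real_sqrt_mult)
    finally show ?thesis by (cases "A *v v = 0") (auto simp: power2_eq_square)
  qed
  then have "(\<Sum>v\<in>V. norm (A *v v)) \<le> real (card V) * norm A" by (rule sum_bounded_above)
  ultimately show ?thesis unfolding V(6)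
    by (meson mult_right_mono norm_ge_zero of_nat_mono order_trans)
qed

lemma continuous_nuclear_norm: "continuous_on UNIV (nuclear_norm :: real^'p^'k \<Rightarrow> real)"
proof -
  have *: "nuclear_norm A - nuclear_norm B \<le> real CARD('p) * dist A B" for A B :: "real^'p^'k"
    using nuclear_norm_triangle[of "A - B" B] nuclear_norm_le_norm[of "A - B"] by (simp add: dist_norm)
  have "(real CARD('p))-lipschitz_on UNIV (nuclear_norm :: real^'p^'k \<Rightarrow> real)"
    by (intro lipschitz_onI) (use * in \<open>simp_all add: dist_real_def abs_le_iff\<close>, metis dist_commute)
  then show ?thesis by (rule lipschitz_on_continuous_on)
qed

text \<open>The singular value decomposition in the form that the Gaussian estimate consumes:
  nonnegative weights, of total mass the nuclear norm, on pairs of unit vectors.\<close>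

lemma nuclear_norm_decomposition:
  fixes A :: "real^'p^'k"
  obtains P s where "finite P" "\<And>u v. (u, v) \<in> P \<Longrightarrow> norm u = 1 \<and> norm v = 1 \<and> s (u, v) \<ge> 0"
    "nuclear_norm A = sum s P" "\<And>G. G \<bullet> A = (\<Sum>(u, v)\<in>P. s (u, v) * (G \<bullet> outer_prod u v))"
proof -
  obtain V where V: "finite V" "\<And>v. v \<in> V \<Longrightarrow> norm v = 1" "pairwise orthogonal V"
    "span V = UNIV" "pairwise (\<lambda>v w. orthogonal (A *v v) (A *v w)) V"
    "nuclear_norm A = (\<Sum>v\<in>V. norm (A *v v))"
    using singular_value_basis[of A] by blast
  define u where "u v = sgn (A *v v)" for v
  \<comment> \<open>On the kernel of \<open>A\<close> the vector \<open>u v\<close> would be 0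
    instead of a unit vector. Those \<open>v\<close> have weight 0 and are removed.\<close>
  define V' where "V' = {v\<in>V. A *v v \<noteq> 0}"
  have inj: "inj_on (\<lambda>v. (u v, v)) V'" by (auto simp: inj_on_def)
  show thesis
  proof (rule that[of "(\<lambda>v. (u v, v)) ` V'" "\<lambda>(u, v). norm (A *v v)"], goal_cases)
    case 1 then show ?case using V(1) by (simp add: V'_def)
  next
    case (2 u v) then show ?case using V(2) by (auto simp: V'_def u_def norm_sgn)
  next
    case 3
    have "(\<Sum>v\<in>V. norm (A *v v)) = (\<Sum>v\<in>V'. norm (A *v v))"
      unfolding V'_def using V(1) by (intro sum.mono_neutral_right) auto
    then show ?case by (simp add: V(6) sum.reindex[OF inj])
  next
    case (4 G)
    have "G \<bullet> A = (\<Sum>v\<in>V'. (G *v v) \<bullet> (A *v v))"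
      unfolding V'_def using V(1) inner_matrix_orthonormal[OF V(1-4), of G A]
      by (subst sum.mono_neutral_right[symmetric]) auto
    also have "\<dots> = (\<Sum>v\<in>V'. norm (A *v v) * (G \<bullet> outer_prod (u v) v))"
      by (intro sum.cong) (auto simp: V'_def inner_outer_prod u_def sgn_div_norm inner_commute)
    finally show ?case by (simp add: sum.reindex[OF inj])
  qed
qed

section \<open>Symmetrization and concentration\<close>

lemma Max_image_measurable:
  fixes f :: "'i \<Rightarrow> 'a \<Rightarrow> real"
  assumes "finite T" "T \<noteq> {}" "\<And>i. i \<in> T \<Longrightarrow> f i \<in> borel_measurable M"
  shows "(\<lambda>x. Max ((\<lambda>i. f i x) ` T)) \<in> borel_measurable M"
  using assms
proof (induction T rule: finite_ne_induct)
  case (insert i T)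
  have eq: "Max ((\<lambda>i. f i x) ` insert i T) = max (f i x) (Max ((\<lambda>i. f i x) ` T))" for x
    using insert by simp
  show ?case unfolding eq using insert by (intro borel_measurable_max) auto
qed simp

lemma Max_image_le_iff:
  fixes f :: "'i \<Rightarrow> real"
  assumes "finite T" "T \<noteq> {}"
  shows "Max (f ` T) \<le> c \<longleftrightarrow> (\<forall>i\<in>T. f i \<le> c)"
  using assms by simp

lemma Max_image_ge:
  fixes f :: "'i \<Rightarrow> real"
  assumes "finite T" "i \<in> T"
  shows "f i \<le> Max (f ` T)"
  using assms by simp

lemma Max_image_attained:
  fixes f :: "'i \<Rightarrow> real"
  assumes "finite T" "T \<noteq> {}"
  obtains i where "i \<in> T" "Max (f ` T) = f i"
  using Max_in[of "f ` T"] assms by fastforce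

lemma Max_image_add_const:
  fixes f :: "'i \<Rightarrow> real"
  assumes "finite T" "T \<noteq> {}"
  shows "Max ((\<lambda>i. f i + c) ` T) = Max (f ` T) + c"
  using Max_add_commute[of T f c] assms by simp

lemma abs_Max_image_le:
  fixes f :: "'i \<Rightarrow> real"
  assumes "finite T" "T \<noteq> {}"
  shows "\<bar>Max (f ` T)\<bar> \<le> (\<Sum>i\<in>T. \<bar>f i\<bar>)"
proof -
  obtain i where "i \<in> T" "Max (f ` T) = f i" using Max_image_attained[OF assms] by metis
  then show ?thesis using member_le_sum[of i T "\<lambda>i. \<bar>f i\<bar>"] assms by simp
qed

lemma integrable_Max_image:
  fixes f :: "'i \<Rightarrow> 'a \<Rightarrow> real"
  assumes "finite T" "T \<noteq> {}" "\<And>i. i \<in> T \<Longrightarrow> integrable M (f i)"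
  shows "integrable M (\<lambda>x. Max ((\<lambda>i. f i x) ` T))"
proof (rule Bochner_Integration.integrable_bound[where f = "\<lambda>x. \<Sum>i\<in>T. \<bar>f i x\<bar>"])
  show "integrable M (\<lambda>x. \<Sum>i\<in>T. \<bar>f i x\<bar>)"
    using assms by (intro Bochner_Integration.integrable_sum integrable_abs) auto
  show "(\<lambda>x. Max ((\<lambda>i. f i x) ` T)) \<in> borel_measurable M"
    using assms by (intro Max_image_measurable) auto
  show "AE x in M. norm (Max ((\<lambda>i. f i x) ` T)) \<le> norm (\<Sum>i\<in>T. \<bar>f i x\<bar>)"
    using abs_Max_image_le[OF assms(1,2)] by (intro AE_I2) (simp add: sum_nonneg)
qed

text \<open>If \<open>i\<close> and \<open>j\<close> attain the two maxima on the left, the left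
  side is at most \<open>h i + h j + 2 * \<bar>a i - a j\<bar>\<close>. Depending on the sign of
  \<open>a i - a j\<close>, testing the two maxima on the right at \<open>i\<close> and
  \<open>j\<close>, or at \<open>j\<close> and \<open>i\<close>, yields this value. It is one step
  of the contraction principle, with the random sign averaged out explicitly.\<close>

lemma contraction_step:
  fixes h a :: "'i \<Rightarrow> real"
  assumes T: "finite T" "T \<noteq> {}" and lip: "\<And>x y. \<bar>\<phi> x - \<phi> y\<bar> \<le> \<bar>x - y\<bar>"
  shows "Max ((\<lambda>i. h i + 2 * \<phi> (a i)) ` T) + Max ((\<lambda>i. h i - 2 * \<phi> (a i)) ` T)
    \<le> Max ((\<lambda>i. h i + 2 * a i) ` T) + Max ((\<lambda>i. h i - 2 * a i) ` T)"
proof -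
  obtain i where i: "i \<in> T" "Max ((\<lambda>i. h i + 2 * \<phi> (a i)) ` T) = h i + 2 * \<phi> (a i)"
    by (rule Max_image_attained[OF T])
  obtain j where j: "j \<in> T" "Max ((\<lambda>i. h i - 2 * \<phi> (a i)) ` T) = h j - 2 * \<phi> (a j)"
    by (rule Max_image_attained[OF T])
  have "h i + 2 * a i \<le> Max ((\<lambda>i. h i + 2 * a i) ` T)" "h j - 2 * a j \<le> Max ((\<lambda>i. h i - 2 * a i) ` T)"
    "h j + 2 * a j \<le> Max ((\<lambda>i. h i + 2 * a i) ` T)" "h i - 2 * a i \<le> Max ((\<lambda>i. h i - 2 * a i) ` T)"
    using T i(1) j(1) by auto
  then show ?thesis unfolding i(2) j(2) using lip[of "a i" "a j"] by argo
qed

text \<open>Symmetrisation without random signs: the mean is replaced by an independent copy, the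
  maximum splits into two halves of opposite sign, contraction removes \<open>\<phi>\<close> from
  the pair of halves, and the symmetry of \<open>\<nu>\<close> makes both halves equal.\<close>

lemma symmetrization_step:
  fixes \<nu> :: "'v::euclidean_space measure" and h :: "'v \<Rightarrow> real"
  assumes "prob_space \<nu>" and [measurable_cong]: "sets \<nu> = sets borel"
    and int: "integrable \<nu> norm" and sym: "distr \<nu> borel uminus = \<nu>"
    and T: "finite T" "T \<noteq> {}" and lip: "\<And>x y. \<bar>\<phi> x - \<phi> y\<bar> \<le> \<bar>x - y\<bar>"
    and m: "\<And>t. t \<in> T \<Longrightarrow> m \<le> (\<integral>x. \<phi> (x \<bullet> t) \<partial>\<nu>)"
  shows "(\<integral>x. Max ((\<lambda>t. h t + (m - \<phi> (x \<bullet> t))) ` T) \<partial>\<nu>) \<le> (\<integral>x. Max ((\<lambda>t. h t + 2 * (x \<bullet> t)) ` T) \<partial>\<nu>)"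
proof -
  interpret prob_space \<nu> by fact
  have "1-lipschitz_on UNIV \<phi>" using lip by (intro lipschitz_onI) (auto simp: dist_real_def)
  then have "continuous_on UNIV \<phi>" by (rule lipschitz_on_continuous_on)
  then have [measurable]: "\<phi> \<in> borel_measurable borel" by (rule borel_measurable_continuous_onI)
  have inner_int: "integrable \<nu> (\<lambda>x. x \<bullet> t)" for t
    by (rule Bochner_Integration.integrable_bound[OF integrable_mult_left[OF int, of "norm t"]])
       (auto intro!: AE_I2 simp: Cauchy_Schwarz_ineq2)
  have phi_int: "integrable \<nu> (\<lambda>x. \<phi> (x \<bullet> t))" for t
  proof (rule Bochner_Integration.integrable_bound[where f = "\<lambda>x. \<bar>\<phi> 0\<bar> + \<bar>x \<bullet> t\<bar>"])
    show "AE x in \<nu>. norm (\<phi> (x \<bullet> t)) \<le> norm (\<bar>\<phi> 0\<bar> + \<bar>x \<bullet> t\<bar>)"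
      using lip[of "x \<bullet> t" 0 for x] by (intro AE_I2) (smt (verit) real_norm_def)
  qed (auto intro!: inner_int)
  note ints = integrable_Max_image[OF T] inner_int phi_int
  define U where "U x = Max ((\<lambda>t. h t + 2 * \<phi> (x \<bullet> t)) ` T)" for x
  define L where "L x = Max ((\<lambda>t. h t - 2 * \<phi> (x \<bullet> t)) ` T)" for x
  have U: "integrable \<nu> U" unfolding U_def by (intro ints(1)) (auto intro!: phi_int)
  have L: "integrable \<nu> L" unfolding L_def by (intro ints(1)) (auto intro!: phi_int)
  \<comment> \<open>With \<open>y\<close> an independent copy,
    \<open>h t + (m - \<phi> (x \<bullet> t))\<close> is at most the average of
    \<open>h t - 2 * \<phi> (x \<bullet> t)\<close> and the expectation of
    \<open>h t + 2 * \<phi> (y \<bullet> t)\<close>. Giving each half a full \<open>h t\<close> is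
    what produces the factor 2 in front of the inner product.\<close>
  have pt: "Max ((\<lambda>t. h t + (m - \<phi> (x \<bullet> t))) ` T) \<le> ((\<integral>y. U y \<partial>\<nu>) + L x) / 2" for x
  proof -
    have "h t + (m - \<phi> (x \<bullet> t)) \<le> ((\<integral>y. U y \<partial>\<nu>) + L x) / 2" if t: "t \<in> T" for t
    proof -
      have "(\<integral>y. h t + 2 * \<phi> (y \<bullet> t) \<partial>\<nu>) \<le> (\<integral>y. U y \<partial>\<nu>)"
        using T t by (intro integral_mono U Bochner_Integration.integrable_add)
          (auto intro!: phi_int simp: U_def)
      moreover have "(\<integral>y. h t + 2 * \<phi> (y \<bullet> t) \<partial>\<nu>) = h t + 2 * (\<integral>y. \<phi> (y \<bullet> t) \<partial>\<nu>)"
        using phi_int by (simp add: prob_space)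
      moreover have "h t - 2 * \<phi> (x \<bullet> t) \<le> L x"
        using T t by (simp add: L_def)
      ultimately show ?thesis using m[OF t] by argo
    qed
    then show ?thesis by (simp only: Max_image_le_iff[OF T] ball_simps) blast
  qed
  have "(\<integral>x. Max ((\<lambda>t. h t + (m - \<phi> (x \<bullet> t))) ` T) \<partial>\<nu>) \<le> (\<integral>x. ((\<integral>y. U y \<partial>\<nu>) + L x) / 2 \<partial>\<nu>)"
    by (intro integral_mono ints(1) pt) (auto intro!: phi_int L)
  also have "\<dots> = (\<integral>x. (U x + L x) / 2 \<partial>\<nu>)"
    using U L by (simp add: prob_space)
  also have "\<dots> \<le> (\<integral>x. (Max ((\<lambda>t. h t + 2 * (x \<bullet> t)) ` T) + Max ((\<lambda>t. h t - 2 * (x \<bullet> t)) ` T)) / 2 \<partial>\<nu>)"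
  proof (intro integral_mono)
    show "(U x + L x) / 2 \<le> (Max ((\<lambda>t. h t + 2 * (x \<bullet> t)) ` T) + Max ((\<lambda>t. h t - 2 * (x \<bullet> t)) ` T)) / 2" for x
      using contraction_step[OF T lip, where h = h and a = "\<lambda>t. x \<bullet> t"] by (simp add: U_def L_def)
  qed (use U L in \<open>auto intro!: Bochner_Integration.integrable_add integrable_divide_zero
      Bochner_Integration.integrable_diff ints(1) inner_int\<close>)
  also have "\<dots> = ((\<integral>x. Max ((\<lambda>t. h t + 2 * (x \<bullet> t)) ` T) \<partial>\<nu>) + (\<integral>x. Max ((\<lambda>t. h t - 2 * (x \<bullet> t)) ` T) \<partial>\<nu>)) / 2"
  proof -
    have "integrable \<nu> (\<lambda>x. Max ((\<lambda>t. h t + 2 * (x \<bullet> t)) ` T))"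
      "integrable \<nu> (\<lambda>x. Max ((\<lambda>t. h t - 2 * (x \<bullet> t)) ` T))"
      by (auto intro!: ints(1) inner_int Bochner_Integration.integrable_diff)
    then show ?thesis by simp
  qed
  also have "(\<integral>x. Max ((\<lambda>t. h t - 2 * (x \<bullet> t)) ` T) \<partial>\<nu>) = (\<integral>x. Max ((\<lambda>t. h t + 2 * (x \<bullet> t)) ` T) \<partial>(distr \<nu> borel uminus))"
    by (subst integral_distr) (auto intro!: Max_image_measurable T)
  finally show ?thesis by (simp add: sym)
qed

section \<open>Sums of independent copies and the exponential moment of the supremum\<close>

lemma integrable_pair_fst:
  fixes f :: "'a \<Rightarrow> real"
  assumes "prob_space N" "integrable M f"
  shows "integrable (M \<Otimes>\<^sub>M N) (\<lambda>z. f (fst z))"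
proof -
  interpret prob_space N by fact
  show ?thesis
    using assms(2) by (intro integrable_distr[OF measurable_fst]) (simp add: distr_pair_fst)
qed

lemma integrable_pair_snd:
  fixes f :: "'b \<Rightarrow> real"
  assumes "prob_space M" "prob_space N" "integrable N f"
  shows "integrable (M \<Otimes>\<^sub>M N) (\<lambda>z. f (snd z))"
proof -
  interpret M: prob_space M by fact
  interpret N: prob_space N by fact
  interpret pair_prob_space N M ..
  show ?thesis
    using integrable_product_swap[OF integrable_pair_fst[OF assms(1,3)]] by (simp add: case_prod_unfold)
qed

text \<open>Convolution powers, defined recursively because the inductions for the exponential
  moment and for Stein's identity both split off one summand.\<close>

primrec sum_law :: "'v::euclidean_space measure \<Rightarrow> nat \<Rightarrow> 'v measure" where
  "sum_law \<nu> 0 = return borel 0"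
| "sum_law \<nu> (Suc n) = distr (sum_law \<nu> n \<Otimes>\<^sub>M \<nu>) borel (\<lambda>(x, y). x + y)"

lemma sets_sum_law [simp, measurable_cong]: "sets (sum_law \<nu> n) = sets borel"
  by (cases n) auto

lemma prob_space_sum_law:
  assumes "prob_space \<nu>" and [measurable_cong]: "sets \<nu> = sets borel"
  shows "prob_space (sum_law \<nu> n)"
proof (induction n)
  case 0 then show ?case by (simp add: prob_space_return)
next
  case (Suc n)
  interpret A: prob_space \<nu> by fact
  interpret B: prob_space "sum_law \<nu> n" by fact
  interpret pair_prob_space "sum_law \<nu> n" \<nu> ..
  show ?case by (simp, rule prob_space_distr) simp
qed

lemma integrable_norm_sum_law:
  assumes "prob_space \<nu>" and [measurable_cong]: "sets \<nu> = sets borel" and int: "integrable \<nu> norm"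
  shows "integrable (sum_law \<nu> n) norm"
proof (induction n)
  case 0
  interpret prob_space "return borel (0::'a)" by (simp add: prob_space_return)
  show ?case by (simp add: integrable_iff_bounded nn_integral_return)
next
  case (Suc n)
  interpret A: prob_space \<nu> by fact
  interpret B: prob_space "sum_law \<nu> n" by (rule prob_space_sum_law) fact+
  interpret P: pair_prob_space "sum_law \<nu> n" \<nu> ..
  have 1: "integrable (sum_law \<nu> n \<Otimes>\<^sub>M \<nu>) (\<lambda>z. norm (fst z))"
    using A.prob_space_axioms Suc by (rule integrable_pair_fst)
  have 2: "integrable (sum_law \<nu> n \<Otimes>\<^sub>M \<nu>) (\<lambda>z. norm (snd z))"
    using B.prob_space_axioms A.prob_space_axioms int by (rule integrable_pair_snd)
  have "integrable (sum_law \<nu> n \<Otimes>\<^sub>M \<nu>) (\<lambda>z. norm (case z of (x, y) \<Rightarrow> x + y))"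
    by (rule Bochner_Integration.integrable_bound[OF Bochner_Integration.integrable_add[OF 1 2]])
       (auto simp: norm_triangle_ineq intro!: AE_I2)
  then show ?case by (simp add: integrable_distr_eq)
qed

text \<open>Hoeffding's lemma with the mean moved to the right. Nonnegative integrals allow it to be
  chained under iterated integration.\<close>

lemma concentration_step:
  fixes \<nu> :: "'v::euclidean_space measure"
  assumes "prob_space \<nu>" and "f \<in> borel_measurable \<nu>" and "\<And>x. f x \<in> {a..a + \<tau>}" and "l > 0"
  shows "(\<integral>\<^sup>+x. ennreal (exp (l * f x)) \<partial>\<nu>) \<le> ennreal (exp (l * (\<integral>x. f x \<partial>\<nu>) + l\<^sup>2 * \<tau>\<^sup>2 / 8))"
proof -
  interpret interval_bounded_random_variable \<nu> f a "a + \<tau>"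
    unfolding interval_bounded_random_variable_def interval_bounded_random_variable_axioms_def
    using assms by auto
  have "(\<integral>\<^sup>+x. ennreal (exp (l * f x)) \<partial>\<nu>)
      = (\<integral>\<^sup>+x. ennreal (exp (l * expectation f)) * ennreal (exp (l * (f x - expectation f))) \<partial>\<nu>)"
    by (intro nn_integral_cong) (simp add: ennreal_mult[symmetric] exp_add[symmetric] algebra_simps)
  also have "\<dots> = ennreal (exp (l * expectation f)) * (\<integral>\<^sup>+x. ennreal (exp (l * (f x - expectation f))) \<partial>\<nu>)"
    using assms(2) by (intro nn_integral_cmult) auto
  also have "\<dots> \<le> ennreal (exp (l * expectation f)) * ennreal (exp (l\<^sup>2 * \<tau>\<^sup>2 / 8))"
    using Hoeffdings_lemma_nn_integral[OF assms(4)] by (intro mult_left_mono) auto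
  finally show ?thesis by (simp add: ennreal_mult[symmetric] exp_add[symmetric])
qed

text \<open>A bounded difference argument interleaved with symmetrisation. The induction generalises
  the offset \<open>h\<close>: conditioning on one coordinate \<open>y\<close> turns the offset into
  \<open>h t + (m - \<phi> (y \<bullet> t))\<close>, to which the induction hypothesis applies.
  Hoeffding's lemma in \<open>y\<close> then costs \<tau>^2 l^2 / 8, and symmetrisation in
  \<open>y\<close> moves this coordinate into the sum law.\<close>

lemma supremum_mgf_bound:
  fixes \<nu> :: "'v::euclidean_space measure" and h :: "'v \<Rightarrow> real" and I :: "'i set"
  assumes "prob_space \<nu>" and [measurable_cong]: "sets \<nu> = sets borel"
    and int: "integrable \<nu> norm" and sym: "distr \<nu> borel uminus = \<nu>"
    and T: "finite T" "T \<noteq> {}" and lip: "\<And>x y. \<bar>\<phi> x - \<phi> y\<bar> \<le> \<bar>x - y\<bar>"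
    and range: "\<And>x. 0 \<le> \<phi> x \<and> \<phi> x \<le> \<tau>"
    and m: "\<And>t. t \<in> T \<Longrightarrow> m \<le> (\<integral>x. \<phi> (x \<bullet> t) \<partial>\<nu>)"
    and l: "l > 0" and I: "finite I"
  shows "(\<integral>\<^sup>+\<omega>. ennreal (exp (l * Max ((\<lambda>t. h t + (\<Sum>i\<in>I. m - \<phi> (\<omega> i \<bullet> t))) ` T))) \<partial>(\<Pi>\<^sub>M i\<in>I. \<nu>))
    \<le> ennreal (exp (l * (\<integral>y. Max ((\<lambda>t. h t + 2 * (y \<bullet> t)) ` T) \<partial>(sum_law \<nu> (card I))) + real (card I) * l\<^sup>2 * \<tau>\<^sup>2 / 8))"
  using I
proof (induction I arbitrary: h rule: finite_induct)
  case empty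
  interpret product_sigma_finite "\<lambda>_::'i. \<nu>"
    using assms(1) by (simp add: product_sigma_finite_def prob_space_imp_sigma_finite)
  have "(\<integral>y. Max ((\<lambda>t. h t + 2 * (y \<bullet> t)) ` T) \<partial>(return borel 0)) = Max (h ` T)"
    by (subst integral_return) (auto intro!: Max_image_measurable T)
  then show ?case by (simp add: PiM_empty)
next
  case (insert i I)
  interpret prob_space \<nu> by fact
  interpret P: product_sigma_finite "\<lambda>_::'i. \<nu>"
    by (simp add: product_sigma_finite_def prob_space_imp_sigma_finite prob_space_axioms)
  define n where "n = card I"
  interpret S: prob_space "sum_law \<nu> n" by (rule prob_space_sum_law) fact+
  interpret Q: pair_prob_space "sum_law \<nu> n" \<nu> ..
  have "1-lipschitz_on UNIV \<phi>" using lip by (intro lipschitz_onI) (auto simp: dist_real_def)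
  then have "continuous_on UNIV \<phi>" by (rule lipschitz_on_continuous_on)
  then have [measurable]: "\<phi> \<in> borel_measurable borel" by (rule borel_measurable_continuous_onI)
  have inner_int: "integrable N (\<lambda>x. x \<bullet> t)" if "integrable N norm" "sets N = sets borel" for t and N :: "'v measure"
    by (rule Bochner_Integration.integrable_bound[OF integrable_mult_left[OF that(1), of "norm t"]])
       (auto intro!: AE_I2 simp: Cauchy_Schwarz_ineq2 measurable_cong_sets[OF that(2) refl])
  note sum_int = integrable_norm_sum_law[OF assms(1-3), of n]
  \<comment> \<open>The bound on the expected supremum once all coordinates but \<open>y\<close>
    have been symmetrised.\<close>
  define \<Psi> where "\<Psi> y = (\<integral>z. Max ((\<lambda>t. h t + (m - \<phi> (y \<bullet> t)) + 2 * (z \<bullet> t)) ` T) \<partial>(sum_law \<nu> n))" for y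
  have phi_int: "integrable \<nu> (\<lambda>x. \<phi> (x \<bullet> t))" for t
    using range by (intro integrable_const_bound[of _ "\<tau>"]) auto
  have fst_int: "integrable (sum_law \<nu> n \<Otimes>\<^sub>M \<nu>) (\<lambda>w. fst w \<bullet> t)" for t
    by (rule integrable_pair_fst[OF prob_space_axioms, of _ "\<lambda>x. x \<bullet> t"]) (rule inner_int[OF sum_int], simp)
  have snd_int: "integrable (sum_law \<nu> n \<Otimes>\<^sub>M \<nu>) (\<lambda>w. snd w \<bullet> t)"
    "integrable (sum_law \<nu> n \<Otimes>\<^sub>M \<nu>) (\<lambda>w. \<phi> (snd w \<bullet> t))" for t
    using integrable_pair_snd[OF S.prob_space_axioms prob_space_axioms inner_int[OF int assms(2)]]
      integrable_pair_snd[OF S.prob_space_axioms prob_space_axioms phi_int] by auto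
  have joint: "integrable (sum_law \<nu> n \<Otimes>\<^sub>M \<nu>) (\<lambda>(z, y). Max ((\<lambda>t. h t + (m - \<phi> (y \<bullet> t)) + 2 * (z \<bullet> t)) ` T))"
    unfolding case_prod_unfold
    by (intro integrable_Max_image T Bochner_Integration.integrable_add Bochner_Integration.integrable_diff
        integrable_mult_right fst_int snd_int) auto
  have joint2: "integrable (sum_law \<nu> n \<Otimes>\<^sub>M \<nu>) (\<lambda>(z, y). Max ((\<lambda>t. h t + 2 * ((z + y) \<bullet> t)) ` T))"
    unfolding case_prod_unfold inner_add_left
    by (intro integrable_Max_image T Bochner_Integration.integrable_add
        integrable_mult_right fst_int snd_int) auto
  have S_int: "integrable (sum_law \<nu> n) (\<lambda>z. Max ((\<lambda>t. g t + 2 * (z \<bullet> t)) ` T))" for g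
    by (intro integrable_Max_image T Bochner_Integration.integrable_add
        integrable_mult_right inner_int[OF sum_int]) auto
  \<comment> \<open>The symmetrised part \<open>z\<close> is unbounded, but \<open>y\<close> enters
    only through the clipped value: replacing \<open>\<phi>\<close> by its extremes 0 and
    \<open>\<tau>\<close> moves every term, hence the maximum and its integral, by at most
    \<open>\<tau>\<close>.\<close>
  have \<Psi>_range: "\<Psi> y \<in> {a..a + \<tau>}" if "a = (\<integral>z. Max ((\<lambda>t. h t + (m - \<tau>) + 2 * (z \<bullet> t)) ` T) \<partial>(sum_law \<nu> n))" for a y
  proof -
    let ?f = "\<lambda>c z. Max ((\<lambda>t. h t + c t + 2 * (z \<bullet> t)) ` T)"
    have mono: "(\<integral>z. ?f c z \<partial>(sum_law \<nu> n)) \<le> (\<integral>z. ?f d z \<partial>(sum_law \<nu> n))"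
      if le: "\<And>t. c t \<le> d t" for c d
    proof (intro integral_mono S_int)
      fix z
      have "h t + c t + 2 * (z \<bullet> t) \<le> ?f d z" if "t \<in> T" for t
        using Max_image_ge[OF T(1) that, of "\<lambda>t. h t + d t + 2 * (z \<bullet> t)"] le[of t] by linarith
      then show "?f c z \<le> ?f d z" by (simp only: Max_image_le_iff[OF T] ball_simps) blast
    qed
    have "(\<integral>z. ?f (\<lambda>_. m) z \<partial>(sum_law \<nu> n)) = (\<integral>z. ?f (\<lambda>_. m - \<tau>) z + \<tau> \<partial>(sum_law \<nu> n))"
      by (subst Max_image_add_const[OF T, symmetric]) (simp add: algebra_simps)
    also have "\<dots> = a + \<tau>"
      using S_int[of "\<lambda>t. h t + (m - \<tau>)"] by (simp add: that S.prob_space)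
    finally have up: "(\<integral>z. ?f (\<lambda>_. m) z \<partial>(sum_law \<nu> n)) = a + \<tau>" .
    show ?thesis
      using mono[of "\<lambda>_. m - \<tau>" "\<lambda>t. m - \<phi> (y \<bullet> t)"] mono[of "\<lambda>t. m - \<phi> (y \<bullet> t)" "\<lambda>_. m"] range up
      by (simp add: that \<Psi>_def)
  qed
  have \<Psi>_mean: "(\<integral>y. \<Psi> y \<partial>\<nu>) \<le> (\<integral>y. Max ((\<lambda>t. h t + 2 * (y \<bullet> t)) ` T) \<partial>(sum_law \<nu> (Suc n)))"
  proof -
    \<comment> \<open>Fubini brings \<open>y\<close> inside, so that for fixed \<open>z\<close>
      symmetrisation applies with the offset \<open>h t + 2 * (z \<bullet> t)\<close>.\<close>
    have "(\<integral>y. \<Psi> y \<partial>\<nu>) = (\<integral>z. \<integral>y. Max ((\<lambda>t. h t + (m - \<phi> (y \<bullet> t)) + 2 * (z \<bullet> t)) ` T) \<partial>\<nu> \<partial>(sum_law \<nu> n))"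
      unfolding \<Psi>_def by (rule Q.Fubini_integral[OF joint])
    also have "\<dots> \<le> (\<integral>z. \<integral>y. Max ((\<lambda>t. h t + 2 * ((z + y) \<bullet> t)) ` T) \<partial>\<nu> \<partial>(sum_law \<nu> n))"
    proof (rule integral_mono)
      show "integrable (sum_law \<nu> n) (\<lambda>z. \<integral>y. Max ((\<lambda>t. h t + (m - \<phi> (y \<bullet> t)) + 2 * (z \<bullet> t)) ` T) \<partial>\<nu>)"
        using Q.integrable_fst[OF joint] .
      show "integrable (sum_law \<nu> n) (\<lambda>z. \<integral>y. Max ((\<lambda>t. h t + 2 * ((z + y) \<bullet> t)) ` T) \<partial>\<nu>)"
        using Q.integrable_fst[OF joint2] .
      show "(\<integral>y. Max ((\<lambda>t. h t + (m - \<phi> (y \<bullet> t)) + 2 * (z \<bullet> t)) ` T) \<partial>\<nu>)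
        \<le> (\<integral>y. Max ((\<lambda>t. h t + 2 * ((z + y) \<bullet> t)) ` T) \<partial>\<nu>)" for z
        using symmetrization_step[OF assms(1-4) T lip m, of "\<lambda>t. h t + 2 * (z \<bullet> t)"]
        by (simp add: inner_add_left algebra_simps)
    qed
    also have "\<dots> = (\<integral>w. (case w of (z, y) \<Rightarrow> Max ((\<lambda>t. h t + 2 * ((z + y) \<bullet> t)) ` T)) \<partial>(sum_law \<nu> n \<Otimes>\<^sub>M \<nu>))"
      using Q.integral_fst[OF joint2] by simp
    also have "\<dots> = (\<integral>y. Max ((\<lambda>t. h t + 2 * (y \<bullet> t)) ` T) \<partial>(sum_law \<nu> (Suc n)))"
      unfolding sum_law.simps(2)
      by (subst integral_distr) (auto intro!: Max_image_measurable T simp: case_prod_unfold)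
    finally show ?thesis .
  qed
  have "(\<integral>\<^sup>+\<omega>. ennreal (exp (l * Max ((\<lambda>t. h t + (\<Sum>i\<in>insert i I. m - \<phi> (\<omega> i \<bullet> t))) ` T))) \<partial>(\<Pi>\<^sub>M i\<in>insert i I. \<nu>))
    = (\<integral>\<^sup>+y. \<integral>\<^sup>+\<omega>. ennreal (exp (l * Max ((\<lambda>t. (h t + (m - \<phi> (y \<bullet> t))) + (\<Sum>i\<in>I. m - \<phi> (\<omega> i \<bullet> t))) ` T))) \<partial>(\<Pi>\<^sub>M i\<in>I. \<nu>) \<partial>\<nu>)"
  proof -
    have "(\<lambda>\<omega>. Max ((\<lambda>t. h t + (\<Sum>i\<in>insert i I. m - \<phi> (\<omega> i \<bullet> t))) ` T)) \<in> borel_measurable (\<Pi>\<^sub>M i\<in>insert i I. \<nu>)"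
      by (intro Max_image_measurable T) measurable
    then have meas: "(\<lambda>\<omega>. ennreal (exp (l * Max ((\<lambda>t. h t + (\<Sum>i\<in>insert i I. m - \<phi> (\<omega> i \<bullet> t))) ` T))))
        \<in> borel_measurable (\<Pi>\<^sub>M i\<in>insert i I. \<nu>)"
      by measurable
    have key: "(\<Sum>j\<in>insert i I. m - \<phi> (fun_upd \<omega> i y j \<bullet> t)) = (m - \<phi> (y \<bullet> t)) + (\<Sum>j\<in>I. m - \<phi> (\<omega> j \<bullet> t))" 
      for \<omega> :: "'i \<Rightarrow> 'v" and y t :: 'v
      using insert.hyps by (subst sum.insert) (auto intro!: sum.cong)
    show ?thesis
      by (subst P.product_nn_integral_insert_rev[OF insert.hyps meas]) (simp only: key add.assoc)
  qed
  also have "\<dots> \<le> (\<integral>\<^sup>+y. ennreal (exp (l * \<Psi> y)) * ennreal (exp (real n * l\<^sup>2 * \<tau>\<^sup>2 / 8)) \<partial>\<nu>)"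
    using insert.IH by (intro nn_integral_mono) (simp add: n_def \<Psi>_def ennreal_mult[symmetric] exp_add[symmetric])
  also have "\<dots> \<le> ennreal (exp (l * (\<integral>y. \<Psi> y \<partial>\<nu>) + l\<^sup>2 * \<tau>\<^sup>2 / 8)) * ennreal (exp (real n * l\<^sup>2 * \<tau>\<^sup>2 / 8))"
  proof -
    have meas: "\<Psi> \<in> borel_measurable \<nu>"
      using borel_measurable_integrable[OF Q.integrable_snd[OF joint]] by (simp add: \<Psi>_def[abs_def])
    show ?thesis
      using concentration_step[OF assms(1) meas \<Psi>_range[OF refl] l] meas
      by (subst nn_integral_multc) (auto intro!: mult_right_mono)
  qed
  also have "\<dots> \<le> ennreal (exp (l * (\<integral>y. Max ((\<lambda>t. h t + 2 * (y \<bullet> t)) ` T) \<partial>(sum_law \<nu> (Suc n))) + real (Suc n) * l\<^sup>2 * \<tau>\<^sup>2 / 8))"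
    using \<Psi>_mean l by (simp add: ennreal_mult[symmetric] exp_add[symmetric] field_simps)
  finally show ?case using insert by (simp add: n_def)
qed

section \<open>Gaussian comparison by Stein's identity\<close>

text \<open>The bound on the derivative dominates the difference quotients by the mean value
  theorem, so dominated convergence applies along every sequence.\<close>

lemma has_real_derivative_integral:
  fixes L L' :: "real \<Rightarrow> 'a \<Rightarrow> real"
  assumes der: "\<And>x \<theta>. ((\<lambda>\<theta>. L \<theta> x) has_real_derivative L' \<theta> x) (at \<theta>)"
    and bound: "\<And>x \<theta>. \<bar>L' \<theta> x\<bar> \<le> w x" and w: "integrable M w"
    and L: "\<And>\<theta>. integrable M (L \<theta>)" and L': "L' \<theta>0 \<in> borel_measurable M"
  shows "((\<lambda>\<theta>. \<integral>x. L \<theta> x \<partial>M) has_real_derivative (\<integral>x. L' \<theta>0 x \<partial>M)) (at \<theta>0)"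
  unfolding has_field_derivative_iff tendsto_at_iff_sequentially
proof (intro allI impI, unfold comp_def)
  fix \<theta> :: "nat \<Rightarrow> real"
  assume \<theta>: "\<forall>i. \<theta> i \<in> UNIV - {\<theta>0}" "\<theta> \<longlonglongrightarrow> \<theta>0"
  have lip: "\<bar>L a x - L b x\<bar> \<le> w x * \<bar>a - b\<bar>" for a b x
    using field_differentiable_bound[of UNIV "\<lambda>\<theta>. L \<theta> x" "\<lambda>\<theta>. L' \<theta> x" "w x" a b] der bound by auto
  have "(\<lambda>n. \<integral>x. (L (\<theta> n) x - L \<theta>0 x) / (\<theta> n - \<theta>0) \<partial>M) \<longlonglongrightarrow> (\<integral>x. L' \<theta>0 x \<partial>M)"
  proof (rule integral_dominated_convergence[where w = w])
    show "AE x in M. (\<lambda>n. (L (\<theta> n) x - L \<theta>0 x) / (\<theta> n - \<theta>0)) \<longlonglongrightarrow> L' \<theta>0 x"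
      using der \<theta> unfolding has_field_derivative_iff tendsto_at_iff_sequentially comp_def
      by (intro AE_I2) blast
    show "AE x in M. norm ((L (\<theta> n) x - L \<theta>0 x) / (\<theta> n - \<theta>0)) \<le> w x" for n
      using lip[of "\<theta> n" _ \<theta>0] \<theta>(1) by (intro AE_I2) (simp add: divide_le_eq)
  qed (use L' w L borel_measurable_integrable[OF L] in auto)
  then show "(\<lambda>n. ((\<integral>x. L (\<theta> n) x \<partial>M) - (\<integral>x. L \<theta>0 x \<partial>M)) / (\<theta> n - \<theta>0)) \<longlonglongrightarrow> (\<integral>x. L' \<theta>0 x \<partial>M)"
    using L by simp
qed

text \<open>The test functions for Stein's identity. One constant bounds both values and derivative,
  so integrability follows from a first moment of the measure.\<close>

definition C1_bounded :: "('v::real_normed_vector \<Rightarrow> real) \<Rightarrow> ('v \<Rightarrow> 'v \<Rightarrow> real) \<Rightarrow> real \<Rightarrow> bool" where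
  "C1_bounded f f' C \<longleftrightarrow> (\<forall>x. (f has_derivative f' x) (at x)) \<and> (\<forall>c. continuous_on UNIV (\<lambda>x. f' x c)) \<and>
     (\<forall>x. \<bar>f x\<bar> \<le> C) \<and> (\<forall>x c. \<bar>f' x c\<bar> \<le> C * norm c)"

text \<open>Stein's identity characterises the centred Gaussian measure with covariance \<open>s\<close> times the
  identity; it is all the interpolation argument below uses about Gaussian measures.\<close>

definition stein :: "'v::euclidean_space measure \<Rightarrow> real \<Rightarrow> bool" where
  "stein \<Gamma> s \<longleftrightarrow> (\<forall>f f' C b. C1_bounded f f' C \<longrightarrow>
     (\<integral>x. (x \<bullet> b) * f x \<partial>\<Gamma>) = s * (\<integral>x. f' x b \<partial>\<Gamma>))"

section \<open>Softmax weights, log-sum-exp, and Gaussian interpolation\<close>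

definition gibbs :: "'i set \<Rightarrow> ('i \<Rightarrow> real) \<Rightarrow> 'i \<Rightarrow> real" where
  "gibbs P z i = exp (z i) / (\<Sum>j\<in>P. exp (z j))"

lemma sum_exp_pos: "finite P \<Longrightarrow> P \<noteq> {} \<Longrightarrow> (0::real) < (\<Sum>j\<in>P. exp (z j))"
  by (intro sum_pos) auto

lemma sum_gibbs: "finite P \<Longrightarrow> P \<noteq> {} \<Longrightarrow> (\<Sum>i\<in>P. gibbs P z i) = 1"
  using sum_exp_pos[of P z] by (simp add: gibbs_def sum_divide_distrib[symmetric])

lemma gibbs_nonneg: "0 \<le> gibbs P z i"
  by (simp add: gibbs_def sum_nonneg)

lemma gibbs_le_1:
  assumes "finite P" "i \<in> P"
  shows "gibbs P z i \<le> 1"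
  using sum_gibbs[of P z] member_le_sum[of i P "gibbs P z"] assms gibbs_nonneg by (metis empty_iff)

lemma gibbs_average_le:
  assumes "finite P" "P \<noteq> {}" "\<And>i. i \<in> P \<Longrightarrow> \<bar>g i\<bar> \<le> K"
  shows "\<bar>\<Sum>i\<in>P. gibbs P z i * g i\<bar> \<le> K"
proof -
  have "\<bar>\<Sum>i\<in>P. gibbs P z i * g i\<bar> \<le> (\<Sum>i\<in>P. \<bar>gibbs P z i * g i\<bar>)" by (rule sum_abs)
  also have "\<dots> \<le> (\<Sum>i\<in>P. gibbs P z i * K)"
    using assms by (intro sum_mono) (simp add: abs_mult abs_of_nonneg[OF gibbs_nonneg] mult_left_mono gibbs_nonneg)
  also have "\<dots> = K" using sum_gibbs[OF assms(1,2)] by (simp add: sum_distrib_right[symmetric])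
  finally show ?thesis .
qed

lemma gibbs_has_derivative:
  fixes z :: "'v::real_normed_vector \<Rightarrow> 'i \<Rightarrow> real"
  assumes P: "finite P" "P \<noteq> {}" and z: "\<And>i. i \<in> P \<Longrightarrow> ((\<lambda>x. z x i) has_derivative z' i) (at x)" and i: "i \<in> P"
  shows "((\<lambda>x. gibbs P (z x) i) has_derivative
    (\<lambda>c. gibbs P (z x) i * (z' i c - (\<Sum>j\<in>P. gibbs P (z x) j * z' j c)))) (at x)"
proof -
  have pos: "(\<Sum>j\<in>P. exp (z x j)) > 0" by (rule sum_exp_pos[OF P])
  have e: "((\<lambda>x. exp (z x j)) has_derivative (\<lambda>c. exp (z x j) * z' j c)) (at x)" if "j \<in> P" for j
    using z[OF that] by (auto intro!: derivative_eq_intros)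
  have S: "((\<lambda>x. \<Sum>j\<in>P. exp (z x j)) has_derivative (\<lambda>c. \<Sum>j\<in>P. exp (z x j) * z' j c)) (at x)"
    using e by (intro has_derivative_sum) auto
  have avg: "(\<Sum>j\<in>P. gibbs P (z x) j * z' j c) = (\<Sum>j\<in>P. exp (z x j) * z' j c) / (\<Sum>j\<in>P. exp (z x j))" for c
    by (simp add: gibbs_def sum_divide_distrib)
  show ?thesis
    unfolding avg unfolding gibbs_def
    by (rule has_derivative_eq_rhs[OF has_derivative_divide'[OF e[OF i] S]])
       (use pos in \<open>auto simp: fun_eq_iff divide_simps algebra_simps power2_eq_square\<close>)
qed

lemma ln_sum_exp_has_derivative:
  fixes z :: "real \<Rightarrow> 'i \<Rightarrow> real"
  assumes P: "finite P" "P \<noteq> {}" and z: "\<And>i. i \<in> P \<Longrightarrow> ((\<lambda>x. z x i) has_real_derivative z' i) (at x)"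
  shows "((\<lambda>x. ln (\<Sum>i\<in>P. exp (z x i))) has_real_derivative (\<Sum>i\<in>P. gibbs P (z x) i * z' i)) (at x)"
proof -
  have pos: "(\<Sum>j\<in>P. exp (z x j)) > 0" by (rule sum_exp_pos[OF P])
  have "((\<lambda>x. \<Sum>i\<in>P. exp (z x i)) has_real_derivative (\<Sum>i\<in>P. exp (z x i) * z' i)) (at x)"
    using z by (intro DERIV_sum DERIV_chain2[OF DERIV_exp]) auto
  from DERIV_chain2[OF DERIV_ln[OF pos] this] show ?thesis
    by (simp add: gibbs_def sum_distrib_left field_simps)
qed

text \<open>The smoothing error \<open>ln (card P) / \<beta>\<close> does not depend on
  \<open>z\<close>, so it disappears from expectations as \<open>\<beta>\<close> tends to
  infinity.\<close>

lemma ln_sum_exp_bounds: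
  fixes z :: "'i \<Rightarrow> real"
  assumes P: "finite P" "P \<noteq> {}" and \<beta>: "\<beta> > 0"
  shows "Max (z ` P) \<le> ln (\<Sum>i\<in>P. exp (\<beta> * z i)) / \<beta>"
    and "ln (\<Sum>i\<in>P. exp (\<beta> * z i)) / \<beta> \<le> Max (z ` P) + ln (card P) / \<beta>"
proof -
  have pos: "(\<Sum>j\<in>P. exp (\<beta> * z j)) > 0" by (rule sum_exp_pos[OF P])
  obtain i where i: "i \<in> P" "Max (z ` P) = z i" by (rule Max_image_attained[OF P])
  have "exp (\<beta> * z i) \<le> (\<Sum>j\<in>P. exp (\<beta> * z j))"
    using P i by (intro member_le_sum[of i P "\<lambda>j. exp (\<beta> * z j)"]) auto
  then have "\<beta> * z i \<le> ln (\<Sum>j\<in>P. exp (\<beta> * z j))" using pos by (simp add: ln_ge_iff)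
  then show "Max (z ` P) \<le> ln (\<Sum>i\<in>P. exp (\<beta> * z i)) / \<beta>"
    using \<beta> i by (simp add: le_divide_eq mult.commute)
  have "(\<Sum>j\<in>P. exp (\<beta> * z j)) \<le> real (card P) * exp (\<beta> * Max (z ` P))"
    using P \<beta> by (intro sum_bounded_above) auto
  then have "ln (\<Sum>j\<in>P. exp (\<beta> * z j)) \<le> ln (real (card P) * exp (\<beta> * Max (z ` P)))"
    using pos by (subst ln_le_cancel_iff) (auto simp: P card_gt_0_iff)
  also have "\<dots> = ln (card P) + \<beta> * Max (z ` P)"
    using P by (subst ln_mult) (auto simp: card_gt_0_iff)
  finally show "ln (\<Sum>i\<in>P. exp (\<beta> * z i)) / \<beta> \<le> Max (z ` P) + ln (card P) / \<beta>"
    using \<beta> by (simp add: field_simps)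
qed

text \<open>Since the weights sum to 1, symmetrising in the two indices turns twice this sum into
  the weighted double sum of \<open>K i i + K j j - 2 * K i j\<close>. For a difference of
  covariances these brackets are differences of squared increments.\<close>

lemma gibbs_quadratic_form:
  assumes P: "finite P" "P \<noteq> {}" and sym: "\<And>i j. K i j = K j i"
    and pos: "\<And>i j. i \<in> P \<Longrightarrow> j \<in> P \<Longrightarrow> 0 \<le> K i i + K j j - 2 * K i j"
  shows "0 \<le> (\<Sum>i\<in>P. gibbs P z i * (K i i - (\<Sum>j\<in>P. gibbs P z j * K j i)))"
proof -
  let ?p = "gibbs P z"
  have 1: "sum ?p P = 1" by (rule sum_gibbs[OF P])
  have "0 \<le> (\<Sum>i\<in>P. \<Sum>j\<in>P. ?p i * ?p j * (K i i + K j j - 2 * K i j))"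
    using pos by (intro sum_nonneg mult_nonneg_nonneg gibbs_nonneg) auto
  also have "\<dots> = (\<Sum>i\<in>P. \<Sum>j\<in>P. ?p i * K i i * ?p j) + (\<Sum>i\<in>P. \<Sum>j\<in>P. ?p i * (?p j * K j j))
      - 2 * (\<Sum>i\<in>P. \<Sum>j\<in>P. ?p i * (?p j * K j i))"
    by (simp add: algebra_simps sum.distrib sum_subtractf sum_distrib_left sym[of _ "_"])
  also have "\<dots> = (\<Sum>i\<in>P. ?p i * K i i) + (\<Sum>j\<in>P. ?p j * K j j) - 2 * (\<Sum>i\<in>P. ?p i * (\<Sum>j\<in>P. ?p j * K j i))"
    using 1 by (simp add: sum_distrib_left[symmetric] sum_distrib_right[symmetric])
  also have "\<dots> = 2 * (\<Sum>i\<in>P. ?p i * (K i i - (\<Sum>j\<in>P. ?p j * K j i)))"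
    by (simp add: algebra_simps sum_subtractf)
  finally show ?thesis by simp
qed

text \<open>Makes the weights admissible in Stein's identity. Their values are at most 1, and the
  derivative is a weight times the deviation of one slope from an average of slopes, hence the
  constant \<open>2 * (\<beta> * K)\<close>.\<close>

lemma C1_bounded_gibbs:
  fixes a :: "'i \<Rightarrow> 'v::euclidean_space" and h :: "'i \<Rightarrow> real"
  assumes P: "finite P" "P \<noteq> {}" and i: "i \<in> P" and \<beta>: "\<beta> > 0"
  defines "z \<equiv> \<lambda>w i. \<beta> * (h i + w \<bullet> a i)"
  shows "\<exists>C. C1_bounded (\<lambda>w. gibbs P (z w) i)
    (\<lambda>w c. gibbs P (z w) i * (\<beta> * (c \<bullet> a i) - (\<Sum>j\<in>P. gibbs P (z w) j * (\<beta> * (c \<bullet> a j))))) C"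
proof -
  define K where "K = (\<Sum>j\<in>P. norm (a j))"
  have K: "norm (a j) \<le> K" if "j \<in> P" for j
    unfolding K_def using P that by (intro member_le_sum) auto
  have K0: "0 \<le> K" unfolding K_def by (intro sum_nonneg) auto
  have cont: "continuous_on UNIV (\<lambda>w. gibbs P (z w) j)" for j
    unfolding gibbs_def z_def using sum_exp_pos[OF P]
    by (intro continuous_intros) (metis less_irrefl)
  have bd: "\<bar>\<beta> * (c \<bullet> a j)\<bar> \<le> \<beta> * K * norm c" if "j \<in> P" for c j
  proof -
    have "\<bar>c \<bullet> a j\<bar> \<le> norm c * K"
      using K[OF that] by (meson Cauchy_Schwarz_ineq2 mult_left_mono norm_ge_zero order_trans)
    then show ?thesis using \<beta> by (simp add: abs_mult mult.assoc mult.commute mult_left_mono)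
  qed
  have "C1_bounded (\<lambda>w. gibbs P (z w) i)
    (\<lambda>w c. gibbs P (z w) i * (\<beta> * (c \<bullet> a i) - (\<Sum>j\<in>P. gibbs P (z w) j * (\<beta> * (c \<bullet> a j))))) (max 1 (2 * (\<beta> * K)))"
    unfolding C1_bounded_def
  proof (intro conjI allI)
    fix w c :: 'v
    show "((\<lambda>w. gibbs P (z w) i) has_derivative
      (\<lambda>c. gibbs P (z w) i * (\<beta> * (c \<bullet> a i) - (\<Sum>j\<in>P. gibbs P (z w) j * (\<beta> * (c \<bullet> a j)))))) (at w)"
      by (rule gibbs_has_derivative[OF P _ i]) (auto simp: z_def intro!: derivative_eq_intros)
    show "continuous_on UNIV (\<lambda>w. gibbs P (z w) i * (\<beta> * (c \<bullet> a i) - (\<Sum>j\<in>P. gibbs P (z w) j * (\<beta> * (c \<bullet> a j)))))"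
      by (intro continuous_intros cont)
    have g: "0 \<le> gibbs P (z w) i" "gibbs P (z w) i \<le> 1"
      using gibbs_nonneg gibbs_le_1[OF P(1) i] by auto
    then show "\<bar>gibbs P (z w) i\<bar> \<le> max 1 (2 * (\<beta> * K))" by auto
    have "\<bar>\<Sum>j\<in>P. gibbs P (z w) j * (\<beta> * (c \<bullet> a j))\<bar> \<le> \<beta> * K * norm c"
      using bd by (intro gibbs_average_le P) auto
    then have "\<bar>\<beta> * (c \<bullet> a i) - (\<Sum>j\<in>P. gibbs P (z w) j * (\<beta> * (c \<bullet> a j)))\<bar> \<le> 2 * (\<beta> * K) * norm c"
      using bd[OF i, of c] by argo
    then have "\<bar>gibbs P (z w) i * (\<beta> * (c \<bullet> a i) - (\<Sum>j\<in>P. gibbs P (z w) j * (\<beta> * (c \<bullet> a j))))\<bar> \<le> 1 * (2 * (\<beta> * K) * norm c)"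
      using g unfolding abs_mult by (intro mult_mono) auto
    also have "\<dots> \<le> max 1 (2 * (\<beta> * K)) * norm c"
      by (simp add: mult_right_mono)
    finally show "\<bar>gibbs P (z w) i * (\<beta> * (c \<bullet> a i) - (\<Sum>j\<in>P. gibbs P (z w) j * (\<beta> * (c \<bullet> a j))))\<bar>
      \<le> max 1 (2 * (\<beta> * K)) * norm c" .
  qed
  then show ?thesis ..
qed

lemma integrable_inner:
  fixes M :: "'v::euclidean_space measure"
  assumes "integrable M norm" "sets M = sets borel"
  shows "integrable M (\<lambda>x. x \<bullet> t)"
  by (rule Bochner_Integration.integrable_bound[OF integrable_mult_left[OF assms(1), of "norm t"]])
     (auto intro!: AE_I2 simp: Cauchy_Schwarz_ineq2 measurable_cong_sets[OF assms(2) refl])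

text \<open>Interpolation along \<open>a(\<theta>) = (cos \<theta> A, sin \<theta> B)\<close>: the derivative of the smoothed maximum is, by
  Stein's identity, a Gibbs average of the differences of the squared increments.\<close>

lemma smooth_sudakov_fernique:
  fixes A :: "'i \<Rightarrow> 'v::euclidean_space" and B :: "'i \<Rightarrow> 'w::euclidean_space"
    and \<Gamma> :: "('v \<times> 'w) measure"
  assumes "prob_space \<Gamma>" and sets: "sets \<Gamma> = sets borel"
    and int: "integrable \<Gamma> norm" and stein: "stein \<Gamma> 1"
    and P: "finite P" "P \<noteq> {}" and \<beta>: "\<beta> > 0"
    and incr: "\<And>i j. i \<in> P \<Longrightarrow> j \<in> P \<Longrightarrow> norm (A i - A j) \<le> norm (B i - B j)"
  shows "(\<integral>w. ln (\<Sum>i\<in>P. exp (\<beta> * (h i + fst w \<bullet> A i))) \<partial>\<Gamma>)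
       \<le> (\<integral>w. ln (\<Sum>i\<in>P. exp (\<beta> * (h i + snd w \<bullet> B i))) \<partial>\<Gamma>)"
proof -
  interpret prob_space \<Gamma> by fact
  note [measurable_cong] = sets
  define a where "a \<theta> i = (cos \<theta> *\<^sub>R A i, sin \<theta> *\<^sub>R B i)" for \<theta> i
  define a' where "a' \<theta> i = (- sin \<theta> *\<^sub>R A i, cos \<theta> *\<^sub>R B i)" for \<theta> i
  define z where "z \<theta> w i = \<beta> * (h i + w \<bullet> a \<theta> i)" for \<theta> w i
  define K where "K = (\<Sum>i\<in>P. norm (A i) + norm (B i))"
  have nrm: "norm (A i) + norm (B i) \<le> K" if "i \<in> P" for i
    unfolding K_def using P that by (intro member_le_sum[of i P "\<lambda>i. norm (A i) + norm (B i)"]) auto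
  have a'_le: "norm (a' \<theta> i) \<le> K" if "i \<in> P" for \<theta> i
  proof -
    have "norm (a' \<theta> i) \<le> \<bar>sin \<theta>\<bar> * norm (A i) + \<bar>cos \<theta>\<bar> * norm (B i)"
      unfolding a'_def using norm_Pair_le[of "- sin \<theta> *\<^sub>R A i" "cos \<theta> *\<^sub>R B i"] by simp
    also have "\<dots> \<le> 1 * norm (A i) + 1 * norm (B i)"
      by (intro add_mono mult_right_mono) auto
    finally show ?thesis using nrm[OF that] by simp
  qed
  have inner_int: "integrable \<Gamma> (\<lambda>w. w \<bullet> t)" for t by (rule integrable_inner[OF int sets])
  have zc: "continuous_on UNIV (\<lambda>w. z \<theta> w i)" for \<theta> i unfolding z_def by (intro continuous_intros)
  have gc: "continuous_on UNIV (\<lambda>w. gibbs P (z \<theta> w) j)" for j \<theta>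
    unfolding gibbs_def using sum_exp_pos[OF P]
    by (intro continuous_intros zc) (metis less_irrefl)
  have gm[measurable]: "(\<lambda>w. gibbs P (z \<theta> w) j) \<in> borel_measurable borel" for j \<theta>
    using gc by (rule borel_measurable_continuous_onI)
  define L where "L \<theta> w = ln (\<Sum>i\<in>P. exp (z \<theta> w i))" for \<theta> w
  define L' where "L' \<theta> w = (\<Sum>i\<in>P. gibbs P (z \<theta> w) i * (\<beta> * (w \<bullet> a' \<theta> i)))" for \<theta> w
  have L_der: "((\<lambda>\<theta>. L \<theta> w) has_real_derivative L' \<theta> w) (at \<theta>)" for w \<theta>
    unfolding L_def L'_def
    by (rule ln_sum_exp_has_derivative[OF P])
       (cases w, auto simp: z_def a_def a'_def intro!: derivative_eq_intros)
  have L'_bound: "\<bar>L' \<theta> w\<bar> \<le> norm w * (\<beta> * K)" for \<theta> w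
    unfolding L'_def
  proof (intro gibbs_average_le P)
    fix i assume i: "i \<in> P"
    have "\<bar>w \<bullet> a' \<theta> i\<bar> \<le> norm w * K"
      using a'_le[OF i, of \<theta>] by (meson Cauchy_Schwarz_ineq2 mult_left_mono norm_ge_zero order_trans)
    then show "\<bar>\<beta> * (w \<bullet> a' \<theta> i)\<bar> \<le> norm w * (\<beta> * K)"
      using \<beta> by (simp add: abs_mult mult.left_commute)
  qed
  have L_int: "integrable \<Gamma> (L \<theta>)" for \<theta>
  proof (rule Bochner_Integration.integrable_bound)
    show "integrable \<Gamma> (\<lambda>w. (\<Sum>i\<in>P. \<bar>z \<theta> w i\<bar>) + ln (card P))"
      unfolding z_def by (intro Bochner_Integration.integrable_add Bochner_Integration.integrable_sum
          integrable_abs integrable_mult_right inner_int) auto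
    have "\<bar>L \<theta> w\<bar> \<le> (\<Sum>i\<in>P. \<bar>z \<theta> w i\<bar>) + ln (card P)" for w
    proof -
      have "0 \<le> ln (card P)" using P by (simp add: Suc_le_eq card_gt_0_iff)
      then show ?thesis
        using ln_sum_exp_bounds[OF P, of 1 "z \<theta> w"] abs_Max_image_le[OF P, of "z \<theta> w"]
        by (simp add: L_def)
    qed
    then show "AE w in \<Gamma>. norm (L \<theta> w) \<le> norm ((\<Sum>i\<in>P. \<bar>z \<theta> w i\<bar>) + ln (card P))"
      by (intro AE_I2) (smt (verit) real_norm_def)
    have "continuous_on UNIV (L \<theta>)" unfolding L_def using sum_exp_pos[OF P]
      by (intro continuous_intros zc) (metis less_irrefl)
    then show "L \<theta> \<in> borel_measurable \<Gamma>"
      using borel_measurable_continuous_onI measurable_cong_sets[OF sets refl] by blast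
  qed
  have L'_meas: "L' \<theta> \<in> borel_measurable \<Gamma>" for \<theta>
    unfolding L'_def by measurable
  define F where "F \<theta> = (\<integral>w. L \<theta> w \<partial>\<Gamma>)" for \<theta>
  have F_der: "(F has_real_derivative (\<integral>w. L' \<theta> w \<partial>\<Gamma>)) (at \<theta>)" for \<theta>
    unfolding F_def
    by (rule has_real_derivative_integral[OF L_der L'_bound integrable_mult_left[OF int] L_int L'_meas])
  have F_nonneg: "0 \<le> (\<integral>w. L' \<theta> w \<partial>\<Gamma>)" if \<theta>: "0 \<le> \<theta>" "\<theta> \<le> pi / 2" for \<theta>
  proof -
    \<comment> \<open>The common factor of all products
      \<open>a' \<theta> i \<bullet> a \<theta> j\<close>. It is nonnegative because the path runs
      only over a quarter circle.\<close>
    define sc where "sc = sin \<theta> * cos \<theta>"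
    have sc: "0 \<le> sc" unfolding sc_def using \<theta> by (intro mult_nonneg_nonneg sin_ge_zero cos_ge_zero) auto
    define Kij where "Kij i j = B i \<bullet> B j - A i \<bullet> A j" for i j
    have aa: "a' \<theta> i \<bullet> a \<theta> j = sc * Kij i j" for i j
      by (simp add: a_def a'_def sc_def Kij_def algebra_simps)
    have gi: "integrable \<Gamma> (\<lambda>w. (w \<bullet> c) * gibbs P (z \<theta> w) i)" if "i \<in> P" for i c
    proof (rule Bochner_Integration.integrable_bound[OF integrable_abs[OF inner_int]])
      show "AE w in \<Gamma>. norm ((w \<bullet> c) * gibbs P (z \<theta> w) i) \<le> norm \<bar>w \<bullet> c\<bar>"
        using gibbs_le_1[OF P(1) that]
        by (intro AE_I2) (auto simp: abs_mult abs_of_nonneg[OF gibbs_nonneg] intro!: mult_left_le)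
    qed measurable
    let ?g = "\<lambda>w i. gibbs P (z \<theta> w) i * (\<beta> * (sc * Kij i i) - (\<Sum>j\<in>P. gibbs P (z \<theta> w) j * (\<beta> * (sc * Kij i j))))"
    \<comment> \<open>Stein's identity in the direction \<open>a' \<theta> i\<close> trades the
      unbounded linear factor for the derivative of the weight, where only the covariance
      differences \<open>Kij\<close> remain.\<close>
    have st: "(\<integral>w. (w \<bullet> a' \<theta> i) * gibbs P (z \<theta> w) i \<partial>\<Gamma>) = (\<integral>w. ?g w i \<partial>\<Gamma>)" if i: "i \<in> P" for i
    proof -
      obtain C where "C1_bounded (\<lambda>w. gibbs P (z \<theta> w) i)
        (\<lambda>w c. gibbs P (z \<theta> w) i * (\<beta> * (c \<bullet> a \<theta> i) - (\<Sum>j\<in>P. gibbs P (z \<theta> w) j * (\<beta> * (c \<bullet> a \<theta> j))))) C"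
        using C1_bounded_gibbs[OF P i \<beta>, of h "a \<theta>"] by (auto simp: z_def[abs_def])
      from stein[unfolded stein_def, rule_format, OF this, of "a' \<theta> i"] show ?thesis
        by (simp add: aa)
    qed
    have g_int: "integrable \<Gamma> (\<lambda>w. ?g w i)" if i: "i \<in> P" for i
    proof (rule integrable_const_bound)
      show "AE w in \<Gamma>. norm (?g w i) \<le> 1 * (\<bar>\<beta> * (sc * Kij i i)\<bar> + (\<Sum>j\<in>P. \<bar>\<beta> * (sc * Kij i j)\<bar>))"
      proof (intro AE_I2)
        fix w
        have "\<bar>\<Sum>j\<in>P. gibbs P (z \<theta> w) j * (\<beta> * (sc * Kij i j))\<bar> \<le> (\<Sum>j\<in>P. \<bar>\<beta> * (sc * Kij i j)\<bar>)"
          using P by (intro gibbs_average_le P member_le_sum[of _ P "\<lambda>j. \<bar>\<beta> * (sc * Kij i j)\<bar>"]) auto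
        then show "norm (?g w i) \<le> 1 * (\<bar>\<beta> * (sc * Kij i i)\<bar> + (\<Sum>j\<in>P. \<bar>\<beta> * (sc * Kij i j)\<bar>))"
          unfolding real_norm_def abs_mult[of "gibbs P (z \<theta> w) i"]
          using gibbs_nonneg[of P "z \<theta> w" i] gibbs_le_1[OF P(1) i, of "z \<theta> w"]
          by (intro mult_mono) auto
      qed
    qed measurable
    have "(\<integral>w. L' \<theta> w \<partial>\<Gamma>) = (\<Sum>i\<in>P. \<integral>w. \<beta> * ((w \<bullet> a' \<theta> i) * gibbs P (z \<theta> w) i) \<partial>\<Gamma>)"
    proof -
      have "L' \<theta> w = (\<Sum>i\<in>P. \<beta> * ((w \<bullet> a' \<theta> i) * gibbs P (z \<theta> w) i))" for w
        by (simp add: L'_def mult_ac)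
      then show ?thesis using gi by (simp add: Bochner_Integration.integral_sum)
    qed
    also have "\<dots> = (\<Sum>i\<in>P. \<beta> * (\<integral>w. ?g w i \<partial>\<Gamma>))"
      using st by simp
    also have "\<dots> = (\<integral>w. \<beta> * (\<Sum>i\<in>P. ?g w i) \<partial>\<Gamma>)"
      using g_int by (simp add: sum_distrib_left[symmetric])
    also have "\<dots> = (\<integral>w. \<beta> * (\<beta> * sc * (\<Sum>i\<in>P. gibbs P (z \<theta> w) i * (Kij i i - (\<Sum>j\<in>P. gibbs P (z \<theta> w) j * Kij j i)))) \<partial>\<Gamma>)"
      by (intro Bochner_Integration.integral_cong refl arg_cong[where f = "(*) \<beta>"])
         (simp add: sum_distrib_left right_diff_distrib mult_ac Kij_def inner_commute)
    also have "\<dots> \<ge> 0"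
    proof (intro integral_nonneg_AE AE_I2 mult_nonneg_nonneg sc)
      fix w
      show "0 \<le> (\<Sum>i\<in>P. gibbs P (z \<theta> w) i * (Kij i i - (\<Sum>j\<in>P. gibbs P (z \<theta> w) j * Kij j i)))"
      proof (rule gibbs_quadratic_form[OF P])
        fix i j assume ij: "i \<in> P" "j \<in> P"
        have "(norm (A i - A j))\<^sup>2 \<le> (norm (B i - B j))\<^sup>2"
          using incr[OF ij] by (intro power_mono) auto
        then show "0 \<le> Kij i i + Kij j j - 2 * Kij i j"
          by (simp add: Kij_def power2_norm_eq_inner inner_diff_left inner_diff_right inner_commute)
      qed (simp add: Kij_def inner_commute)
    qed (use \<beta> in auto)
    finally show ?thesis .
  qed
  have "F 0 \<le> F (pi / 2)"
    using F_der F_nonneg by (intro DERIV_nonneg_imp_nondecreasing[of 0 "pi / 2" F]) auto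
  moreover have "L 0 w = ln (\<Sum>i\<in>P. exp (\<beta> * (h i + fst w \<bullet> A i)))"
    "L (pi / 2) w = ln (\<Sum>i\<in>P. exp (\<beta> * (h i + snd w \<bullet> B i)))" for w
    by (simp_all add: L_def z_def a_def inner_prod_def)
  ultimately show ?thesis by (simp add: F_def)
qed

text \<open>Scaling, products and sums all preserve Stein's identity by applying it to
  \<open>f\<close> composed with an affine map. Requiring \<open>1 \<le> K\<close> lets the same
  constant still bound the values of \<open>f\<close>.\<close>

lemma C1_bounded_affine:
  fixes g :: "'w::real_normed_vector \<Rightarrow> 'v::real_normed_vector"
  assumes f: "C1_bounded f f' C" and g: "bounded_linear g" and K: "1 \<le> K" "\<And>c. norm (g c) \<le> K * norm c"
  shows "C1_bounded (\<lambda>u. f (g u + a)) (\<lambda>u c. f' (g u + a) (g c)) (C * K)"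
proof -
  have f: "\<And>x. (f has_derivative f' x) (at x)" "\<And>c. continuous_on UNIV (\<lambda>x. f' x c)"
    "\<And>x. \<bar>f x\<bar> \<le> C" "\<And>x c. \<bar>f' x c\<bar> \<le> C * norm c"
    using assms(1) by (auto simp: C1_bounded_def)
  have C: "0 \<le> C" using f(3)[of 0] by linarith
  show ?thesis
    unfolding C1_bounded_def
  proof (intro conjI allI)
    fix x c
    show "((\<lambda>u. f (g u + a)) has_derivative (\<lambda>c. f' (g x + a) (g c))) (at x)"
      by (rule has_derivative_compose[OF _ f(1)])
         (auto intro!: derivative_eq_intros bounded_linear_imp_has_derivative[OF g])
    show "continuous_on UNIV (\<lambda>x. f' (g x + a) (g c))"
      by (rule continuous_on_compose2[OF f(2)])
         (auto intro!: continuous_intros linear_continuous_on[OF g])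
    have "C * 1 \<le> C * K" using K C by (intro mult_left_mono) auto
    then show "\<bar>f (g x + a)\<bar> \<le> C * K" using f(3)[of "g x + a"] by linarith
    have "\<bar>f' (g x + a) (g c)\<bar> \<le> C * norm (g c)" by (rule f(4))
    also have "\<dots> \<le> C * (K * norm c)" using C K by (intro mult_left_mono) auto
    finally show "\<bar>f' (g x + a) (g c)\<bar> \<le> C * K * norm c" by (simp add: mult.assoc)
  qed
qed

lemma C1_bounded_measurable:
  fixes f :: "'v::euclidean_space \<Rightarrow> real"
  assumes "C1_bounded f f' C"
  shows "f \<in> borel_measurable borel" "(\<lambda>x. f' x c) \<in> borel_measurable borel"
proof -
  have "continuous_on UNIV f" "continuous_on UNIV (\<lambda>x. f' x c)"
    using assms unfolding C1_bounded_def
    by (meson has_derivative_continuous continuous_at_imp_continuous_on)+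
  then show "f \<in> borel_measurable borel" "(\<lambda>x. f' x c) \<in> borel_measurable borel"
    by (auto intro: borel_measurable_continuous_onI)
qed

lemma C1_bounded_linear: "C1_bounded f f' C \<Longrightarrow> linear (f' x)"
  by (auto simp: C1_bounded_def intro: has_derivative_linear)

lemma C1_bounded_bounds: "C1_bounded f f' C \<Longrightarrow> \<bar>f x\<bar> \<le> C" "C1_bounded f f' C \<Longrightarrow> \<bar>f' x c\<bar> \<le> C * norm c"
  by (auto simp: C1_bounded_def)

lemma steinD:
  assumes "stein \<Gamma> s" "C1_bounded f f' C"
  shows "(\<integral>x. (x \<bullet> b) * f x \<partial>\<Gamma>) = s * (\<integral>x. f' x b \<partial>\<Gamma>)"
  using assms unfolding stein_def by blast

lemma integrable_mult_bounded:
  fixes f g :: "'a \<Rightarrow> real"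
  assumes "integrable M g" "f \<in> borel_measurable M" "\<And>x. \<bar>f x\<bar> \<le> C"
  shows "integrable M (\<lambda>x. g x * f x)"
proof (rule Bochner_Integration.integrable_bound[OF integrable_mult_left[OF assms(1), of C]])
  have "0 \<le> C" using assms(3)[of undefined] by linarith
  then show "AE x in M. norm (g x * f x) \<le> norm (g x * C)"
    using assms(3) by (intro AE_I2) (simp add: abs_mult mult_left_mono)
qed (use assms in measurable)

lemma stein_scale:
  fixes \<Gamma> :: "'v::euclidean_space measure"
  assumes st: "stein \<Gamma> s" and [measurable_cong]: "sets \<Gamma> = sets borel"
  shows "stein (distr \<Gamma> borel (\<lambda>x. r *\<^sub>R x)) (r\<^sup>2 * s)"
  unfolding stein_def
proof (intro allI impI)
  fix f :: "'v \<Rightarrow> real" and f' C b assume f: "C1_bounded f f' C"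
  note [measurable] = C1_bounded_measurable[OF f]
  have "C1_bounded (\<lambda>u. f (r *\<^sub>R u + 0)) (\<lambda>u c. f' (r *\<^sub>R u + 0) (r *\<^sub>R c)) (C * max 1 \<bar>r\<bar>)"
    by (rule C1_bounded_affine[OF f]) (auto intro!: bounded_linear_scaleR_right mult_right_mono)
  from steinD[OF st this, of b]
  have *: "(\<integral>x. (x \<bullet> b) * f (r *\<^sub>R x) \<partial>\<Gamma>) = s * (\<integral>x. r * f' (r *\<^sub>R x) b \<partial>\<Gamma>)"
    using C1_bounded_linear[OF f] by (simp add: linear_scale)
  have "(\<integral>x. (x \<bullet> b) * f x \<partial>distr \<Gamma> borel (\<lambda>x. r *\<^sub>R x)) = (\<integral>x. r * ((x \<bullet> b) * f (r *\<^sub>R x)) \<partial>\<Gamma>)"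
    by (subst integral_distr) (auto simp: mult.assoc)
  also have "\<dots> = r\<^sup>2 * s * (\<integral>x. f' (r *\<^sub>R x) b \<partial>\<Gamma>)"
    using * by (simp add: power2_eq_square)
  also have "(\<integral>x. f' (r *\<^sub>R x) b \<partial>\<Gamma>) = (\<integral>x. f' x b \<partial>distr \<Gamma> borel (\<lambda>x. r *\<^sub>R x))"
    by (subst integral_distr) auto
  finally show "(\<integral>x. (x \<bullet> b) * f x \<partial>distr \<Gamma> borel (\<lambda>x. r *\<^sub>R x))
      = r\<^sup>2 * s * (\<integral>x. f' x b \<partial>distr \<Gamma> borel (\<lambda>x. r *\<^sub>R x))" .
qed

lemma integrable_norm_pair:
  fixes M :: "'v::euclidean_space measure" and N :: "'w::euclidean_space measure"
  assumes "prob_space M" "prob_space N" and [measurable_cong]: "sets M = sets borel" "sets N = sets borel"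
    and int: "integrable M norm" "integrable N norm"
  shows "integrable (M \<Otimes>\<^sub>M N) norm"
proof (rule Bochner_Integration.integrable_bound)
  show "integrable (M \<Otimes>\<^sub>M N) (\<lambda>z. norm (fst z) + norm (snd z))"
    using integrable_pair_fst[OF assms(2) int(1)] integrable_pair_snd[OF assms(1,2) int(2)]
    by (rule Bochner_Integration.integrable_add)
  show "AE z in M \<Otimes>\<^sub>M N. norm (norm z) \<le> norm (norm (fst z) + norm (snd z))"
    using norm_Pair_le by (intro AE_I2) auto
  have "sets (M \<Otimes>\<^sub>M N) = sets borel"
    using sets_pair_measure_cong[OF assms(3,4)] by (simp only: borel_prod)
  then show "norm \<in> borel_measurable (M \<Otimes>\<^sub>M N)"
    using borel_measurable_norm measurable_cong_sets by blast
qed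

text \<open>Split the direction \<open>b\<close> into its two components, use Stein's identity of
  one factor while the other variable is frozen, and recombine by Fubini and linearity of the
  derivative.\<close>

lemma stein_pair:
  fixes \<Gamma>1 :: "'v::euclidean_space measure" and \<Gamma>2 :: "'w::euclidean_space measure"
  assumes prob: "prob_space \<Gamma>1" "prob_space \<Gamma>2" and [measurable_cong]: "sets \<Gamma>1 = sets borel" "sets \<Gamma>2 = sets borel"
    and int: "integrable \<Gamma>1 norm" "integrable \<Gamma>2 norm" and st: "stein \<Gamma>1 s" "stein \<Gamma>2 s"
  shows "stein (\<Gamma>1 \<Otimes>\<^sub>M \<Gamma>2) s"
  unfolding stein_def
proof (intro allI impI)
  fix f :: "'v \<times> 'w \<Rightarrow> real" and f' C and b :: "'v \<times> 'w" assume f: "C1_bounded f f' C"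
  interpret A: prob_space \<Gamma>1 by fact
  interpret B: prob_space \<Gamma>2 by fact
  interpret P: pair_prob_space \<Gamma>1 \<Gamma>2 ..
  have sets: "sets (\<Gamma>1 \<Otimes>\<^sub>M \<Gamma>2) = sets borel"
    using sets_pair_measure_cong[OF assms(3,4)] by (simp only: borel_prod)
  note fm = C1_bounded_measurable[OF f] and bd = C1_bounded_bounds[OF f]
  have m: "f \<in> borel_measurable (\<Gamma>1 \<Otimes>\<^sub>M \<Gamma>2)" "\<And>c. (\<lambda>x. f' x c) \<in> borel_measurable (\<Gamma>1 \<Otimes>\<^sub>M \<Gamma>2)"
    using fm by (simp_all add: measurable_cong_sets[OF sets refl])
  have i1: "integrable (\<Gamma>1 \<Otimes>\<^sub>M \<Gamma>2) (\<lambda>z. (fst z \<bullet> fst b) * f z)"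
    by (rule integrable_mult_bounded[OF integrable_pair_fst[OF prob(2) integrable_inner[OF int(1) assms(3)]] m(1) bd(1)])
  have i2: "integrable (\<Gamma>1 \<Otimes>\<^sub>M \<Gamma>2) (\<lambda>z. (snd z \<bullet> snd b) * f z)"
    by (rule integrable_mult_bounded[OF integrable_pair_snd[OF prob integrable_inner[OF int(2) assms(4)]] m(1) bd(1)])
  have i3: "integrable (\<Gamma>1 \<Otimes>\<^sub>M \<Gamma>2) (\<lambda>z. f' z c)" for c
    using bd(2)[of _ c] m(2) by (intro P.integrable_const_bound[of _ "C * norm c"]) auto
  have s1: "(\<integral>u. (u \<bullet> fst b) * f (u, v) \<partial>\<Gamma>1) = s * (\<integral>u. f' (u, v) (fst b, 0) \<partial>\<Gamma>1)" for v
  proof -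
    have "C1_bounded (\<lambda>u. f ((u, 0) + (0, v))) (\<lambda>u c. f' ((u, 0) + (0, v)) (c, 0)) (C * 1)"
      by (rule C1_bounded_affine[OF f]) (auto intro!: bounded_linear_Pair bounded_linear_ident bounded_linear_zero simp: norm_Pair)
    from steinD[OF st(1) this] show ?thesis by simp
  qed
  have s2: "(\<integral>v. (v \<bullet> snd b) * f (u, v) \<partial>\<Gamma>2) = s * (\<integral>v. f' (u, v) (0, snd b) \<partial>\<Gamma>2)" for u
  proof -
    have "C1_bounded (\<lambda>v. f ((0, v) + (u, 0))) (\<lambda>v c. f' ((0, v) + (u, 0)) (0, c)) (C * 1)"
      by (rule C1_bounded_affine[OF f]) (auto intro!: bounded_linear_Pair bounded_linear_ident bounded_linear_zero simp: norm_Pair)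
    from steinD[OF st(2) this] show ?thesis by simp
  qed
  have "(\<integral>z. (z \<bullet> b) * f z \<partial>(\<Gamma>1 \<Otimes>\<^sub>M \<Gamma>2)) = (\<integral>z. (fst z \<bullet> fst b) * f z + (snd z \<bullet> snd b) * f z \<partial>(\<Gamma>1 \<Otimes>\<^sub>M \<Gamma>2))"
    by (simp add: inner_prod_def distrib_right)
  also have "\<dots> = (\<integral>z. (fst z \<bullet> fst b) * f z \<partial>(\<Gamma>1 \<Otimes>\<^sub>M \<Gamma>2)) + (\<integral>z. (snd z \<bullet> snd b) * f z \<partial>(\<Gamma>1 \<Otimes>\<^sub>M \<Gamma>2))"
    using i1 i2 by simp
  also have "(\<integral>z. (fst z \<bullet> fst b) * f z \<partial>(\<Gamma>1 \<Otimes>\<^sub>M \<Gamma>2)) = (\<integral>v. \<integral>u. (u \<bullet> fst b) * f (u, v) \<partial>\<Gamma>1 \<partial>\<Gamma>2)"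
    using P.integral_snd[of "\<lambda>u v. (u \<bullet> fst b) * f (u, v)"] i1 by (simp add: case_prod_unfold)
  also have "\<dots> = s * (\<integral>z. f' z (fst b, 0) \<partial>(\<Gamma>1 \<Otimes>\<^sub>M \<Gamma>2))"
    unfolding s1 using P.integral_snd[of "\<lambda>u v. f' (u, v) (fst b, 0)"] i3 by (simp add: case_prod_unfold)
  also have "(\<integral>z. (snd z \<bullet> snd b) * f z \<partial>(\<Gamma>1 \<Otimes>\<^sub>M \<Gamma>2)) = (\<integral>u. \<integral>v. (v \<bullet> snd b) * f (u, v) \<partial>\<Gamma>2 \<partial>\<Gamma>1)"
    using P.integral_fst[of "\<lambda>u v. (v \<bullet> snd b) * f (u, v)"] i2 by (simp add: case_prod_unfold)
  also have "\<dots> = s * (\<integral>z. f' z (0, snd b) \<partial>(\<Gamma>1 \<Otimes>\<^sub>M \<Gamma>2))"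
    unfolding s2 using P.integral_fst[of "\<lambda>u v. f' (u, v) (0, snd b)"] i3 by (simp add: case_prod_unfold)
  also have "s * (\<integral>z. f' z (fst b, 0) \<partial>(\<Gamma>1 \<Otimes>\<^sub>M \<Gamma>2)) + s * (\<integral>z. f' z (0, snd b) \<partial>(\<Gamma>1 \<Otimes>\<^sub>M \<Gamma>2))
      = s * (\<integral>z. f' z (fst b, 0) + f' z (0, snd b) \<partial>(\<Gamma>1 \<Otimes>\<^sub>M \<Gamma>2))"
    using i3 by (simp add: distrib_left)
  also have "(\<lambda>z. f' z (fst b, 0) + f' z (0, snd b)) = (\<lambda>z. f' z b)"
    by (simp add: fun_eq_iff linear_add[OF C1_bounded_linear[OF f], symmetric])
  finally show "(\<integral>z. (z \<bullet> b) * f z \<partial>(\<Gamma>1 \<Otimes>\<^sub>M \<Gamma>2)) = s * (\<integral>z. f' z b \<partial>(\<Gamma>1 \<Otimes>\<^sub>M \<Gamma>2))" .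
qed

text \<open>Variances add, in the form of Stein's identity. Thus the normalised sum can enter the
  Gaussian comparison without its law being identified.\<close>

lemma stein_sum_law:
  fixes \<nu> :: "'v::euclidean_space measure"
  assumes prob: "prob_space \<nu>" and [measurable_cong]: "sets \<nu> = sets borel"
    and int: "integrable \<nu> norm" and st: "stein \<nu> s"
  shows "stein (sum_law \<nu> n) (real n * s)"
proof (induction n)
  case 0
  have "(\<integral>x. (x \<bullet> b) * f x \<partial>return borel 0) = 0" if "C1_bounded f f' C" for f :: "'v \<Rightarrow> real" and f' C b
    using C1_bounded_measurable(1)[OF that] by (subst integral_return) auto
  then show ?case by (auto simp: stein_def)
next
  case (Suc n)
  let ?S = "sum_law \<nu> n"
  interpret A: prob_space \<nu> by fact
  interpret B: prob_space ?S by (rule prob_space_sum_law) fact+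
  interpret P: pair_prob_space ?S \<nu> ..
  show ?case unfolding stein_def
  proof (intro allI impI)
    fix f :: "'v \<Rightarrow> real" and f' C b assume f: "C1_bounded f f' C"
    note [measurable] = C1_bounded_measurable[OF f] note bd = C1_bounded_bounds[OF f]
    have aff: "C1_bounded (\<lambda>u. f (u + a)) (\<lambda>u c. f' (u + a) c) (C * 1)" for a
      by (rule C1_bounded_affine[OF f]) (auto intro!: bounded_linear_ident)
    have i1: "integrable (?S \<Otimes>\<^sub>M \<nu>) (\<lambda>z. (fst z \<bullet> b) * f (fst z + snd z))"
      by (rule integrable_mult_bounded[OF integrable_pair_fst[OF prob
        integrable_inner[OF integrable_norm_sum_law[OF prob assms(2) int] sets_sum_law]] _ bd(1)]) measurable
    have i2: "integrable (?S \<Otimes>\<^sub>M \<nu>) (\<lambda>z. (snd z \<bullet> b) * f (fst z + snd z))"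
      by (rule integrable_mult_bounded[OF integrable_pair_snd[OF B.prob_space_axioms prob
        integrable_inner[OF int assms(2)]] _ bd(1)]) measurable
    have i3: "integrable (?S \<Otimes>\<^sub>M \<nu>) (\<lambda>z. f' (fst z + snd z) b)"
      using bd(2)[of _ b] by (intro P.integrable_const_bound[of _ "C * norm b"]) auto
    have s1: "(\<integral>x. (x \<bullet> b) * f (x + y) \<partial>?S) = real n * s * (\<integral>x. f' (x + y) b \<partial>?S)" for y
      using steinD[OF Suc.IH aff] by simp
    have s2: "(\<integral>y. (y \<bullet> b) * f (x + y) \<partial>\<nu>) = s * (\<integral>y. f' (x + y) b \<partial>\<nu>)" for x
      using steinD[OF st aff, of b x] by (simp add: add.commute)
    have "(\<integral>x. (x \<bullet> b) * f x \<partial>sum_law \<nu> (Suc n)) = (\<integral>z. ((fst z + snd z) \<bullet> b) * f (fst z + snd z) \<partial>(?S \<Otimes>\<^sub>M \<nu>))"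
      unfolding sum_law.simps by (subst integral_distr) (auto simp: case_prod_unfold)
    also have "\<dots> = (\<integral>z. (fst z \<bullet> b) * f (fst z + snd z) \<partial>(?S \<Otimes>\<^sub>M \<nu>)) + (\<integral>z. (snd z \<bullet> b) * f (fst z + snd z) \<partial>(?S \<Otimes>\<^sub>M \<nu>))"
      using i1 i2 by (simp add: inner_add_left distrib_right)
    also have "(\<integral>z. (fst z \<bullet> b) * f (fst z + snd z) \<partial>(?S \<Otimes>\<^sub>M \<nu>)) = (\<integral>y. \<integral>x. (x \<bullet> b) * f (x + y) \<partial>?S \<partial>\<nu>)"
      using P.integral_snd[of "\<lambda>x y. (x \<bullet> b) * f (x + y)"] i1 by (simp add: case_prod_unfold)
    also have "\<dots> = real n * s * (\<integral>z. f' (fst z + snd z) b \<partial>(?S \<Otimes>\<^sub>M \<nu>))"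
      unfolding s1 using P.integral_snd[of "\<lambda>x y. f' (x + y) b"] i3 by (simp add: case_prod_unfold)
    also have "(\<integral>z. (snd z \<bullet> b) * f (fst z + snd z) \<partial>(?S \<Otimes>\<^sub>M \<nu>)) = (\<integral>x. \<integral>y. (y \<bullet> b) * f (x + y) \<partial>\<nu> \<partial>?S)"
      using P.integral_fst[of "\<lambda>x y. (y \<bullet> b) * f (x + y)"] i2 by (simp add: case_prod_unfold)
    also have "\<dots> = s * (\<integral>z. f' (fst z + snd z) b \<partial>(?S \<Otimes>\<^sub>M \<nu>))"
      unfolding s2 using P.integral_fst[of "\<lambda>x y. f' (x + y) b"] i3 by (simp add: case_prod_unfold)
    also have "real n * s * (\<integral>z. f' (fst z + snd z) b \<partial>(?S \<Otimes>\<^sub>M \<nu>)) + s * (\<integral>z. f' (fst z + snd z) b \<partial>(?S \<Otimes>\<^sub>M \<nu>))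
      = real (Suc n) * s * (\<integral>z. f' (fst z + snd z) b \<partial>(?S \<Otimes>\<^sub>M \<nu>))"
      by (simp add: algebra_simps)
    also have "(\<integral>z. f' (fst z + snd z) b \<partial>(?S \<Otimes>\<^sub>M \<nu>)) = (\<integral>x. f' x b \<partial>sum_law \<nu> (Suc n))"
      unfolding sum_law.simps by (subst integral_distr) (auto simp: case_prod_unfold)
    finally show "(\<integral>x. (x \<bullet> b) * f x \<partial>sum_law \<nu> (Suc n)) = real (Suc n) * s * (\<integral>x. f' x b \<partial>sum_law \<nu> (Suc n))" .
  qed
qed

section \<open>Standard Gaussian vectors\<close>

abbreviation std_normal :: "real measure" where
  "std_normal \<equiv> density lborel std_normal_density"

lemma prob_space_std_normal: "prob_space std_normal"
  by (rule prob_space_normal_density) simp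

lemma integral_std_normal:
  fixes f :: "real \<Rightarrow> real"
  assumes "f \<in> borel_measurable borel"
  shows "(\<integral>x. f x \<partial>std_normal) = (\<integral>x. std_normal_density x * f x \<partial>lborel)"
  using assms by (subst integral_density) auto

lemma integrable_std_normal_iff:
  fixes f :: "real \<Rightarrow> real"
  assumes "f \<in> borel_measurable borel"
  shows "integrable std_normal f \<longleftrightarrow> integrable lborel (\<lambda>x. std_normal_density x * f x)"
  using assms by (subst integrable_density) auto

lemma std_normal_moments:
  "integrable std_normal (\<lambda>x. \<bar>x\<bar>)" "(\<integral>x. \<bar>x\<bar> \<partial>std_normal) = sqrt (2 / pi)"
  "integrable std_normal (\<lambda>x. x ^ 2)" "(\<integral>x. x ^ 2 \<partial>std_normal) = 1"
  "integrable std_normal (\<lambda>x. x ^ 4)" "(\<integral>x. x ^ 4 \<partial>std_normal) = 3"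
  using integrable_std_normal_moment_abs[of 1] integrable_std_normal_moment[of 2]
    integrable_std_normal_moment[of 4] integral_std_normal_moment_abs_odd[of 0]
    integral_std_normal_moment_even[of 1] integral_std_normal_moment_even[of 2]
  by (simp_all add: integral_std_normal integrable_std_normal_iff fact_numeral)

text \<open>Integration by parts: the difference of the integrands is the derivative of minus the
  density times \<open>f\<close>, which vanishes at both ends of the line.\<close>

lemma stein_std_normal:
  fixes f :: "real \<Rightarrow> real"
  assumes der: "\<And>x. (f has_real_derivative f' x) (at x)" and cont: "continuous_on UNIV f'"
    and bd: "\<And>x. \<bar>f x\<bar> \<le> C" "\<And>x. \<bar>f' x\<bar> \<le> C"
  shows "(\<integral>x. x * f x \<partial>std_normal) = (\<integral>x. f' x \<partial>std_normal)"
proof -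
  let ?\<rho> = "std_normal_density"
  have contf: "continuous_on UNIV f"
    using der by (meson DERIV_isCont continuous_at_imp_continuous_on)
  note [measurable] = borel_measurable_continuous_onI[OF cont] borel_measurable_continuous_onI[OF contf]
  have C: "0 \<le> C" using bd(1)[of 0] by linarith
  have 1: "integrable lborel (\<lambda>x. ?\<rho> x * (x * f x))"
    by (rule Bochner_Integration.integrable_bound[OF integrable_mult_left[OF integrable_std_normal_moment_abs[of 1], of C]])
       (use bd C in \<open>auto intro!: AE_I2 mult_mono simp: abs_mult mult.assoc\<close>)
  have 2: "integrable lborel (\<lambda>x. ?\<rho> x * f' x)"
    by (rule Bochner_Integration.integrable_bound[OF integrable_mult_left[OF integrable_normal_density[of 1 0], of C]])
       (use bd C in \<open>auto intro!: AE_I2 mult_mono simp: abs_mult\<close>)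
  define G where "G x = - (?\<rho> x * f x)" for x
  have G_der: "(G has_real_derivative (?\<rho> x * (x * f x) - ?\<rho> x * f' x)) (at x)" for x
  proof -
    have "((\<lambda>x. k * exp (- x\<^sup>2 / 2)) has_real_derivative - (x * (k * exp (- x\<^sup>2 / 2)))) (at x)" for k :: real
      by (auto intro!: derivative_eq_intros)
    then have "(?\<rho> has_real_derivative - (x * ?\<rho> x)) (at x)"
      unfolding std_normal_density_def[abs_def] .
    from DERIV_minus[OF DERIV_mult[OF this der]] show ?thesis
      unfolding G_def by (simp add: algebra_simps)
  qed
  have "(G \<longlongrightarrow> 0) at_infinity"
  proof (rule tendsto_0_le[where K = C])
    show "((\<lambda>x. inverse x :: real) \<longlongrightarrow> 0) at_infinity" by (rule tendsto_inverse_0)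
    show "\<forall>\<^sub>F x in at_infinity. norm (G x) \<le> norm (inverse x) * C"
    proof (rule eventually_mono[OF eventually_not_equal_at_infinity[of 0]])
      fix x :: real assume x: "x \<noteq> 0"
      \<comment> \<open>From this square, exp (x^2 / 2) is at least the absolute value of x. The
        density is therefore at most its inverse, which is all the decay that is required.\<close>
      have "0 \<le> (\<bar>x\<bar> - 1)\<^sup>2" by simp
      then have "\<bar>x\<bar> \<le> 1 + x\<^sup>2 / 2" by (simp add: power2_diff)
      also have "\<dots> \<le> exp (x\<^sup>2 / 2)" by (rule exp_ge_add_one_self)
      finally have "exp (- x\<^sup>2 / 2) \<le> inverse \<bar>x\<bar>"
        using x by (simp add: exp_minus le_imp_inverse_le)
      moreover have "1 / sqrt (2 * pi) \<le> 1"
        using pi_gt3 by (simp add: divide_le_eq)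
      ultimately have "1 / sqrt (2 * pi) * exp (- x\<^sup>2 / 2) \<le> 1 * inverse \<bar>x\<bar>"
        by (intro mult_mono) auto
      then have "?\<rho> x \<le> inverse \<bar>x\<bar>" by (simp add: std_normal_density_def)
      then have "?\<rho> x * \<bar>f x\<bar> \<le> inverse \<bar>x\<bar> * C"
        using bd(1)[of x] by (intro mult_mono) auto
      then show "norm (G x) \<le> norm (inverse x) * C" by (simp add: G_def abs_mult)
    qed
  qed
  then have lims: "(G \<longlongrightarrow> 0) at_top" "(G \<longlongrightarrow> 0) at_bot"
    by (auto intro: tendsto_mono[OF at_top_le_at_infinity] tendsto_mono[OF at_bot_le_at_infinity])
  have "(LBINT x=-\<infinity>..\<infinity>. ?\<rho> x * (x * f x) - ?\<rho> x * f' x) = 0 - 0"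
  proof (rule interval_integral_FTC_integrable)
    show "(G has_vector_derivative (?\<rho> x * (x * f x) - ?\<rho> x * f' x)) (at x)" for x
      using G_der by (simp add: has_real_derivative_iff_has_vector_derivative)
    have "continuous_on UNIV (\<lambda>x. ?\<rho> x * (x * f x) - ?\<rho> x * f' x)"
      unfolding std_normal_density_def by (intro continuous_intros cont contf) auto
    then show "isCont (\<lambda>x. ?\<rho> x * (x * f x) - ?\<rho> x * f' x) x" for x
      by (simp add: continuous_on_eq_continuous_at)
    show "set_integrable lborel (einterval (-\<infinity>) \<infinity>) (\<lambda>x. ?\<rho> x * (x * f x) - ?\<rho> x * f' x)"
      using 1 2 by (simp add: set_integrable_def)
  qed (use lims in \<open>auto simp: ereal_tendsto_simps\<close>)
  then have "(\<integral>x. ?\<rho> x * (x * f x) - ?\<rho> x * f' x \<partial>lborel) = 0"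
    by (simp add: interval_lebesgue_integral_def set_lebesgue_integral_def)
  then show ?thesis using 1 2 by (simp add: integral_std_normal)
qed

lemma distr_uminus_std_normal: "distr std_normal borel uminus = std_normal"
proof -
  interpret prob_space std_normal by (rule prob_space_std_normal)
  have "distributed std_normal lborel (\<lambda>x. x) std_normal_density"
    by (simp add: distributed_def distr_id2)
  from normal_density_affine[OF this, of "-1" 0]
  have "distr std_normal lborel (\<lambda>x. - x) = std_normal" by (simp add: distributed_def)
  moreover have "distr std_normal lborel (\<lambda>x. - x) = distr std_normal borel uminus"
    by (intro distr_cong) auto
  ultimately show ?thesis by simp
qed

text \<open>The basis is indexed by an arbitrary set because two indexings occur: pairs of row and
  column for random matrices, and the basis itself for the comparison vector.\<close>

definition gaussian_law :: "('j \<Rightarrow> 'v::euclidean_space) \<Rightarrow> 'j set \<Rightarrow> 'v measure" where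
  "gaussian_law e J = distr (\<Pi>\<^sub>M j\<in>J. std_normal) borel (\<lambda>\<omega>. \<Sum>j\<in>J. \<omega> j *\<^sub>R e j)"

lemma sets_gaussian_law [simp, measurable_cong]: "sets (gaussian_law e J) = sets borel"
  by (simp add: gaussian_law_def)

context
  fixes e :: "'j \<Rightarrow> 'v::euclidean_space" and J :: "'j set"
  assumes bij: "bij_betw e J Basis"
begin

interpretation N: prob_space std_normal by (rule prob_space_std_normal)
interpretation PN: product_prob_space "\<lambda>_::'j. std_normal" J by standard

lemma finite_coords: "finite J"
  using bij bij_betw_finite finite_Basis by blast

lemma coords_Basis: "j \<in> J \<Longrightarrow> e j \<in> Basis"
  using bij by (auto simp: bij_betw_def)

lemma coords_inner:
  assumes "i \<in> J" "j \<in> J"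
  shows "e i \<bullet> e j = (if i = j then 1 else 0)"
proof -
  have "e i = e j \<longleftrightarrow> i = j"
    using bij assms unfolding bij_betw_def by (meson inj_onD)
  then show ?thesis using inner_Basis[OF coords_Basis[OF assms(1)] coords_Basis[OF assms(2)]] by simp
qed

lemma sum_coords_inner:
  assumes "i \<in> J"
  shows "(\<Sum>j\<in>J. \<omega> j *\<^sub>R e j) \<bullet> e i = \<omega> i"
proof -
  have "(\<Sum>j\<in>J. \<omega> j *\<^sub>R e j) \<bullet> e i = (\<Sum>j\<in>J. if j = i then \<omega> j else 0)"
    unfolding inner_sum_left using assms by (intro sum.cong refl) (simp add: coords_inner)
  then show ?thesis using finite_coords assms by simp
qed

lemma coords_expansion: "b = (\<Sum>j\<in>J. (b \<bullet> e j) *\<^sub>R e j)"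
proof -
  have "b = (\<Sum>u\<in>Basis. (b \<bullet> u) *\<^sub>R u)" by (simp add: euclidean_representation)
  also have "\<dots> = (\<Sum>j\<in>J. (b \<bullet> e j) *\<^sub>R e j)" by (rule sum.reindex_bij_betw[OF bij, symmetric])
  finally show ?thesis .
qed

lemma measurable_coords_sum [measurable]: "(\<lambda>\<omega>. \<Sum>j\<in>J. \<omega> j *\<^sub>R e j) \<in> borel_measurable (\<Pi>\<^sub>M j\<in>J. std_normal)"
  by measurable

lemma prob_space_gaussian_law: "prob_space (gaussian_law e J)"
  unfolding gaussian_law_def by (rule PN.prob_space_distr) measurable

lemma distr_coordinate: "i \<in> J \<Longrightarrow> distr (\<Pi>\<^sub>M j\<in>J. std_normal) std_normal (\<lambda>\<omega>. \<omega> i) = std_normal"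
  using PN.PiM_component[of i] by simp

lemma integrable_coordinate:
  fixes g :: "real \<Rightarrow> real"
  assumes "i \<in> J" "integrable std_normal g"
  shows "integrable (\<Pi>\<^sub>M j\<in>J. std_normal) (\<lambda>\<omega>. g (\<omega> i))"
  by (rule integrable_distr[of "\<lambda>\<omega>. \<omega> i" _ std_normal]) (use assms in \<open>simp_all add: distr_coordinate\<close>)

lemma integral_coordinate:
  fixes g :: "real \<Rightarrow> real"
  assumes "i \<in> J" and [measurable]: "g \<in> borel_measurable borel"
  shows "(\<integral>\<omega>. g (\<omega> i) \<partial>(\<Pi>\<^sub>M j\<in>J. std_normal)) = (\<integral>y. g y \<partial>std_normal)"
proof -
  have "(\<integral>y. g y \<partial>std_normal) = (\<integral>y. g y \<partial>distr (\<Pi>\<^sub>M j\<in>J. std_normal) std_normal (\<lambda>\<omega>. \<omega> i))"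
    by (simp only: distr_coordinate[OF assms(1)])
  also have "\<dots> = (\<integral>\<omega>. g (\<omega> i) \<partial>(\<Pi>\<^sub>M j\<in>J. std_normal))"
    using assms(1) by (intro integral_distr) measurable
  finally show ?thesis ..
qed

lemma integrable_norm_gaussian_law: "integrable (gaussian_law e J) norm"
  unfolding gaussian_law_def
proof (subst integrable_distr_eq)
  have "integrable (\<Pi>\<^sub>M j\<in>J. std_normal) (\<lambda>\<omega>. \<Sum>j\<in>J. \<bar>\<omega> j\<bar>)"
    using integrable_coordinate std_normal_moments(1) by (intro Bochner_Integration.integrable_sum) blast
  then show "integrable (\<Pi>\<^sub>M j\<in>J. std_normal) (\<lambda>\<omega>. norm (\<Sum>j\<in>J. \<omega> j *\<^sub>R e j))"
  proof (rule Bochner_Integration.integrable_bound)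
    have "norm (\<Sum>j\<in>J. \<omega> j *\<^sub>R e j) \<le> (\<Sum>j\<in>J. \<bar>\<omega> j\<bar>)" for \<omega> :: "'j \<Rightarrow> real"
      using norm_sum[of "\<lambda>j. \<omega> j *\<^sub>R e j" J] coords_Basis by (simp add: norm_Basis)
    then show "AE \<omega> in \<Pi>\<^sub>M j\<in>J. std_normal. norm (norm (\<Sum>j\<in>J. \<omega> j *\<^sub>R e j)) \<le> norm (\<Sum>j\<in>J. \<bar>\<omega> j\<bar>)"
      by (intro AE_I2) (simp add: sum_nonneg)
  qed measurable
qed auto

text \<open>The one-dimensional identity is applied to each coordinate with the others frozen; the
  directional version is the combination of these with the coefficients
  \<open>b \<bullet> e i\<close>.\<close>

lemma stein_gaussian_law: "stein (gaussian_law e J) 1"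
  unfolding stein_def
proof (intro allI impI)
  fix f :: "'v \<Rightarrow> real" and f' C b assume "C1_bounded f f' C"
  then have f: "\<And>x. (f has_derivative f' x) (at x)" "\<And>c. continuous_on UNIV (\<lambda>x. f' x c)"
    "\<And>x. \<bar>f x\<bar> \<le> C" "\<And>x c. \<bar>f' x c\<bar> \<le> C * norm c"
    by (auto simp: C1_bounded_def)
  have contf: "continuous_on UNIV f"
    using f(1) by (meson has_derivative_continuous continuous_at_imp_continuous_on)
  have fm[measurable]: "f \<in> borel_measurable borel" "\<And>c. (\<lambda>x. f' x c) \<in> borel_measurable borel"
    using borel_measurable_continuous_onI[OF contf] borel_measurable_continuous_onI[OF f(2)] by auto
  let ?P = "\<Pi>\<^sub>M j\<in>J. std_normal" and ?S = "\<lambda>\<omega>. \<Sum>j\<in>J. \<omega> j *\<^sub>R e j"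
  have C: "0 \<le> C" using f(3)[of 0] by linarith
  have int1: "integrable ?P (\<lambda>\<omega>. \<omega> i * f (?S \<omega>))" if "i \<in> J" for i
    by (rule Bochner_Integration.integrable_bound[OF integrable_mult_left[OF integrable_coordinate[OF that std_normal_moments(1)], of C]])
       (use f(3) C that in \<open>auto intro!: AE_I2 mult_left_mono simp: abs_mult\<close>)
  have int2: "integrable ?P (\<lambda>\<omega>. f' (?S \<omega>) c)" for c
    using f(4)[of _ c] by (intro PN.integrable_const_bound[of _ "C * norm c"]) auto
  have coord: "(\<integral>\<omega>. \<omega> i * f (?S \<omega>) \<partial>?P) = (\<integral>\<omega>. f' (?S \<omega>) (e i) \<partial>?P)" if i: "i \<in> J" for i
  proof -
    define I where "I = J - {i}"
    have J: "J = insert i I" "finite I" "i \<notin> I" using i finite_coords by (auto simp: I_def)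
    have S: "?S (fun_upd \<omega> i y) = (\<Sum>j\<in>I. \<omega> j *\<^sub>R e j) + y *\<^sub>R e i" for \<omega> y
      unfolding J(1) using J(2,3) by (subst sum.insert) (auto intro!: sum.cong simp: add.commute)
    have st: "(\<integral>y. y * f (s + y *\<^sub>R e i) \<partial>std_normal) = (\<integral>y. f' (s + y *\<^sub>R e i) (e i) \<partial>std_normal)" for s
    proof (rule stein_std_normal[where C = C])
      fix y
      have "((\<lambda>y. f (s + y *\<^sub>R e i)) has_derivative (\<lambda>t. f' (s + y *\<^sub>R e i) (t *\<^sub>R e i))) (at y)"
        by (rule has_derivative_compose[OF _ f(1)]) (auto intro!: derivative_eq_intros)
      moreover have "f' (s + y *\<^sub>R e i) (t *\<^sub>R e i) = f' (s + y *\<^sub>R e i) (e i) * t" for t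
        using has_derivative_linear[OF f(1)] by (simp add: linear_scale)
      ultimately show "((\<lambda>y. f (s + y *\<^sub>R e i)) has_real_derivative f' (s + y *\<^sub>R e i) (e i)) (at y)"
        by (simp add: has_field_derivative_def)
      show "\<bar>f' (s + y *\<^sub>R e i) (e i)\<bar> \<le> C"
        using f(4)[of "s + y *\<^sub>R e i" "e i"] coords_Basis[OF i] by (simp add: norm_Basis)
    qed (use f(3) in \<open>auto intro!: continuous_on_compose2[OF f(2)] continuous_intros\<close>)
    have "(\<integral>\<omega>. \<omega> i * f (?S \<omega>) \<partial>?P) = (\<integral>\<omega>. (\<integral>y. (fun_upd \<omega> i y) i * f (?S (fun_upd \<omega> i y)) \<partial>std_normal) \<partial>(\<Pi>\<^sub>M j\<in>I. std_normal))"
      using PN.product_integral_insert[OF J(2,3), folded J(1), OF int1[OF i]] .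
    also have "\<dots> = (\<integral>\<omega>. (\<integral>y. f' (?S (fun_upd \<omega> i y)) (e i) \<partial>std_normal) \<partial>(\<Pi>\<^sub>M j\<in>I. std_normal))"
      unfolding S using st by simp
    also have "\<dots> = (\<integral>\<omega>. f' (?S \<omega>) (e i) \<partial>?P)"
      using PN.product_integral_insert[OF J(2,3), folded J(1), OF int2, of "e i"] by simp
    finally show ?thesis .
  qed
  have lin: "f' x b = (\<Sum>i\<in>J. (b \<bullet> e i) * f' x (e i))" for x
  proof -
    have "f' x b = f' x (\<Sum>i\<in>J. (b \<bullet> e i) *\<^sub>R e i)" using coords_expansion[of b] by simp
    also have "\<dots> = (\<Sum>i\<in>J. (b \<bullet> e i) * f' x (e i))"
      using has_derivative_linear[OF f(1), of x] by (simp add: linear_sum linear_scale)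
    finally show ?thesis .
  qed
  have inb: "x \<bullet> b = (\<Sum>i\<in>J. (b \<bullet> e i) * (x \<bullet> e i))" for x
    by (subst coords_expansion[of b]) (simp add: inner_sum_right)
  have "(\<integral>x. (x \<bullet> b) * f x \<partial>gaussian_law e J) = (\<integral>\<omega>. (?S \<omega> \<bullet> b) * f (?S \<omega>) \<partial>?P)"
    unfolding gaussian_law_def by (rule integral_distr) measurable
  also have "\<dots> = (\<integral>\<omega>. (\<Sum>i\<in>J. (b \<bullet> e i) * (\<omega> i * f (?S \<omega>))) \<partial>?P)"
    by (intro Bochner_Integration.integral_cong refl)
       (simp add: inb sum_coords_inner sum_distrib_right mult.assoc)
  also have "\<dots> = (\<Sum>i\<in>J. (b \<bullet> e i) * (\<integral>\<omega>. \<omega> i * f (?S \<omega>) \<partial>?P))"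
    using int1 by (subst Bochner_Integration.integral_sum) auto
  also have "\<dots> = (\<Sum>i\<in>J. (b \<bullet> e i) * (\<integral>\<omega>. f' (?S \<omega>) (e i) \<partial>?P))"
    using coord by simp
  also have "\<dots> = (\<integral>\<omega>. f' (?S \<omega>) b \<partial>?P)"
    unfolding lin[of _] using int2 by (subst Bochner_Integration.integral_sum) auto
  also have "\<dots> = (\<integral>x. f' x b \<partial>gaussian_law e J)"
    unfolding gaussian_law_def by (rule integral_distr[symmetric]) measurable
  finally show "(\<integral>x. (x \<bullet> b) * f x \<partial>gaussian_law e J) = 1 * (\<integral>x. f' x b \<partial>gaussian_law e J)" by simp
qed

lemma second_moment_gaussian_law:
  assumes "b \<in> Basis"
  shows "integrable (gaussian_law e J) (\<lambda>x. (x \<bullet> b)\<^sup>2)" "(\<integral>x. (x \<bullet> b)\<^sup>2 \<partial>gaussian_law e J) = 1"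
proof -
  obtain i where i: "i \<in> J" "b = e i" using assms bij by (auto simp: bij_betw_def)
  show "integrable (gaussian_law e J) (\<lambda>x. (x \<bullet> b)\<^sup>2)"
    unfolding gaussian_law_def
    using integrable_coordinate[OF i(1) std_normal_moments(3)]
    by (subst integrable_distr_eq) (auto simp: i(2) sum_coords_inner[OF i(1)])
  have "(\<integral>x. (x \<bullet> b)\<^sup>2 \<partial>gaussian_law e J) = (\<integral>\<omega>. (\<omega> i)\<^sup>2 \<partial>(\<Pi>\<^sub>M j\<in>J. std_normal))"
    unfolding gaussian_law_def by (subst integral_distr) (auto simp: i(2) sum_coords_inner[OF i(1)])
  then show "(\<integral>x. (x \<bullet> b)\<^sup>2 \<partial>gaussian_law e J) = 1"
    using integral_coordinate[OF i(1), of "\<lambda>y. y\<^sup>2"] std_normal_moments(4) by simp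
qed


text \<open>Coordinatewise negation preserves the measure of every box, hence the product measure.
  Symmetrisation relies on this symmetry.\<close>

lemma distr_uminus_gaussian_law: "distr (gaussian_law e J) borel uminus = gaussian_law e J"
proof -
  let ?P = "\<Pi>\<^sub>M j\<in>J. std_normal" and ?S = "\<lambda>\<omega>. \<Sum>j\<in>J. \<omega> j *\<^sub>R e j"
  \<comment> \<open>The restriction to \<open>J\<close> keeps the image among the extensional
    functions that form the product space.\<close>
  define neg :: "('j \<Rightarrow> real) \<Rightarrow> 'j \<Rightarrow> real" where "neg \<omega> = (\<lambda>j\<in>J. - \<omega> j)" for \<omega>
  have neg_meas[measurable]: "neg \<in> measurable ?P ?P"
    unfolding neg_def by measurable
  have "distr ?P ?P neg = ?P"
  proof (rule PN.PiM_eqI[OF finite_coords])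
    fix A :: "'j \<Rightarrow> real set" assume A: "\<And>i. i \<in> J \<Longrightarrow> A i \<in> sets std_normal"
    have "(uminus :: real \<Rightarrow> real) \<in> borel_measurable borel" by measurable
    then have uA: "uminus -` A j \<in> sets borel" if "j \<in> J" for j
      using A[OF that] by (intro measurable_sets_borel) auto
    have "emeasure (distr ?P ?P neg) (Pi\<^sub>E J A) = emeasure ?P (neg -` Pi\<^sub>E J A \<inter> space ?P)"
      using A finite_coords by (intro emeasure_distr sets_PiM_I_finite) auto
    also have "neg -` Pi\<^sub>E J A \<inter> space ?P = Pi\<^sub>E J (\<lambda>j. uminus -` A j)"
      by (auto simp: neg_def space_PiM PiE_iff)
    also have "emeasure ?P \<dots> = (\<Prod>j\<in>J. emeasure std_normal (uminus -` A j))"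
      using uA finite_coords by (intro PN.emeasure_PiM) auto
    also have "\<dots> = (\<Prod>j\<in>J. emeasure std_normal (A j))"
    proof (intro prod.cong refl)
      fix j assume "j \<in> J"
      then have "emeasure (distr std_normal borel uminus) (A j) = emeasure std_normal (uminus -` A j)"
        using A by (subst emeasure_distr) auto
      then show "emeasure std_normal (uminus -` A j) = emeasure std_normal (A j)"
        by (simp add: distr_uminus_std_normal)
    qed
    finally show "emeasure (distr ?P ?P neg) (Pi\<^sub>E J A) = (\<Prod>j\<in>J. emeasure std_normal (A j))" .
  qed simp
  then have "gaussian_law e J = distr (distr ?P ?P neg) borel ?S" by (simp add: gaussian_law_def)
  also have "\<dots> = distr ?P borel (\<lambda>\<omega>. ?S (neg \<omega>))"
    by (subst distr_distr) (auto simp: comp_def)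
  also have "(\<lambda>\<omega>. ?S (neg \<omega>)) = (\<lambda>\<omega>. - ?S \<omega>)"
    by (auto simp: neg_def sum_negf[symmetric] intro!: sum.cong)
  also have "distr ?P borel (\<lambda>\<omega>. - ?S \<omega>) = distr (gaussian_law e J) borel uminus"
    unfolding gaussian_law_def by (subst distr_distr) (auto simp: comp_def)
  finally show ?thesis by (rule sym)
qed

lemma indep_coordinates:
  assumes "J \<noteq> {}"
  shows "PN.indep_vars (\<lambda>_. borel) (\<lambda>j \<omega>. \<omega> j) J"
proof (subst PN.indep_vars_iff_distr_eq_PiM'[OF assms])
  let ?P = "\<Pi>\<^sub>M j\<in>J. std_normal"
  have 1: "distr ?P borel (\<lambda>\<omega>. \<omega> j) = std_normal" if "j \<in> J" for j
    using distr_coordinate[OF that] by (subst distr_cong[OF refl _ refl, of borel std_normal]) auto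
  have "distr ?P (\<Pi>\<^sub>M j\<in>J. borel) (\<lambda>\<omega>. \<lambda>j\<in>J. \<omega> j) = distr ?P ?P (\<lambda>\<omega>. \<omega>)"
    by (rule distr_cong) (auto simp: space_PiM PiE_iff extensional_restrict intro!: sets_PiM_cong)
  also have "\<dots> = ?P" by (simp add: distr_id2)
  also have "\<dots> = (\<Pi>\<^sub>M j\<in>J. distr ?P borel (\<lambda>\<omega>. \<omega> j))"
    using 1 by (intro PiM_cong) auto
  finally show "distr ?P (\<Pi>\<^sub>M j\<in>J. borel) (\<lambda>\<omega>. \<lambda>j\<in>J. \<omega> j) = (\<Pi>\<^sub>M j\<in>J. distr ?P borel (\<lambda>\<omega>. \<omega> j))" .
qed measurable

text \<open>The inner product is a combination of independent standard normals, and its squared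
  coefficients sum to 1 by Parseval.\<close>

lemma gaussian_law_marginal:
  assumes t: "norm t = 1"
  shows "distr (gaussian_law e J) borel (\<lambda>x. x \<bullet> t) = std_normal"
proof -
  let ?P = "\<Pi>\<^sub>M j\<in>J. std_normal" and ?S = "\<lambda>\<omega>. \<Sum>j\<in>J. \<omega> j *\<^sub>R e j"
  \<comment> \<open>Coefficients equal to 0 are discarded because the addition theorem for
    independent normals asks for positive standard deviations.\<close>
  define K where "K = {j\<in>J. e j \<bullet> t \<noteq> 0}"
  have K: "K \<subseteq> J" "finite K" using finite_coords by (auto simp: K_def)
  have sq: "(\<Sum>j\<in>K. (e j \<bullet> t)\<^sup>2) = 1"
  proof -
    have "1 = t \<bullet> t" using t by (simp add: norm_eq_1)
    also have "\<dots> = (\<Sum>j\<in>J. (e j \<bullet> t)\<^sup>2)"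
      by (subst (2) coords_expansion) (simp add: inner_sum_right power2_eq_square inner_commute)
    also have "\<dots> = (\<Sum>j\<in>K. (e j \<bullet> t)\<^sup>2)"
      unfolding K_def using finite_coords by (intro sum.mono_neutral_right) auto
    finally show ?thesis ..
  qed
  then have "K \<noteq> {}" by auto
  with K have "J \<noteq> {}" by auto
  have dist: "distributed ?P lborel (\<lambda>\<omega>. \<omega> j) std_normal_density" if "j \<in> J" for j
  proof -
    have "distr ?P lborel (\<lambda>\<omega>. \<omega> j) = distr ?P std_normal (\<lambda>\<omega>. \<omega> j)" by (rule distr_cong) auto
    then show ?thesis using that by (simp add: distributed_def distr_coordinate)
  qed
  have "distributed ?P lborel (\<lambda>\<omega>. \<Sum>j\<in>K. (e j \<bullet> t) * \<omega> j) (normal_density (\<Sum>j\<in>K. 0) (sqrt (\<Sum>j\<in>K. \<bar>e j \<bullet> t\<bar>\<^sup>2)))"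
  proof (rule PN.sum_indep_normal)
    show "PN.indep_vars (\<lambda>_. borel) (\<lambda>j \<omega>. (e j \<bullet> t) * \<omega> j) K"
      by (rule PN.indep_vars_compose2[OF PN.indep_vars_subset[OF indep_coordinates[OF \<open>J \<noteq> {}\<close>] K(1)]]) auto
    show "distributed ?P lborel (\<lambda>\<omega>. (e j \<bullet> t) * \<omega> j) (normal_density 0 \<bar>e j \<bullet> t\<bar>)" if "j \<in> K" for j
      using PN.normal_density_affine[OF dist, of j "e j \<bullet> t" 0] that by (simp add: K_def)
  qed (use K \<open>K \<noteq> {}\<close> in \<open>auto simp: K_def\<close>)
  then have d: "distr ?P lborel (\<lambda>\<omega>. \<Sum>j\<in>K. (e j \<bullet> t) * \<omega> j) = std_normal"
    by (simp add: distributed_def sq)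
  have S: "?S \<omega> \<bullet> t = (\<Sum>j\<in>K. (e j \<bullet> t) * \<omega> j)" for \<omega>
  proof -
    have "?S \<omega> \<bullet> t = (\<Sum>j\<in>J. (e j \<bullet> t) * \<omega> j)" by (simp add: inner_sum_left mult.commute)
    also have "\<dots> = (\<Sum>j\<in>K. (e j \<bullet> t) * \<omega> j)"
      unfolding K_def using finite_coords by (intro sum.mono_neutral_right) auto
    finally show ?thesis .
  qed
  have "distr (gaussian_law e J) borel (\<lambda>x. x \<bullet> t) = distr ?P borel (\<lambda>\<omega>. ?S \<omega> \<bullet> t)"
    unfolding gaussian_law_def by (subst distr_distr) (auto simp: comp_def)
  also have "\<dots> = distr ?P lborel (\<lambda>\<omega>. \<Sum>j\<in>K. (e j \<bullet> t) * \<omega> j)"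
    by (intro distr_cong) (auto simp: S)
  finally show ?thesis by (simp add: d)
qed

end

section \<open>Comparison of expected maxima and the expected bilinear supremum\<close>

lemma integrable_ln_sum_exp:
  fixes z :: "'i \<Rightarrow> 'a \<Rightarrow> real"
  assumes P: "finite P" "P \<noteq> {}" and \<beta>: "\<beta> > 0" and z: "\<And>i. i \<in> P \<Longrightarrow> integrable M (z i)"
    and const: "integrable M (\<lambda>_. ln (card P) / \<beta> :: real)"
  shows "integrable M (\<lambda>w. ln (\<Sum>i\<in>P. exp (\<beta> * z i w)))"
proof -
  have "integrable M (\<lambda>w. ln (\<Sum>i\<in>P. exp (\<beta> * z i w)) / \<beta>)"
  proof (rule Bochner_Integration.integrable_bound)
    show "integrable M (\<lambda>w. (\<Sum>i\<in>P. \<bar>z i w\<bar>) + ln (card P) / \<beta>)"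
      by (intro Bochner_Integration.integrable_add Bochner_Integration.integrable_sum integrable_abs z const)
    have "\<bar>ln (\<Sum>i\<in>P. exp (\<beta> * z i w)) / \<beta>\<bar> \<le> \<bar>(\<Sum>i\<in>P. \<bar>z i w\<bar>) + ln (card P) / \<beta>\<bar>" for w
    proof -
      have "0 \<le> ln (card P) / \<beta>" using P \<beta> by (simp add: Suc_le_eq card_gt_0_iff)
      then show ?thesis
        using ln_sum_exp_bounds[OF P \<beta>, of "\<lambda>i. z i w"] abs_Max_image_le[OF P, of "\<lambda>i. z i w"] by linarith
    qed
    then show "AE w in M. norm (ln (\<Sum>i\<in>P. exp (\<beta> * z i w)) / \<beta>) \<le> norm ((\<Sum>i\<in>P. \<bar>z i w\<bar>) + ln (card P) / \<beta>)"
      by (intro AE_I2) simp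
    have "(\<lambda>w. \<Sum>i\<in>P. exp (\<beta> * z i w)) \<in> borel_measurable M"
      by (intro borel_measurable_sum borel_measurable_exp[THEN measurable_compose[rotated]]
          borel_measurable_times borel_measurable_const borel_measurable_integrable z)
    then show "(\<lambda>w. ln (\<Sum>i\<in>P. exp (\<beta> * z i w)) / \<beta>) \<in> borel_measurable M"
      by measurable
  qed
  then have "integrable M (\<lambda>w. \<beta> * (ln (\<Sum>i\<in>P. exp (\<beta> * z i w)) / \<beta>))" by (rule integrable_mult_right)
  then show ?thesis using \<beta> by simp
qed

lemma integral_pair_fst:
  fixes f :: "'a \<Rightarrow> real"
  assumes "prob_space M" "prob_space N" "integrable M f"
  shows "(\<integral>z. f (fst z) \<partial>(M \<Otimes>\<^sub>M N)) = (\<integral>x. f x \<partial>M)"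
proof -
  interpret M: prob_space M by fact
  interpret N: prob_space N by fact
  interpret pair_prob_space M N ..
  show ?thesis
    using integral_fst[of "\<lambda>x y. f x"] integrable_pair_fst[OF assms(2,3)]
    by (simp add: case_prod_unfold N.prob_space)
qed

lemma integral_pair_snd:
  fixes f :: "'b \<Rightarrow> real"
  assumes "prob_space M" "prob_space N" "integrable N f"
  shows "(\<integral>z. f (snd z) \<partial>(M \<Otimes>\<^sub>M N)) = (\<integral>y. f y \<partial>N)"
proof -
  interpret M: prob_space M by fact
  interpret N: prob_space N by fact
  interpret pair_prob_space M N ..
  show ?thesis
    using integral_fst[of "\<lambda>x y. f y"] integrable_pair_snd[OF assms]
    by (simp add: case_prod_unfold M.prob_space)
qed

text \<open>Both laws are placed on their product so that a single measure satisfying Stein's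
  identity carries the interpolation; afterwards \<open>\<beta>\<close> tends to infinity.\<close>

lemma sudakov_fernique:
  fixes A :: "'i \<Rightarrow> 'v::euclidean_space" and B :: "'i \<Rightarrow> 'w::euclidean_space"
    and \<Gamma>1 :: "'v measure" and \<Gamma>2 :: "'w measure"
  assumes prob: "prob_space \<Gamma>1" "prob_space \<Gamma>2" and sets: "sets \<Gamma>1 = sets borel" "sets \<Gamma>2 = sets borel"
    and int: "integrable \<Gamma>1 norm" "integrable \<Gamma>2 norm" and st: "stein \<Gamma>1 1" "stein \<Gamma>2 1"
    and P: "finite P" "P \<noteq> {}"
    and incr: "\<And>i j. i \<in> P \<Longrightarrow> j \<in> P \<Longrightarrow> norm (A i - A j) \<le> norm (B i - B j)"
  shows "(\<integral>x. Max ((\<lambda>i. h i + x \<bullet> A i) ` P) \<partial>\<Gamma>1) \<le> (\<integral>y. Max ((\<lambda>i. h i + y \<bullet> B i) ` P) \<partial>\<Gamma>2)"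
proof -
  interpret G1: prob_space \<Gamma>1 by fact
  interpret G2: prob_space \<Gamma>2 by fact
  interpret pair_prob_space \<Gamma>1 \<Gamma>2 ..
  let ?\<Gamma> = "\<Gamma>1 \<Otimes>\<^sub>M \<Gamma>2"
  have sets': "sets ?\<Gamma> = sets borel"
    using sets_pair_measure_cong[OF sets] by (simp only: borel_prod)
  let ?m = "\<lambda>x. Max ((\<lambda>i. h i + x \<bullet> A i) ` P)" and ?m' = "\<lambda>y. Max ((\<lambda>i. h i + y \<bullet> B i) ` P)"
  have i1: "integrable \<Gamma>1 (\<lambda>x. h i + x \<bullet> A i)" for i
    by (intro Bochner_Integration.integrable_add integrable_inner int sets) auto
  have i2: "integrable \<Gamma>2 (\<lambda>x. h i + x \<bullet> B i)" for i
    by (intro Bochner_Integration.integrable_add integrable_inner int sets) auto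
  have m1: "integrable \<Gamma>1 ?m" and m2: "integrable \<Gamma>2 ?m'"
    by (intro integrable_Max_image P i1 i2)+
  have main: "(\<integral>x. ?m x \<partial>\<Gamma>1) \<le> (\<integral>y. ?m' y \<partial>\<Gamma>2) + ln (card P) / \<beta>" if \<beta>: "\<beta> > 0" for \<beta>
  proof -
    let ?L = "\<lambda>w. ln (\<Sum>i\<in>P. exp (\<beta> * (h i + fst w \<bullet> A i))) / \<beta>"
    let ?L' = "\<lambda>w. ln (\<Sum>i\<in>P. exp (\<beta> * (h i + snd w \<bullet> B i))) / \<beta>"
    have L: "integrable ?\<Gamma> ?L"
      by (intro integrable_divide_zero disjI2 integrable_ln_sum_exp P \<beta>)
         (rule integrable_pair_fst[OF prob(2) i1], simp)
    have L': "integrable ?\<Gamma> ?L'"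
      by (intro integrable_divide_zero disjI2 integrable_ln_sum_exp P \<beta>)
         (rule integrable_pair_snd[OF prob i2], simp)
    have "(\<integral>x. ?m x \<partial>\<Gamma>1) = (\<integral>w. ?m (fst w) \<partial>?\<Gamma>)"
      by (rule integral_pair_fst[OF prob m1, symmetric])
    also have "\<dots> \<le> (\<integral>w. ?L w \<partial>?\<Gamma>)"
      by (intro integral_mono L integrable_pair_fst[OF prob(2) m1] ln_sum_exp_bounds(1) P \<beta>)
    also have "\<dots> \<le> (\<integral>w. ?L' w \<partial>?\<Gamma>)"
    proof -
      have "integrable ?\<Gamma> norm" by (rule integrable_norm_pair[OF prob sets int])
      from smooth_sudakov_fernique[OF prob_space_axioms sets' this stein_pair[OF prob sets int st] P \<beta> incr, where h = h]
      show ?thesis using \<beta> by (simp add: divide_right_mono)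
    qed
    also have "\<dots> \<le> (\<integral>w. ?m' (snd w) + ln (card P) / \<beta> \<partial>?\<Gamma>)"
      by (intro integral_mono L' Bochner_Integration.integrable_add integrable_pair_snd[OF prob m2] ln_sum_exp_bounds(2) P \<beta>) auto
    also have "\<dots> = (\<integral>y. ?m' y \<partial>\<Gamma>2) + ln (card P) / \<beta>"
      using integrable_pair_snd[OF prob m2] integral_pair_snd[OF prob m2] by (simp add: prob_space)
    finally show ?thesis .
  qed
  show ?thesis
  proof (rule tendsto_lowerbound)
    have "((\<lambda>\<beta>. (\<integral>y. ?m' y \<partial>\<Gamma>2) + ln (card P) * inverse \<beta>) \<longlongrightarrow> (\<integral>y. ?m' y \<partial>\<Gamma>2) + ln (card P) * 0) at_top"
      by (intro tendsto_intros tendsto_inverse_0_at_top filterlim_ident)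
    then show "((\<lambda>\<beta>. (\<integral>y. ?m' y \<partial>\<Gamma>2) + ln (card P) / \<beta>) \<longlongrightarrow> (\<integral>y. ?m' y \<partial>\<Gamma>2)) at_top"
      by (simp add: divide_inverse)
    show "\<forall>\<^sub>F \<beta> in at_top. (\<integral>x. ?m x \<partial>\<Gamma>1) \<le> (\<integral>y. ?m' y \<partial>\<Gamma>2) + ln (card P) / \<beta>"
      using eventually_gt_at_top[of 0] by eventually_elim (rule main)
  qed auto
qed

lemma second_moments_pair_gaussian:
  defines "\<Gamma> \<equiv> gaussian_law (\<lambda>b. b) (Basis :: ((real^'k) \<times> (real^'p)) set)"
  shows "integrable \<Gamma> (\<lambda>y. (norm (fst y))\<^sup>2)" "(\<integral>y. (norm (fst y))\<^sup>2 \<partial>\<Gamma>) = real CARD('k)"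
    "integrable \<Gamma> (\<lambda>y. (norm (snd y))\<^sup>2)" "(\<integral>y. (norm (snd y))\<^sup>2 \<partial>\<Gamma>) = real CARD('p)"
proof -
  have bij: "bij_betw (\<lambda>b. b) (Basis :: ((real^'k) \<times> (real^'p)) set) Basis" by (simp add: bij_betw_def)
  note mom = second_moment_gaussian_law[OF bij, folded \<Gamma>_def]
  have fst_eq: "(norm (fst y))\<^sup>2 = (\<Sum>b\<in>Basis. (y \<bullet> (b, 0))\<^sup>2)" for y :: "(real^'k) \<times> (real^'p)"
    unfolding power2_norm_eq_inner by (subst euclidean_inner) (simp add: inner_prod_def power2_eq_square)
  have snd_eq: "(norm (snd y))\<^sup>2 = (\<Sum>b\<in>Basis. (y \<bullet> (0, b))\<^sup>2)" for y :: "(real^'k) \<times> (real^'p)"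
    unfolding power2_norm_eq_inner by (subst euclidean_inner) (simp add: inner_prod_def power2_eq_square)
  have B: "b \<in> Basis \<Longrightarrow> (b, 0) \<in> (Basis :: ((real^'k) \<times> (real^'p)) set)"
    "b' \<in> Basis \<Longrightarrow> (0, b') \<in> (Basis :: ((real^'k) \<times> (real^'p)) set)" for b b'
    by (auto simp: Basis_prod_def)
  show "integrable \<Gamma> (\<lambda>y. (norm (fst y))\<^sup>2)" "integrable \<Gamma> (\<lambda>y. (norm (snd y))\<^sup>2)"
    unfolding fst_eq snd_eq using mom B by (auto intro!: Bochner_Integration.integrable_sum)
  show "(\<integral>y. (norm (fst y))\<^sup>2 \<partial>\<Gamma>) = real CARD('k)" "(\<integral>y. (norm (snd y))\<^sup>2 \<partial>\<Gamma>) = real CARD('p)"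
    unfolding fst_eq snd_eq using mom B by (simp_all add: Bochner_Integration.integral_sum)
qed

text \<open>The comparison process pairs a standard Gaussian vector (g, h) with (u, v), so its
  maximum is at most that of c/2 and the sum of the norms of g and h. Second moments of g and h then
  suffice.\<close>

lemma expected_max_bilinear_le:
  fixes \<Gamma> :: "(real^'p^'k) measure" and Q :: "((real^'k) \<times> (real^'p)) set"
  assumes prob: "prob_space \<Gamma>" and sets: "sets \<Gamma> = sets borel" and int: "integrable \<Gamma> norm"
    and st: "stein \<Gamma> 1" and Q: "finite Q" "\<And>u v. (u, v) \<in> Q \<Longrightarrow> norm u = 1 \<and> norm v = 1"
  defines "c \<equiv> sqrt (real CARD('k)) + sqrt (real CARD('p))"
  shows "integrable \<Gamma> (\<lambda>x. Max (insert (c / 2) ((\<lambda>(u, v). x \<bullet> outer_prod u v) ` Q)))"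
    and "(\<integral>x. Max (insert (c / 2) ((\<lambda>(u, v). x \<bullet> outer_prod u v) ` Q)) \<partial>\<Gamma>) \<le> c"
proof -
  interpret prob_space \<Gamma> by fact
  \<comment> \<open>The index \<open>None\<close>, with zero vector and offset \<open>c / 2\<close>,
    builds the floor into the process as one more point.\<close>
  define P where "P = insert None (Some ` Q)"
  define h where "h i = (case i of None \<Rightarrow> c / 2 | Some _ \<Rightarrow> 0)" for i :: "((real^'k) \<times> (real^'p)) option"
  define A where "A i = (case i of None \<Rightarrow> 0 | Some (u, v) \<Rightarrow> outer_prod u v)" for i :: "((real^'k) \<times> (real^'p)) option"
  define B where "B i = (case i of None \<Rightarrow> 0 | Some w \<Rightarrow> w)" for i :: "((real^'k) \<times> (real^'p)) option"
  define \<Gamma>2 where "\<Gamma>2 = gaussian_law (\<lambda>b. b) (Basis :: ((real^'k) \<times> (real^'p)) set)"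
  have bij: "bij_betw (\<lambda>b. b) (Basis :: ((real^'k) \<times> (real^'p)) set) Basis" by (simp add: bij_betw_def)
  have P: "finite P" "P \<noteq> {}" using Q by (auto simp: P_def)
  have k: "0 < sqrt (real CARD('k))" and p: "0 < sqrt (real CARD('p))" by auto
  then have c: "0 < c" unfolding c_def by (rule add_pos_pos)
  have eq: "(\<lambda>i. h i + x \<bullet> A i) ` P = insert (c / 2) ((\<lambda>(u, v). x \<bullet> outer_prod u v) ` Q)" for x
    by (auto simp: P_def h_def A_def image_image case_prod_unfold)
  have "integrable \<Gamma> (\<lambda>x. Max ((\<lambda>i. h i + x \<bullet> A i) ` P))"
    by (intro integrable_Max_image P Bochner_Integration.integrable_add integrable_inner int sets) auto
  then show "integrable \<Gamma> (\<lambda>x. Max (insert (c / 2) ((\<lambda>(u, v). x \<bullet> outer_prod u v) ` Q)))"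
    unfolding eq .
  have incr: "norm (A i - A j) \<le> norm (B i - B j)" if ij: "i \<in> P" "j \<in> P" for i j
  proof -
    have le1: "x \<bullet> y \<le> 1" if "norm x = 1" "norm y = 1" for x y :: "'z::real_inner"
      using norm_cauchy_schwarz[of x y] that by simp
    have "(norm (A i - A j))\<^sup>2 \<le> (norm (B i - B j))\<^sup>2"
    proof (cases i)
      case None
      show ?thesis
      proof (cases j)
        case (Some w)
        obtain u v where w: "w = (u, v)" by (cases w)
        have "norm u = 1" "norm v = 1" using Q(2) ij(2) by (auto simp: P_def Some w)
        then show ?thesis using None Some w
          by (simp add: A_def B_def power2_norm_eq_inner outer_prod_inner_outer_prod inner_prod_def norm_eq_1)
      qed (use None in \<open>simp add: A_def\<close>)
    next
      case (Some w)
      obtain u v where w: "w = (u, v)" by (cases w)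
      have uv: "norm u = 1" "norm v = 1" using Q(2) ij(1) by (auto simp: P_def Some w)
      show ?thesis
      proof (cases j)
        case None
        then show ?thesis using Some w uv
          by (simp add: A_def B_def power2_norm_eq_inner outer_prod_inner_outer_prod inner_prod_def norm_eq_1)
      next
        case (Some w')
        obtain u' v' where w': "w' = (u', v')" by (cases w')
        have uv': "norm u' = 1" "norm v' = 1" using Q(2) ij(2) by (auto simp: P_def Some w')
        \<comment> \<open>Twice this product is the difference of the squared increments, which are
          4 - 2 u.u' - 2 v.v' and 2 - 2 (u.u') (v.v') for unit vectors.\<close>
        have "0 \<le> (1 - u \<bullet> u') * (1 - v \<bullet> v')"
          using le1[OF uv(1) uv'(1)] le1[OF uv(2) uv'(2)] by simp
        then show ?thesis using \<open>i = Some w\<close> Some w w' uv uv'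
          by (simp add: A_def B_def power2_norm_eq_inner outer_prod_inner_outer_prod inner_prod_def norm_eq_1
              inner_diff_left inner_diff_right inner_commute algebra_simps)
      qed
    qed
    then show ?thesis by (rule power2_le_imp_le) simp
  qed
  have prob2: "prob_space \<Gamma>2" and int2: "integrable \<Gamma>2 norm" and st2: "stein \<Gamma>2 1" and sets2: "sets \<Gamma>2 = sets borel"
    unfolding \<Gamma>2_def
    by (rule prob_space_gaussian_law[OF bij] integrable_norm_gaussian_law[OF bij] stein_gaussian_law[OF bij]
        sets_gaussian_law)+
  interpret G2: prob_space \<Gamma>2 by fact
  note mom = second_moments_pair_gaussian[where 'k = 'k and 'p = 'p, folded \<Gamma>2_def]
  define r where "r = sqrt (real CARD('p)) / sqrt (real CARD('k))"
  have r: "0 < r" using k p by (simp add: r_def)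
  have pt: "Max ((\<lambda>i. h i + y \<bullet> B i) ` P) \<le> c / 2 + ((1 + r) * (norm (fst y))\<^sup>2 + (1 + 1 / r) * (norm (snd y))\<^sup>2) / (2 * c)" for y
  proof -
    let ?g = "norm (fst y)" and ?h = "norm (snd y)"
    have quad: "(?g + ?h)\<^sup>2 \<le> (1 + r) * ?g\<^sup>2 + (1 + 1 / r) * ?h\<^sup>2"
    proof -
      have "0 \<le> (r * ?g - ?h)\<^sup>2 / r" using r by simp
      also have "\<dots> = r * ?g\<^sup>2 + ?h\<^sup>2 / r - 2 * ?g * ?h" using r by (simp add: power2_eq_square field_simps)
      finally show ?thesis by (simp add: power2_eq_square algebra_simps)
    qed
    \<comment> \<open>A tangent line bound for the square root at c^2. Its constant term
      \<open>c / 2\<close> already covers the floor, and in expectation it gives c/2 + c^2 / (2 c) =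
      c.\<close>
    have amgm: "?g + ?h \<le> c / 2 + (?g + ?h)\<^sup>2 / (2 * c)"
    proof -
      have "0 \<le> (?g + ?h - c)\<^sup>2 / (2 * c)" using c by simp
      also have "\<dots> = (?g + ?h)\<^sup>2 / (2 * c) + c / 2 - (?g + ?h)" using c by (simp add: power2_eq_square field_simps)
      finally show ?thesis by simp
    qed
    have "h i + y \<bullet> B i \<le> c / 2 + (?g + ?h)\<^sup>2 / (2 * c)" if i: "i \<in> P" for i
    proof (cases i)
      case None then show ?thesis using c by (simp add: h_def B_def)
    next
      case (Some w)
      obtain u v where w: "w = (u, v)" by (cases w)
      have "norm u = 1" "norm v = 1" using Q(2) i by (auto simp: P_def Some w)
      then have "y \<bullet> w \<le> ?g + ?h"
        using norm_cauchy_schwarz[of "fst y" u] norm_cauchy_schwarz[of "snd y" v] by (simp add: inner_prod_def w)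
      then show ?thesis using amgm Some by (simp add: h_def B_def)
    qed
    then have "Max ((\<lambda>i. h i + y \<bullet> B i) ` P) \<le> c / 2 + (?g + ?h)\<^sup>2 / (2 * c)"
      using P by simp
    also have "\<dots> \<le> c / 2 + ((1 + r) * ?g\<^sup>2 + (1 + 1 / r) * ?h\<^sup>2) / (2 * c)"
      using quad c by (intro add_left_mono divide_right_mono) auto
    finally show ?thesis .
  qed
  have "(\<integral>x. Max ((\<lambda>i. h i + x \<bullet> A i) ` P) \<partial>\<Gamma>) \<le> (\<integral>y. Max ((\<lambda>i. h i + y \<bullet> B i) ` P) \<partial>\<Gamma>2)"
    by (rule sudakov_fernique[OF prob prob2 sets sets2 int int2 st st2 P incr])
  also have "\<dots> \<le> (\<integral>y. c / 2 + ((1 + r) * (norm (fst y))\<^sup>2 + (1 + 1 / r) * (norm (snd y))\<^sup>2) / (2 * c) \<partial>\<Gamma>2)"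
    using mom by (intro integral_mono pt integrable_Max_image P Bochner_Integration.integrable_add integrable_inner int2 sets2
        integrable_divide_zero disjI2 integrable_mult_right) auto
  also have "\<dots> = c / 2 + ((1 + r) * real CARD('k) + (1 + 1 / r) * real CARD('p)) / (2 * c)"
    using mom by (simp add: G2.prob_space)
  also have "(1 + r) * real CARD('k) + (1 + 1 / r) * real CARD('p) = c\<^sup>2"
  proof -
    have "r * real CARD('k) = sqrt (real CARD('k)) * sqrt (real CARD('p))"
      using k by (simp add: r_def field_simps)
    moreover have "(1 / r) * real CARD('p) = sqrt (real CARD('k)) * sqrt (real CARD('p))"
      using k p by (simp add: r_def field_simps)
    ultimately show ?thesis by (simp add: c_def power2_sum algebra_simps)
  qed
  also have "c / 2 + c\<^sup>2 / (2 * c) = c" using c by (simp add: power2_eq_square)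
  finally show "(\<integral>x. Max (insert (c / 2) ((\<lambda>(u, v). x \<bullet> outer_prod u v) ` Q)) \<partial>\<Gamma>) \<le> c"
    unfolding eq .
qed

section \<open>The random operator\<close>

text \<open>Writing t through its rank-one pieces gives
  \<open>x \<bullet> t \<le> nuclear_norm t * m x\<close>, where \<open>m\<close> is the floored
  bilinear maximum. As \<open>2 * m x - c\<close> is nonnegative, the nuclear norm may be raised to
  its largest allowed value \<open>R / c\<close>, and the expectation of \<open>m\<close> is at most
  \<open>c\<close>.\<close>

lemma expected_max_nuclear_le:
  fixes \<Gamma> :: "(real^'p^'k) measure" and T :: "(real^'p^'k) set" and R :: real
  defines "c \<equiv> sqrt (real CARD('k)) + sqrt (real CARD('p))"
  assumes prob: "prob_space \<Gamma>" and sets: "sets \<Gamma> = sets borel" and int: "integrable \<Gamma> norm"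
    and st: "stein \<Gamma> 1" and T: "finite T" "T \<noteq> {}" and small: "\<And>t. t \<in> T \<Longrightarrow> c * nuclear_norm t \<le> R"
  shows "(\<integral>x. Max ((\<lambda>t. 2 * (x \<bullet> t) - c * nuclear_norm t) ` T) \<partial>\<Gamma>) \<le> R"
proof -
  interpret prob_space \<Gamma> by fact
  have c: "0 < c" unfolding c_def by (intro add_pos_pos) auto
  define dec where "dec t P s \<longleftrightarrow> finite P \<and> (\<forall>w\<in>P. norm (fst w) = 1 \<and> norm (snd w) = 1 \<and> 0 \<le> s w) \<and>
    nuclear_norm t = sum s P \<and> (\<forall>G. G \<bullet> t = (\<Sum>w\<in>P. s w * (G \<bullet> outer_prod (fst w) (snd w))))"
    for t :: "real^'p^'k" and P s
  have "\<exists>P s. dec t P s" for t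
  proof -
    obtain P s where "finite P" "\<And>u v. (u, v) \<in> P \<Longrightarrow> norm u = 1 \<and> norm v = 1 \<and> s (u, v) \<ge> 0"
      "nuclear_norm t = sum s P" "\<And>G. G \<bullet> t = (\<Sum>(u, v)\<in>P. s (u, v) * (G \<bullet> outer_prod u v))"
      by (rule nuclear_norm_decomposition[of t]) blast
    then have "dec t P s" by (auto simp: dec_def case_prod_unfold)
    then show ?thesis by blast
  qed
  then obtain P s where "\<And>t. dec t (P t) (s t)" by metis
  note dec = this[unfolded dec_def]
  have P: "\<And>t. finite (P t)"
    "\<And>t w. w \<in> P t \<Longrightarrow> norm (fst w) = 1 \<and> norm (snd w) = 1 \<and> 0 \<le> s t w"
    "\<And>t. nuclear_norm t = sum (s t) (P t)"
    "\<And>t G. G \<bullet> t = (\<Sum>w\<in>P t. s t w * (G \<bullet> outer_prod (fst w) (snd w)))"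
    using dec by blast+
  \<comment> \<open>Finitely many singular pairs already control every matrix in
    \<open>T\<close>.\<close>
  define Q where "Q = (\<Union>t\<in>T. P t)"
  have Q: "finite Q" "\<And>u v. (u, v) \<in> Q \<Longrightarrow> norm u = 1 \<and> norm v = 1"
    using T P(1) P(2)[of "(_, _)"] by (auto simp: Q_def)
  define m where "m x = Max (insert (c / 2) ((\<lambda>(u, v). x \<bullet> outer_prod u v) ` Q))" for x
  have m_int: "integrable \<Gamma> m" and m_le: "(\<integral>x. m x \<partial>\<Gamma>) \<le> c"
    using expected_max_bilinear_le[OF prob sets int st Q] by (simp_all add: m_def[abs_def] c_def)
  have m_ge: "c / 2 \<le> m x" "w \<in> Q \<Longrightarrow> x \<bullet> outer_prod (fst w) (snd w) \<le> m x" for x w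
    unfolding m_def using Q(1) by (intro Max_ge, auto simp: case_prod_unfold)+
  have R: "0 \<le> R"
    using T(2) small nuclear_norm_nonneg c by (metis all_not_in_conv less_imp_le mult_nonneg_nonneg order_trans)
  have pt: "Max ((\<lambda>t. 2 * (x \<bullet> t) - c * nuclear_norm t) ` T) \<le> R / c * (2 * m x - c)" for x
  proof -
    have "2 * (x \<bullet> t) - c * nuclear_norm t \<le> R / c * (2 * m x - c)" if t: "t \<in> T" for t
    proof -
      have "x \<bullet> t \<le> (\<Sum>w\<in>P t. s t w * m x)"
        unfolding P(4)[of x t]
      proof (intro sum_mono)
        fix w assume w: "w \<in> P t"
        then have "0 \<le> s t w" "w \<in> Q" using P(2) t by (auto simp: Q_def)
        then show "s t w * (x \<bullet> outer_prod (fst w) (snd w)) \<le> s t w * m x"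
          using m_ge(2) by (simp add: mult_left_mono)
      qed
      also have "\<dots> = nuclear_norm t * m x" by (simp add: P(3) sum_distrib_right)
      finally have "2 * (x \<bullet> t) - c * nuclear_norm t \<le> nuclear_norm t * (2 * m x - c)"
        by (simp add: algebra_simps)
      also have "\<dots> \<le> R / c * (2 * m x - c)"
        using small[OF t] m_ge(1)[of x] c by (intro mult_right_mono) (auto simp: le_divide_eq mult.commute)
      finally show ?thesis .
    qed
    then show ?thesis using T by simp
  qed
  have "(\<integral>x. Max ((\<lambda>t. 2 * (x \<bullet> t) - c * nuclear_norm t) ` T) \<partial>\<Gamma>) \<le> (\<integral>x. R / c * (2 * m x - c) \<partial>\<Gamma>)"
    by (intro integral_mono pt integrable_Max_image T Bochner_Integration.integrable_diff integrable_mult_right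
        integrable_inner int sets m_int) auto
  also have "\<dots> = R / c * (2 * (\<integral>x. m x \<partial>\<Gamma>) - c)"
    using m_int by (simp add: prob_space)
  also have "\<dots> \<le> R / c * c"
    using m_le R c by (intro mult_left_mono) auto
  finally show ?thesis using c by simp
qed

text \<open>Dividing the sum by sqrt N restores unit variance in Stein's identity. Pulling sqrt N
  out of the maximum turns the penalty coefficient into \<open>c\<close> and the bound sqrt N / 4
  into N / 4.\<close>

lemma expected_max_sum_law_le:
  fixes \<nu> :: "(real^'p^'k) measure" and T :: "(real^'p^'k) set" and N :: nat
  defines "c \<equiv> sqrt (real CARD('k)) + sqrt (real CARD('p))"
  assumes prob: "prob_space \<nu>" and sets: "sets \<nu> = sets borel" and int: "integrable \<nu> norm"
    and st: "stein \<nu> 1" and T: "finite T" "T \<noteq> {}" and N: "N > 0"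
    and small: "\<And>t. t \<in> T \<Longrightarrow> c * nuclear_norm t \<le> sqrt (real N) / 4"
  shows "(\<integral>y. Max ((\<lambda>t. - (c * sqrt (real N) * nuclear_norm t) + 2 * (y \<bullet> t)) ` T) \<partial>(sum_law \<nu> N)) \<le> real N / 4"
proof -
  let ?S = "sum_law \<nu> N" and ?r = "1 / sqrt (real N)"
  interpret S: prob_space ?S by (rule prob_space_sum_law[OF prob sets])
  define \<Gamma> where "\<Gamma> = distr ?S borel (\<lambda>x. ?r *\<^sub>R x)"
  have \<Gamma>: "prob_space \<Gamma>" "sets \<Gamma> = sets borel"
    unfolding \<Gamma>_def by (auto intro!: S.prob_space_distr)
  have int\<Gamma>: "integrable \<Gamma> norm"
    unfolding \<Gamma>_def using integrable_norm_sum_law[OF prob sets int, of N]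
    by (subst integrable_distr_eq) auto
  have "stein \<Gamma> (?r\<^sup>2 * (real N * 1))"
    unfolding \<Gamma>_def by (intro stein_scale stein_sum_law prob sets int st sets_sum_law)
  moreover have "?r\<^sup>2 * (real N * 1) = 1" using N by (simp add: power_divide)
  ultimately have st\<Gamma>: "stein \<Gamma> 1" by simp
  have scale: "Max ((\<lambda>t. - (c * sqrt (real N) * nuclear_norm t) + 2 * (y \<bullet> t)) ` T)
      = sqrt (real N) * Max ((\<lambda>t. 2 * ((?r *\<^sub>R y) \<bullet> t) - c * nuclear_norm t) ` T)" for y
  proof -
    have "sqrt (real N) * Max ((\<lambda>t. 2 * ((?r *\<^sub>R y) \<bullet> t) - c * nuclear_norm t) ` T)
        = Max ((*) (sqrt (real N)) ` (\<lambda>t. 2 * ((?r *\<^sub>R y) \<bullet> t) - c * nuclear_norm t) ` T)"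
      using T by (intro mono_Max_commute) (auto simp: mono_def mult_left_mono)
    also have "(*) (sqrt (real N)) ` (\<lambda>t. 2 * ((?r *\<^sub>R y) \<bullet> t) - c * nuclear_norm t) ` T
        = (\<lambda>t. - (c * sqrt (real N) * nuclear_norm t) + 2 * (y \<bullet> t)) ` T"
      unfolding image_image using N by (intro image_cong) (auto simp: field_simps)
    finally show ?thesis ..
  qed
  have "(\<integral>y. Max ((\<lambda>t. - (c * sqrt (real N) * nuclear_norm t) + 2 * (y \<bullet> t)) ` T) \<partial>?S)
      = sqrt (real N) * (\<integral>x. Max ((\<lambda>t. 2 * (x \<bullet> t) - c * nuclear_norm t) ` T) \<partial>\<Gamma>)"
    unfolding scale \<Gamma>_def by (subst integral_distr) (auto intro!: Max_image_measurable T)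
  also have "\<dots> \<le> sqrt (real N) * (sqrt (real N) / 4)"
    using expected_max_nuclear_le[OF \<Gamma> int\<Gamma> st\<Gamma> T, of "sqrt (real N) / 4"] small
    by (intro mult_left_mono) (auto simp: c_def)
  finally show ?thesis by simp
qed

text \<open>A quartic minorant replaces the truncated Gaussian integral, leaving only the first
  absolute moment sqrt (2 / pi) and the fourth moment 3.\<close>

lemma clipped_abs_mean_ge: "11 / 16 \<le> (\<integral>y. min \<bar>y\<bar> (3 / 2) \<partial>std_normal)"
proof -
  interpret prob_space std_normal by (rule prob_space_std_normal)
  have pt: "\<bar>y\<bar> - y ^ 4 / 32 \<le> min \<bar>y\<bar> (3 / 2)" for y :: real
  proof -
    \<comment> \<open>The factor 1/32 makes the minorant touch the clip level 3/2 exactly at 2,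
      hence the double root.\<close>
    have "0 \<le> (z - 2)\<^sup>2 * ((z + 2)\<^sup>2 + 8) / 32" for z :: real
      by (intro divide_nonneg_nonneg mult_nonneg_nonneg) auto
    also have "(z - 2)\<^sup>2 * ((z + 2)\<^sup>2 + 8) / 32 = z ^ 4 / 32 - z + 3 / 2" for z :: real
      by (simp add: power2_eq_square power4_eq_xxxx field_simps)
    finally have "0 \<le> \<bar>y\<bar> ^ 4 / 32 - \<bar>y\<bar> + 3 / 2" .
    then have "\<bar>y\<bar> - y ^ 4 / 32 \<le> 3 / 2" by (simp add: power_even_abs)
    moreover have "0 \<le> y ^ 4" by simp
    ultimately show ?thesis by simp
  qed
  \<comment> \<open>A rational bound chosen so that 25/32 - 3/32 = 11/16.\<close>
  have "25 / 32 \<le> sqrt (2 / pi)"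
  proof (rule real_le_rsqrt)
    show "(25 / 32)\<^sup>2 \<le> 2 / pi"
      using pi_approx(2) pi_gt_zero by (simp add: le_divide_eq power2_eq_square)
  qed
  then have "11 / 16 \<le> sqrt (2 / pi) - 3 / 32" by simp
  also have "\<dots> = (\<integral>y. \<bar>y\<bar> - y ^ 4 / 32 \<partial>std_normal)"
    using std_normal_moments by simp
  also have "\<dots> \<le> (\<integral>y. min \<bar>y\<bar> (3 / 2) \<partial>std_normal)"
    using std_normal_moments by (intro integral_mono pt) (auto intro: integrable_min)
  finally show ?thesis .
qed

section \<open>From random matrices with independent entries to the probability bound\<close>

definition matrix_unit :: "'k \<times> 'p \<Rightarrow> real^'p^'k" where
  "matrix_unit ab = axis (fst ab) (axis (snd ab) 1)"

lemma bij_betw_matrix_unit: "bij_betw matrix_unit (UNIV :: ('k::finite \<times> 'p::finite) set) (Basis :: (real^'p^'k) set)"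
proof -
  have "inj (matrix_unit :: 'k \<times> 'p \<Rightarrow> real^'p^'k)"
    by (auto simp: inj_on_def matrix_unit_def axis_eq_axis)
  moreover have "range (matrix_unit :: 'k \<times> 'p \<Rightarrow> real^'p^'k) = Basis"
  proof
    show "Basis \<subseteq> range (matrix_unit :: 'k \<times> 'p \<Rightarrow> real^'p^'k)"
    proof
      fix b :: "real^'p^'k" assume "b \<in> Basis"
      then obtain i j where "b = axis i (axis j 1)" by (auto simp: Basis_vec_def)
      then show "b \<in> range matrix_unit" by (intro range_eqI[of _ _ "(i, j)"]) (simp add: matrix_unit_def)
    qed
  qed (auto simp: matrix_unit_def Basis_vec_def)
  ultimately show ?thesis by (simp add: bij_betw_def)
qed

lemma matrix_unit_expansion: "A = (\<Sum>ab\<in>UNIV. (A $ fst ab $ snd ab) *\<^sub>R matrix_unit ab)"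
  for A :: "real^'p::finite^'k::finite"
proof -
  have "A = (\<Sum>ab\<in>UNIV. (A \<bullet> matrix_unit ab) *\<^sub>R matrix_unit ab)"
    by (rule coords_expansion[OF bij_betw_matrix_unit])
  then show ?thesis by (simp add: matrix_unit_def inner_axis)
qed

text \<open>Independence makes the joint law of the entries a product of standard normals, and the
  matrix is recovered from its entries by the expansion in matrix units.\<close>

lemma distr_iid_std_normal_entries:
  fixes Y :: "'a \<Rightarrow> real^'p::finite^'k::finite"
  assumes "prob_space M" and Y: "iid_std_normal_entries M Y"
  shows "distr M borel Y = gaussian_law matrix_unit UNIV"
proof -
  interpret prob_space M by fact
  let ?E = "\<lambda>ab \<omega>. Y \<omega> $ fst ab $ snd ab"
  have ind: "indep_vars (\<lambda>_. borel) ?E (UNIV :: ('k \<times> 'p) set)"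
    using Y by (simp add: iid_std_normal_entries_def case_prod_unfold)
  have dist: "distributed M lborel (?E ab) std_normal_density" for ab
    using Y by (simp add: iid_std_normal_entries_def)
  have rv[measurable]: "random_variable borel (?E ab)" for ab
    using ind by (simp add: indep_vars_def)
  have marg: "distr M borel (?E ab) = std_normal" for ab
  proof -
    have "distr M borel (?E ab) = distr M lborel (?E ab)" by (rule distr_cong) auto
    then show ?thesis using dist[of ab] by (simp add: distributed_def)
  qed
  let ?F = "\<lambda>\<omega>. \<lambda>ab\<in>UNIV. ?E ab \<omega>"
  have joint: "distr M (\<Pi>\<^sub>M ab\<in>UNIV. borel) ?F = (\<Pi>\<^sub>M ab\<in>UNIV. std_normal)"
    using indep_vars_iff_distr_eq_PiM[where I = UNIV and M' = "\<lambda>_. borel" and X = ?E] ind rv marg by simp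
  have "gaussian_law matrix_unit UNIV = distr (distr M (\<Pi>\<^sub>M ab\<in>UNIV. borel) ?F) borel (\<lambda>\<omega>. \<Sum>ab\<in>UNIV. \<omega> ab *\<^sub>R (matrix_unit ab :: real^'p^'k))"
    by (simp add: gaussian_law_def joint)
  also have "\<dots> = distr M borel (\<lambda>\<omega>. \<Sum>ab\<in>UNIV. ?E ab \<omega> *\<^sub>R (matrix_unit ab :: real^'p^'k))"
    by (subst distr_distr) (auto simp: comp_def)
  also have "\<dots> = distr M borel Y"
    by (intro distr_cong refl) (rule matrix_unit_expansion[symmetric])
  finally show ?thesis ..
qed

lemma norm_trace_operator: "norm (trace_operator X \<Theta>) = sqrt (\<Sum>i\<in>UNIV. (X i \<bullet> \<Theta>)\<^sup>2)"
  for X :: "'n::finite \<Rightarrow> real^'p::finite^'k::finite"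
proof -
  have "trace_operator X \<Theta> $ i = X i \<bullet> \<Theta>" for i
    unfolding trace_operator_def
    by (simp add: trace_def matrix_matrix_mult_def transpose_def inner_vec_def) (rule sum.swap)
  then show ?thesis by (simp add: norm_vec_def L2_set_def)
qed

lemma sum_abs_le_norm_trace_operator:
  fixes X :: "'n::finite \<Rightarrow> real^'p::finite^'k::finite"
  shows "(\<Sum>i\<in>UNIV. \<bar>X i \<bullet> \<Theta>\<bar>) \<le> sqrt (real CARD('n)) * norm (trace_operator X \<Theta>)"
proof -
  have "(\<Sum>i\<in>UNIV. 1 * \<bar>X i \<bullet> \<Theta>\<bar>)\<^sup>2 \<le> (\<Sum>i\<in>(UNIV::'n set). 1\<^sup>2) * (\<Sum>i\<in>UNIV. \<bar>X i \<bullet> \<Theta>\<bar>\<^sup>2)"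
    by (rule Cauchy_Schwarz_ineq_sum)
  then show ?thesis
    by (simp add: norm_trace_operator real_sqrt_mult[symmetric] real_le_rsqrt)
qed

text \<open>Markov's inequality for the exponential of the penalised supremum \<open>S\<close>. The
  bound does not involve the size of \<open>T\<close>, which permits exhausting an infinite set
  later.\<close>

lemma finite_failure_probability:
  fixes M :: "'a measure" and X :: "'n::finite \<Rightarrow> 'a \<Rightarrow> real^'p::finite^'k::finite"
    and T :: "(real^'p^'k) set"
  defines "c \<equiv> sqrt (real CARD('k)) + sqrt (real CARD('p))" and "N \<equiv> real CARD('n)"
  assumes "prob_space M" and ind: "prob_space.indep_vars M (\<lambda>_. borel) X UNIV"
    and iid: "\<And>i. iid_std_normal_entries M (X i)"
    and T: "finite T" "\<And>t. t \<in> T \<Longrightarrow> norm t = 1" "\<And>t. t \<in> T \<Longrightarrow> c * nuclear_norm t \<le> sqrt N / 4"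
  shows "measure M {\<omega>\<in>space M. \<exists>t\<in>T. (\<Sum>i\<in>UNIV. min \<bar>X i \<omega> \<bullet> t\<bar> (3 / 2)) < N / 4 - c * sqrt N * nuclear_norm t}
    \<le> exp (- N / 32)"
proof (cases "T = {}")
  case True then show ?thesis by simp
next
  case False
  interpret prob_space M by fact
  define \<nu> :: "(real^'p^'k) measure" where "\<nu> = gaussian_law matrix_unit UNIV"
  note bij = bij_betw_matrix_unit[where 'k = 'k and 'p = 'p]
  have \<nu>: "prob_space \<nu>" "sets \<nu> = sets borel" "integrable \<nu> norm" "distr \<nu> borel uminus = \<nu>" "stein \<nu> 1"
    unfolding \<nu>_def
    by (rule prob_space_gaussian_law[OF bij] integrable_norm_gaussian_law[OF bij] stein_gaussian_law[OF bij]
        sets_gaussian_law distr_uminus_gaussian_law[OF bij])+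
  have rv[measurable]: "random_variable borel (X i)" for i using ind by (simp add: indep_vars_def)
  have law: "distr M borel (X i) = \<nu>" for i
    unfolding \<nu>_def by (rule distr_iid_std_normal_entries[OF prob_space_axioms iid])
  have XM: "(\<lambda>\<omega>. \<lambda>i\<in>UNIV. X i \<omega>) \<in> measurable M (\<Pi>\<^sub>M i\<in>UNIV. borel)"
    by (intro measurable_restrict rv)
  have joint: "distr M (\<Pi>\<^sub>M i\<in>UNIV. borel) (\<lambda>\<omega>. \<lambda>i\<in>UNIV. X i \<omega>) = (\<Pi>\<^sub>M i\<in>UNIV. \<nu>)"
    using indep_vars_iff_distr_eq_PiM[where I = UNIV and M' = "\<lambda>_. borel" and X = X] ind rv law by simp
  define \<phi> :: "real \<Rightarrow> real" where "\<phi> y = min \<bar>y\<bar> (3 / 2)" for y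
  have [measurable]: "\<phi> \<in> borel_measurable borel" unfolding \<phi>_def by measurable
  have mean: "11 / 16 \<le> (\<integral>x. \<phi> (x \<bullet> t) \<partial>\<nu>)" if "t \<in> T" for t
  proof -
    have "(\<integral>x. \<phi> (x \<bullet> t) \<partial>\<nu>) = (\<integral>y. \<phi> y \<partial>distr \<nu> borel (\<lambda>x. x \<bullet> t))"
      by (subst integral_distr) (auto simp: measurable_cong_sets[OF \<nu>(2) refl])
    also have "distr \<nu> borel (\<lambda>x. x \<bullet> t) = std_normal"
      unfolding \<nu>_def by (rule gaussian_law_marginal[OF bij T(2)[OF that]])
    finally show ?thesis using clipped_abs_mean_ge by (simp add: \<phi>_def)
  qed
  have N: "N > 0" by (simp add: N_def)
  define h where "h t = - (c * sqrt N * nuclear_norm t)" for t :: "real^'p^'k"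
  define S where "S x = Max ((\<lambda>t. h t + (\<Sum>i\<in>UNIV. 11 / 16 - \<phi> (x i \<bullet> t))) ` T)" for x :: "'n \<Rightarrow> real^'p^'k"
  have S_meas[measurable]: "S \<in> borel_measurable (\<Pi>\<^sub>M i\<in>UNIV. borel)"
    unfolding S_def by (intro Max_image_measurable T False) measurable
  \<comment> \<open>The minimiser of - (7/16 - 1/4) l + (3/2)^2 l^2 / 8, whose minimum is
    -1/32.\<close>
  let ?l = "1 / 3 :: real"
  have "(\<integral>\<^sup>+\<omega>. ennreal (exp (?l * S (\<lambda>i. X i \<omega>))) \<partial>M)
      = (\<integral>\<^sup>+x. ennreal (exp (?l * S x)) \<partial>(\<Pi>\<^sub>M i\<in>UNIV. \<nu>))"
    unfolding joint[symmetric] by (subst nn_integral_distr[OF XM]) (simp_all add: restrict_UNIV)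
  also have "\<dots> \<le> ennreal (exp (?l * (\<integral>y. Max ((\<lambda>t. h t + 2 * (y \<bullet> t)) ` T) \<partial>(sum_law \<nu> CARD('n)))
      + real CARD('n) * ?l\<^sup>2 * (3 / 2)\<^sup>2 / 8))"
    unfolding S_def
    by (rule supremum_mgf_bound[OF \<nu>(1-4) T(1) False]) (use mean in \<open>auto simp: \<phi>_def\<close>)
  also have "\<dots> \<le> ennreal (exp (?l * (N / 4) + N / 32))"
  proof -
    have "(\<integral>y. Max ((\<lambda>t. h t + 2 * (y \<bullet> t)) ` T) \<partial>(sum_law \<nu> CARD('n))) \<le> N / 4"
      unfolding h_def N_def c_def
      by (rule expected_max_sum_law_le[OF \<nu>(1,2,3,5) T(1) False]) (use T(3) in \<open>auto simp: N_def c_def\<close>)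
    then show ?thesis by (simp add: N_def power2_eq_square)
  qed
  finally have mgf: "(\<integral>\<^sup>+\<omega>. ennreal (exp (?l * S (\<lambda>i. X i \<omega>))) \<partial>M) \<le> ennreal (exp (?l * (N / 4) + N / 32))" .
  define B where "B = {\<omega>\<in>space M. \<exists>t\<in>T. (\<Sum>i\<in>UNIV. \<phi> (X i \<omega> \<bullet> t)) < N / 4 - c * sqrt N * nuclear_norm t}"
  have SX[measurable]: "(\<lambda>\<omega>. S (\<lambda>i. X i \<omega>)) \<in> borel_measurable M"
    using measurable_compose[OF XM S_meas] by (simp add: restrict_UNIV)
  have B: "1 \<le> ennreal (exp (- (?l * (7 / 16 * N)))) * ennreal (exp (?l * S (\<lambda>i. X i \<omega>)))" if \<omega>: "\<omega> \<in> B" for \<omega>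
  proof -
    obtain t where t: "t \<in> T" "(\<Sum>i\<in>UNIV. \<phi> (X i \<omega> \<bullet> t)) < N / 4 - c * sqrt N * nuclear_norm t"
      using \<omega> by (auto simp: B_def)
    have "(\<Sum>i\<in>UNIV. 11 / 16 - \<phi> (X i \<omega> \<bullet> t)) = 11 / 16 * N - (\<Sum>i\<in>UNIV. \<phi> (X i \<omega> \<bullet> t))"
      by (simp add: sum_subtractf N_def)
    \<comment> \<open>A failure leaves a clipped sum below N/4 minus the penalty, and 11/16 - 1/4 =
      7/16.\<close>
    then have "7 / 16 * N \<le> h t + (\<Sum>i\<in>UNIV. 11 / 16 - \<phi> (X i \<omega> \<bullet> t))"
      using t(2) unfolding h_def by linarith
    also have "\<dots> \<le> S (\<lambda>i. X i \<omega>)" unfolding S_def by (rule Max_image_ge[OF T(1) t(1)])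
    finally show ?thesis by (simp add: ennreal_mult[symmetric] exp_add[symmetric])
  qed
  have "emeasure M B \<le> emeasure M {\<omega>\<in>space M. 1 \<le> ennreal (exp (- (?l * (7 / 16 * N)))) * ennreal (exp (?l * S (\<lambda>i. X i \<omega>)))}"
  proof (rule emeasure_mono)
    show "B \<subseteq> {\<omega>\<in>space M. 1 \<le> ennreal (exp (- (?l * (7 / 16 * N)))) * ennreal (exp (?l * S (\<lambda>i. X i \<omega>)))}"
    proof
      fix \<omega> assume \<omega>: "\<omega> \<in> B"
      then have "\<omega> \<in> space M" by (simp add: B_def)
      with B[OF \<omega>] show "\<omega> \<in> {\<omega>\<in>space M. 1 \<le> ennreal (exp (- (?l * (7 / 16 * N)))) * ennreal (exp (?l * S (\<lambda>i. X i \<omega>)))}"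
        by blast
    qed
  qed measurable
  also have "\<dots> \<le> ennreal (exp (- (?l * (7 / 16 * N)))) * (\<integral>\<^sup>+\<omega>. ennreal (exp (?l * S (\<lambda>i. X i \<omega>))) * indicator (space M) \<omega> \<partial>M)"
    by (rule nn_integral_Markov_inequality) measurable
  also have "\<dots> \<le> ennreal (exp (- (?l * (7 / 16 * N)))) * ennreal (exp (?l * (N / 4) + N / 32))"
  proof (rule mult_left_mono)
    have "(\<integral>\<^sup>+\<omega>. ennreal (exp (?l * S (\<lambda>i. X i \<omega>))) * indicator (space M) \<omega> \<partial>M)
        = (\<integral>\<^sup>+\<omega>. ennreal (exp (?l * S (\<lambda>i. X i \<omega>))) \<partial>M)"
      by (intro nn_integral_cong) simp
    then show "(\<integral>\<^sup>+\<omega>. ennreal (exp (?l * S (\<lambda>i. X i \<omega>))) * indicator (space M) \<omega> \<partial>M)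
        \<le> ennreal (exp (?l * (N / 4) + N / 32))"
      using mgf by (simp only:)
  qed simp
  also have "\<dots> = ennreal (exp (- N / 32))"
    by (simp add: ennreal_mult[symmetric] exp_add[symmetric])
  finally have "measure M B \<le> exp (- N / 32)"
    by (simp add: emeasure_eq_measure)
  then show ?thesis by (simp add: B_def \<phi>_def)
qed

theorem proposition1:
  fixes M :: "'a measure"
    and X :: "'n::finite \<Rightarrow> 'a \<Rightarrow> real^'p::finite^'k::finite"
  assumes "prob_space M"
    and "prob_space.indep_vars M (\<lambda>_. borel) X UNIV"
    and "\<And>i. iid_std_normal_entries M (X i)"
  shows "measure M {\<omega> \<in> space M. \<forall>\<Theta>.
           norm (trace_operator (\<lambda>i. X i \<omega>) \<Theta>) / sqrt (real CARD('n))
             \<ge> 1 / 4 * frobenius_norm \<Theta>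
                - (sqrt (real CARD('k) / real CARD('n)) + sqrt (real CARD('p) / real CARD('n)))
                  * nuclear_norm \<Theta>}
         \<ge> 1 - 2 * exp (- real CARD('n) / 32)"
proof -
  interpret prob_space M by fact
  define N where "N = real CARD('n)"
  define c where "c = sqrt (real CARD('k)) + sqrt (real CARD('p))"
  have N: "N > 0" by (simp add: N_def)
  have NS: "N / sqrt N = sqrt N" using N by (simp add: real_div_sqrt)
  have c: "0 < c" unfolding c_def by (intro add_pos_pos) auto
  have coeff: "sqrt (real CARD('k) / real CARD('n)) + sqrt (real CARD('p) / real CARD('n)) = c / sqrt N"
    by (simp add: c_def N_def real_sqrt_divide add_divide_distrib)
  have rv[measurable]: "random_variable borel (X i)" for i using assms(2) by (simp add: indep_vars_def)
  define f where "f \<omega> \<Theta> = norm (trace_operator (\<lambda>i. X i \<omega>) \<Theta>) / sqrt N - norm \<Theta> / 4 + c / sqrt N * nuclear_norm \<Theta>" for \<omega> \<Theta>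
  have f_meas[measurable]: "(\<lambda>\<omega>. f \<omega> \<Theta>) \<in> borel_measurable M" for \<Theta>
    unfolding f_def norm_trace_operator by measurable
  have f_cont: "continuous_on UNIV (f \<omega>)" for \<omega>
    unfolding f_def norm_trace_operator using N
    by (intro continuous_intros continuous_nuclear_norm) auto
  have f_scale: "f \<omega> (r *\<^sub>R \<Theta>) = r * f \<omega> \<Theta>" if "r \<ge> 0" for \<omega> r \<Theta>
  proof -
    have "norm (trace_operator (\<lambda>i. X i \<omega>) (r *\<^sub>R \<Theta>)) = r * norm (trace_operator (\<lambda>i. X i \<omega>) \<Theta>)"
      using that by (simp add: norm_trace_operator power_mult_distrib sum_distrib_left[symmetric] real_sqrt_mult)
    then show ?thesis using that by (simp add: f_def nuclear_norm_scaleR algebra_simps)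
  qed
  have f_zero: "0 \<le> f \<omega> 0" for \<omega>
    using nuclear_norm_nonneg[of "0 :: real^'p^'k"] c N by (simp add: f_def)
  \<comment> \<open>The matrices violating the inequality form an open set, so a violation is
    visible on a countable dense set. This also makes the event over all \<Theta>
    measurable.\<close>
  obtain D :: "(real^'p^'k) set" where D: "countable D" "\<And>U. open U \<Longrightarrow> U \<noteq> {} \<Longrightarrow> \<exists>d\<in>D. d \<in> U"
    using countable_dense_setE by blast
  have "D \<noteq> {}" using D(2)[of UNIV] by auto
  then have rangeD: "range (from_nat_into D) = D" using D(1) by (rule range_from_nat_into)
  let ?E = "{\<omega> \<in> space M. \<forall>\<Theta>. 0 \<le> f \<omega> \<Theta>}"
  \<comment> \<open>An increasing sequence of events, each involving finitely many matrices; the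
    uniform bound on them passes to their union.\<close>
  define A where "A n = {\<omega> \<in> space M. \<exists>j\<le>n. f \<omega> (from_nat_into D j) < 0}" for n :: nat
  have A_sets: "A n \<in> sets M" for n unfolding A_def by measurable
  have E_eq: "?E = space M - (\<Union>n. A n)"
  proof -
    have "(\<forall>\<Theta>. 0 \<le> f \<omega> \<Theta>) \<longleftrightarrow> (\<forall>d\<in>D. 0 \<le> f \<omega> d)" for \<omega>
    proof
      assume nonneg: "\<forall>d\<in>D. 0 \<le> f \<omega> d"
      have "open {\<Theta>. f \<omega> \<Theta> < 0}"
        using f_cont by (intro open_Collect_less continuous_intros) auto
      then have "{\<Theta>. f \<omega> \<Theta> < 0} = {}" using D(2)[of "{\<Theta>. f \<omega> \<Theta> < 0}"] nonneg by (metis mem_Collect_eq not_less)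
      then show "\<forall>\<Theta>. 0 \<le> f \<omega> \<Theta>" by (simp add: not_less)
    qed auto
    moreover have "(\<forall>d\<in>D. 0 \<le> f \<omega> d) \<longleftrightarrow> (\<forall>j. 0 \<le> f \<omega> (from_nat_into D j))" for \<omega>
      by (subst (1) rangeD[symmetric]) auto
    ultimately have "(\<forall>\<Theta>. 0 \<le> f \<omega> \<Theta>) \<longleftrightarrow> \<not> (\<exists>n. \<exists>j\<le>n. f \<omega> (from_nat_into D j) < 0)" for \<omega>
      by (meson le_refl not_less)
    then show ?thesis unfolding A_def by blast
  qed
  have A_le: "prob (A n) \<le> exp (- N / 32)" for n
  proof -
    \<comment> \<open>Homogeneity allows passing to \<open>sgn\<close>. The condition
      \<open>norm t = 1\<close> excludes the value \<open>sgn 0 = 0\<close>, and the bound on the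
      nuclear norm loses nothing, since a violation at \<open>t\<close> forces it.\<close>
    define T where "T = {t \<in> (\<lambda>j. sgn (from_nat_into D j)) ` {..n}. norm t = 1 \<and> c * nuclear_norm t \<le> sqrt N / 4}"
    have T: "finite T" "\<And>t. t \<in> T \<Longrightarrow> norm t = 1" "\<And>t. t \<in> T \<Longrightarrow> c * nuclear_norm t \<le> sqrt N / 4"
      by (auto simp: T_def)
    let ?B = "{\<omega>\<in>space M. \<exists>t\<in>T. (\<Sum>i\<in>UNIV. min \<bar>X i \<omega> \<bullet> t\<bar> (3 / 2)) < N / 4 - c * sqrt N * nuclear_norm t}"
    have "A n \<subseteq> ?B"
    proof
      fix \<omega> assume "\<omega> \<in> A n"
      then obtain j where j: "\<omega> \<in> space M" "j \<le> n" "f \<omega> (from_nat_into D j) < 0" by (auto simp: A_def)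
      define t where "t = sgn (from_nat_into D j)"
      have nz: "from_nat_into D j \<noteq> 0" using f_zero[of \<omega>] j(3) by auto
      then have t1: "norm t = 1" by (simp add: t_def norm_sgn)
      have "f \<omega> t < 0" unfolding t_def sgn_div_norm using nz j(3) by (subst f_scale) (auto intro!: mult_pos_neg)
      then have lt: "norm (trace_operator (\<lambda>i. X i \<omega>) t) / sqrt N < 1 / 4 - c / sqrt N * nuclear_norm t"
        using t1 by (simp add: f_def)
      moreover have "0 \<le> norm (trace_operator (\<lambda>i. X i \<omega>) t) / sqrt N" using N by simp
      \<comment> \<open>A nonnegative left side can be violated only where the right side is
        positive; this is where matrices with a large nuclear norm are ruled out.\<close>
      ultimately have "c / sqrt N * nuclear_norm t \<le> 1 / 4" by linarith
      then have "c * nuclear_norm t \<le> sqrt N / 4" using N by (simp add: field_simps)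
      then have tT: "t \<in> T" using t1 j(2) by (auto simp: T_def t_def)
      have "(\<Sum>i\<in>UNIV. min \<bar>X i \<omega> \<bullet> t\<bar> (3 / 2)) \<le> (\<Sum>i\<in>UNIV. \<bar>X i \<omega> \<bullet> t\<bar>)" by (intro sum_mono) auto
      also have "\<dots> \<le> sqrt N * norm (trace_operator (\<lambda>i. X i \<omega>) t)"
        unfolding N_def by (rule sum_abs_le_norm_trace_operator)
      also have "\<dots> = N * (norm (trace_operator (\<lambda>i. X i \<omega>) t) / sqrt N)"
        by (subst NS[symmetric]) simp
      also have "\<dots> < N * (1 / 4 - c / sqrt N * nuclear_norm t)"
        using lt N by (intro mult_strict_left_mono)
      also have "\<dots> = N / 4 - c * sqrt N * nuclear_norm t"
        by (subst (2) NS[symmetric]) (simp add: algebra_simps)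
      finally show "\<omega> \<in> ?B" using tT j(1) by blast
    qed
    moreover have "?B \<in> sets M" using T(1) by measurable
    ultimately have "prob (A n) \<le> prob ?B" by (rule finite_measure_mono)
    also have "\<dots> \<le> exp (- N / 32)"
      using finite_failure_probability[OF assms T(1,2)] T(3) by (simp add: N_def c_def)
    finally show ?thesis .
  qed
  have "(\<lambda>n. prob (A n)) \<longlonglongrightarrow> prob (\<Union>n. A n)"
    by (rule finite_Lim_measure_incseq) (use A_sets in \<open>auto simp: A_def incseq_def intro: order_trans\<close>)
  then have "prob (\<Union>n. A n) \<le> exp (- N / 32)"
    using A_le by (intro LIMSEQ_le_const2) auto
  then have "prob ?E \<ge> 1 - exp (- N / 32)"
    unfolding E_eq using A_sets by (subst prob_compl) auto
  moreover have "exp (- N / 32) \<le> 2 * exp (- N / 32)" by simp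
  ultimately have "prob ?E \<ge> 1 - 2 * exp (- N / 32)" by linarith
  then show ?thesis
    unfolding coeff frobenius_norm_eq_norm by (simp add: f_def N_def algebra_simps)
qed

end
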